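(* Let $p\ge 1$ and let $\mathfrak{n}$ be a $p$-filiform complex Lie algebra. Then $\mathfrak{n}$ admits a grading $\mathfrak{n}=\bigoplus_{i\leq -1}\mathfrak{n}_{i}$ satisfying the conditions (W) and (H) if and only if $\dim \mathfrak{n}<p+3$. Equivalently, a $p$-filiform complex Lie algebra $\mathfrak{n}$ admits a grading $\mathfrak{n}=\bigoplus_{i\leq -1}\mathfrak{n}_i$ satisfying (W) and (H) if and only if $\mathfrak{n}$ is either abelian or $2$-step nilpotent.
   Context: For a Lie algebra $\mathfrak{n}$ put $C^0\mathfrak{n}:=\mathfrak{n}$ and $C^i\mathfrak{n}:=[\mathfrak{n},C^{i-1}\mathfrak{n}]$ for $i\ge1$; $\mathfrak{n}$ is $k$-step nilpotent if $C^k\mathfrak{n}=0$ and $C^{k-1}\mathfrak{n}\ne 0$. An $m$-dimensional nilpotent Lie algebra $\mathfrak{n}$ is called $p$-filiform (for an integer $1\le p\le m-1$) if $\dim C^i\mathfrak{n}=m-i-p$ for all $1\le i\le m-p$. A grading $\mathfrak{n}=\bigoplus_{i\le -1}\mathfrak{n}_i$ is a vector space decomposition with $[\mathfrak{n}_i,\mathfrak{n}_j]\subset\mathfrak{n}_{i+j}$ for all $i,j$. Let $d:\mathfrak{n}^*\to\bigwedge^2\mathfrak{n}^*$ be the dual of the bracket, extended to $\bigwedge^\bullet\mathfrak{n}^*$ by the (graded) Leibniz rule, and $H^\bullet(\mathfrak{n})=\operatorname{Ker} d/\operatorname{Im} d$ the Lie algebra cohomology. The grading induces $\bigwedge^j\mathfrak{n}^*=\bigoplus_k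 C_k^j$, where $C_k^j$ is the sum over $i_1+\cdots+i_j=k$ of $\mathfrak{n}_{-i_1}^*\wedge\cdots\wedge\mathfrak{n}_{-i_j}^*$; then $d(C_k^j)\subset C_k^{j+1}$ and $H^j(\mathfrak{n})=\bigoplus_k H_k^j$ with $H_k^j=\operatorname{Ker}(d:C_k^j\to C_k^{j+1})/\operatorname{Im}(d:C_k^{j-1}\to C_k^j)$. The conditions are: (W): $H^1(\mathfrak{n})=H_1^1\oplus H_2^1$ and $H^2(\mathfrak{n})=H_2^2\oplus H_3^2\oplus H_4^2$. (H): for every odd integer $k$ (and every $j$), $\dim\mathfrak{n}_k$ and $\dim H_k^j$ are even. *)

theory Defs
  imports
    Complex_Main
    "HOL-Library.FuncSet"
    "HOL-Library.Function_Algebras"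
    "HOL-Library.Set_Algebras"
begin

subsection \<open>Quotients of subspaces\<close>

locale vector_space_quotient = vector_space
begin

definition quotient_space :: "'b set \<Rightarrow> 'b set \<Rightarrow> 'b set set" where
  "quotient_space K I = (\<lambda>x. x +o I) ` K"

text \<open>The vectors of \<open>B\<close> represent a basis of \<open>K/I\<close>; uniqueness of the coefficients also makes the
  classes of distinct elements of \<open>B\<close> distinct.\<close>

definition quotient_basis :: "'b set \<Rightarrow> 'b set \<Rightarrow> 'b set \<Rightarrow> bool" where
  "quotient_basis K I B \<longleftrightarrow> finite B \<and> B \<subseteq> K \<and>
     (\<forall>X \<in> quotient_space K I. \<exists>!c. c \<in> B \<rightarrow>\<^sub>E UNIV \<and> X = (\<Sum>b\<in>B. scale (c b) b) +o I)"

text \<open>The dimension of a finite-dimensional quotient \<open>K/I\<close>; for infinite-dimensional quotients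
  the value is meaningless.\<close>

definition quotient_dim :: "'b set \<Rightarrow> 'b set \<Rightarrow> nat" where
  "quotient_dim K I = card (SOME B. quotient_basis K I B)"

lemma coset_eq_iff:
  assumes "subspace I"
  shows "x +o I = y +o I \<longleftrightarrow> x - y \<in> I"
proof
  assume "x +o I = y +o I"
  moreover have "x \<in> x +o I"
    using subspace_0[OF assms] by (force simp: elt_set_plus_def)
  ultimately show "x - y \<in> I" by (auto simp: elt_set_plus_def)
next
  assume *: "x - y \<in> I"
  have "x + b \<in> y +o I" if "b \<in> I" for b
    using subspace_add[OF assms * that] by (auto simp: elt_set_plus_def intro!: bexI[of _ "x - y + b"])
  moreover have "y + b \<in> x +o I" if "b \<in> I" for b
    using subspace_diff[OF assms that *] by (auto simp: elt_set_plus_def intro!: bexI[of _ "b - (x - y)"])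
  ultimately show "x +o I = y +o I" by (auto simp: elt_set_plus_def)
qed

lemma quotient_basis_iff:
  assumes "subspace I"
  shows "quotient_basis K I B \<longleftrightarrow> finite B \<and> B \<subseteq> K \<and>
     (\<forall>x\<in>K. \<exists>!c. c \<in> B \<rightarrow>\<^sub>E UNIV \<and> x - (\<Sum>b\<in>B. scale (c b) b) \<in> I)"
  by (simp add: quotient_basis_def quotient_space_def coset_eq_iff[OF assms])

lemma quotient_basis_extends:
  assumes K: "subspace K" and I: "subspace I" and IK: "I \<subseteq> K"
    and A: "independent A" "A \<subseteq> I" "I \<subseteq> span A" and finA: "finite A"
    and B: "quotient_basis K I B"
  shows "A \<inter> B = {}" "independent (A \<union> B)" "K \<subseteq> span (A \<union> B)"
proof -
  have finB: "finite B" and BK: "B \<subseteq> K"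
    and ex1: "\<And>x. x \<in> K \<Longrightarrow> \<exists>!c. c \<in> B \<rightarrow>\<^sub>E UNIV \<and> x - (\<Sum>b\<in>B. scale (c b) b) \<in> I"
    using B unfolding quotient_basis_iff[OF I] by auto
  have spanA: "span A = I"
    using A I by (metis span_minimal subset_antisym)
  have zero: "\<forall>b\<in>B. u b = 0" if "(\<Sum>b\<in>B. scale (u b) b) \<in> I" for u
  proof -
    have uniq: "c = e" if "c \<in> B \<rightarrow>\<^sub>E UNIV \<and> 0 - (\<Sum>b\<in>B. scale (c b) b) \<in> I"
      "e \<in> B \<rightarrow>\<^sub>E UNIV \<and> 0 - (\<Sum>b\<in>B. scale (e b) b) \<in> I" for c e
      using ex1[OF subspace_0[OF K]] that by (elim ex1E) (metis (no_types))
    have "restrict u B = restrict (\<lambda>_. 0) B"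
      by (rule uniq) (use subspace_neg[OF I that] subspace_0[OF I] in simp_all)
    then show ?thesis by (metis restrict_apply')
  qed
  show disj: "A \<inter> B = {}"
  proof (rule ccontr)
    assume "A \<inter> B \<noteq> {}"
    then obtain x where x: "x \<in> B" "x \<in> I" using A by auto
    have "(\<Sum>b\<in>B. scale (if b = x then 1 else 0) b) = x"
      using x finB by (simp add: if_distrib[of "\<lambda>c. scale c _"] cong: if_cong)
    then have "(if x = x then 1 else 0::'a) = 0"
      using zero[of "\<lambda>b. if b = x then 1 else 0"] x by auto
    then show False by simp
  qed
  show "independent (A \<union> B)"
  proof (rule independent_if_scalars_zero)
    show "finite (A \<union> B)" using finA finB by simp
    fix f x assume sum0: "(\<Sum>x\<in>A \<union> B. scale (f x) x) = 0" and x: "x \<in> A \<union> B"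
    have split: "(\<Sum>x\<in>A. scale (f x) x) + (\<Sum>x\<in>B. scale (f x) x) = 0"
      using sum0 by (simp add: sum.union_disjoint[OF finA finB disj])
    have "(\<Sum>x\<in>A. scale (f x) x) \<in> I"
      using A by (intro subspace_sum[OF I] subspace_scale[OF I]) auto
    then have "(\<Sum>x\<in>B. scale (f x) x) \<in> I"
      using split subspace_neg[OF I] by (metis add_eq_0_iff)
    then have fB: "\<forall>b\<in>B. f b = 0" by (rule zero)
    then have "(\<Sum>x\<in>A. scale (f x) x) = 0" using split by simp
    then have "\<forall>a\<in>A. f a = 0" using A(1) finA independent_explicit_finite_subsets by blast
    with fB x show "f x = 0" by auto
  qed
  show "K \<subseteq> span (A \<union> B)"
  proof
    fix x assume "x \<in> K"
    then obtain c where "x - (\<Sum>b\<in>B. scale (c b) b) \<in> I" using ex1 by blast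
    then have "x - (\<Sum>b\<in>B. scale (c b) b) \<in> span (A \<union> B)"
      using spanA span_mono[of A "A \<union> B"] by auto
    moreover have "(\<Sum>b\<in>B. scale (c b) b) \<in> span (A \<union> B)"
      by (intro span_sum span_scale span_base) auto
    ultimately show "x \<in> span (A \<union> B)" by (metis diff_add_cancel span_add)
  qed
qed

lemma quotient_basis_exists:
  assumes K: "subspace K" and I: "subspace I" and IK: "I \<subseteq> K" and fin: "finite D" "K \<subseteq> span D"
  shows "\<exists>B. quotient_basis K I B"
proof -
  obtain A where A: "A \<subseteq> I" "independent A" "I \<subseteq> span A"
    by (metis basis_exists)
  obtain C where C: "A \<subseteq> C" "C \<subseteq> K" "independent C" "K \<subseteq> span C"
    using maximal_independent_subset_extend[of A K] A IK by blast
  have finC: "finite C"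
    using fin C independent_span_bound by (metis subset_trans)
  have spanA: "span A = I" using A I by (metis span_minimal subset_antisym)
  define B where "B = C - A"
  have finA: "finite A" and finB: "finite B" and CAB: "C = A \<union> B" and disj: "A \<inter> B = {}"
    using C(1) finC by (auto simp: B_def intro: finite_subset)
  have ex: "\<exists>c. c \<in> B \<rightarrow>\<^sub>E UNIV \<and> x - (\<Sum>b\<in>B. scale (c b) b) \<in> I" if "x \<in> K" for x
  proof -
    have "x \<in> span C" using that C by auto
    then obtain u where "x = (\<Sum>b\<in>C. scale (u b) b)"
      using span_finite[OF finC] by auto
    then have "x = (\<Sum>b\<in>A. scale (u b) b) + (\<Sum>b\<in>B. scale (u b) b)"
      unfolding CAB by (simp add: sum.union_disjoint[OF finA finB disj])
    moreover have "(\<Sum>b\<in>A. scale (u b) b) \<in> I"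
      using A by (intro subspace_sum[OF I] subspace_scale[OF I]) auto
    ultimately show ?thesis by (intro exI[of _ "restrict u B"]) auto
  qed
  have uniq: "c = e"
    if c: "c \<in> B \<rightarrow>\<^sub>E UNIV" "x - (\<Sum>b\<in>B. scale (c b) b) \<in> I"
      and e: "e \<in> B \<rightarrow>\<^sub>E UNIV" "x - (\<Sum>b\<in>B. scale (e b) b) \<in> I" for c e x
  proof -
    have "(\<Sum>b\<in>B. scale (c b - e b) b) \<in> I"
      using subspace_diff[OF I e(2) c(2)] by (simp add: scale_left_diff_distrib sum_subtractf)
    then obtain u where u: "(\<Sum>b\<in>B. scale (c b - e b) b) = (\<Sum>b\<in>A. scale (u b) b)"
      using span_finite[OF finA] spanA by auto
    define f where "f b = (if b \<in> A then - u b else c b - e b)" for b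
    have "(\<Sum>b\<in>C. scale (f b) b) = (\<Sum>b\<in>A. scale (f b) b) + (\<Sum>b\<in>B. scale (f b) b)"
      unfolding CAB by (simp add: sum.union_disjoint[OF finA finB disj])
    also have "(\<Sum>b\<in>A. scale (f b) b) = - (\<Sum>b\<in>A. scale (u b) b)"
      by (simp add: f_def sum_negf)
    also have "(\<Sum>b\<in>B. scale (f b) b) = (\<Sum>b\<in>B. scale (c b - e b) b)"
      using disj by (intro sum.cong) (auto simp: f_def)
    finally have "(\<Sum>b\<in>C. scale (f b) b) = 0" by (simp add: u)
    then have "\<forall>b\<in>C. f b = 0"
      using C(3) finC independent_explicit_finite_subsets by blast
    then have "c b = e b" if "b \<in> B" for b
      using that disj unfolding f_def CAB by (metis IntI Un_iff empty_iff right_minus_eq)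
    then show "c = e" using c(1) e(1) by (meson PiE_ext)
  qed
  have "quotient_basis K I B"
    unfolding quotient_basis_iff[OF I]
  proof (intro conjI ballI)
    show "B \<subseteq> K" using C(2) by (auto simp: B_def)
    fix x assume "x \<in> K"
    show "\<exists>!c. c \<in> B \<rightarrow>\<^sub>E UNIV \<and> x - (\<Sum>b\<in>B. scale (c b) b) \<in> I"
      by (rule ex_ex1I[OF ex[OF \<open>x \<in> K\<close>]]) (elim conjE, rule uniq)
  qed (rule finB)
  then show ?thesis ..
qed

lemma quotient_dim_eq:
  assumes K: "subspace K" and I: "subspace I" and IK: "I \<subseteq> K" and fin: "finite D" "K \<subseteq> span D"
  shows "quotient_dim K I = dim K - dim I"
proof -
  define B where "B = (SOME B. quotient_basis K I B)"
  have B: "quotient_basis K I B"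
    unfolding B_def using quotient_basis_exists[OF assms] by (rule someI_ex)
  obtain A where A: "A \<subseteq> I" "independent A" "I \<subseteq> span A" "card A = dim I"
    by (metis basis_exists)
  have finA: "finite A"
    using fin A IK independent_span_bound by (metis subset_trans)
  note ext = quotient_basis_extends[OF K I IK A(2,1,3) finA B]
  have "A \<union> B \<subseteq> K" "finite B" using A(1) IK B by (auto simp: quotient_basis_def)
  then have "dim K = card (A \<union> B)"
    using ext by (metis basis_card_eq_dim)
  then show ?thesis
    using ext(1) finA \<open>finite B\<close> A(4) by (simp add: card_Un_disjoint quotient_dim_def flip: B_def)
qed

end


subsection \<open>Forms and the wedge product\<close>

text \<open>A (possibly inhomogeneous) form on \<open>'a\<close> is a function on argument lists. Its component of degree
  \<open>j\<close> is its restriction to lists of length \<open>j\<close>.\<close>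

type_synonym 'a form = "'a list \<Rightarrow> complex"

definition form_scale :: "complex \<Rightarrow> 'a form \<Rightarrow> 'a form" where
  "form_scale c \<omega> = (\<lambda>xs. c * \<omega> xs)"

global_interpretation form: vector_space_quotient form_scale
  by unfold_locales (auto simp: form_scale_def algebra_simps fun_eq_iff)

definition form_one :: "'a form" where
  "form_one xs = (if xs = [] then 1 else 0)"

definition one_form :: "('a \<Rightarrow> complex) \<Rightarrow> 'a form" where
  "one_form \<alpha> xs = (if length xs = 1 then \<alpha> (hd xs) else 0)"

text \<open>The sign of the shuffle that lists the positions in \<open>S\<close> before the other positions below \<open>n\<close>.\<close>

definition shuffle_sign :: "nat \<Rightarrow> nat set \<Rightarrow> complex" where
  "shuffle_sign n S = (- 1) ^ card {(a, b). a < b \<and> b < n \<and> a \<notin> S \<and> b \<in> S}"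

definition wedge :: "'a form \<Rightarrow> 'a form \<Rightarrow> 'a form" where
  "wedge \<omega> \<eta> xs =
     (\<Sum>S\<in>Pow {..<length xs}. shuffle_sign (length xs) S * \<omega> (nths xs S) * \<eta> (nths xs (- S)))"

definition wedge_list :: "('a \<Rightarrow> complex) list \<Rightarrow> 'a form" where
  "wedge_list \<alpha>s = foldr (\<lambda>\<alpha> \<omega>. wedge (one_form \<alpha>) \<omega>) \<alpha>s form_one"


subsection \<open>Lie algebras\<close>

locale complex_lie_algebra = vector_space scale
  for scale :: "complex \<Rightarrow> 'a::ab_group_add \<Rightarrow> 'a" +
  fixes bracket :: "'a \<Rightarrow> 'a \<Rightarrow> 'a"
  assumes bracket_add_left: "bracket (x + y) z = bracket x z + bracket y z"
    and bracket_add_right: "bracket x (y + z) = bracket x y + bracket x z"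
    and bracket_scale_left: "bracket (scale c x) y = scale c (bracket x y)"
    and bracket_scale_right: "bracket x (scale c y) = scale c (bracket x y)"
    and bracket_self: "bracket x x = 0"
    and jacobi: "bracket x (bracket y z) + bracket y (bracket z x) + bracket z (bracket x y) = 0"
begin

definition abelian :: bool where
  "abelian \<longleftrightarrow> (\<forall>x y. bracket x y = 0)"

primrec lower_central :: "nat \<Rightarrow> 'a set" where
  "lower_central 0 = UNIV"
| "lower_central (Suc i) = span {bracket x y |x y. y \<in> lower_central i}"

definition nilpotent :: bool where
  "nilpotent \<longleftrightarrow> (\<exists>k. lower_central k = {0})"

definition step_nilpotent :: "nat \<Rightarrow> bool" where
  "step_nilpotent k \<longleftrightarrow> k \<ge> 1 \<and> lower_central k = {0} \<and> lower_central (k - 1) \<noteq> {0}"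

text \<open>Finite-dimensionality has to be required separately, because \<^const>\<open>dim\<close> is \<open>0\<close> on
  infinite-dimensional spaces.\<close>

definition filiform :: "nat \<Rightarrow> bool" where
  "filiform p \<longleftrightarrow> (\<exists>B. finite B \<and> span B = (UNIV :: 'a set)) \<and> nilpotent \<and>
     1 \<le> p \<and> p \<le> dim (UNIV :: 'a set) - 1 \<and>
     (\<forall>i. 1 \<le> i \<and> i \<le> dim (UNIV :: 'a set) - p \<longrightarrow>
        dim (lower_central i) = dim (UNIV :: 'a set) - i - p)"

text \<open>A grading is indexed by all integers, with zero components in the degrees \<open>i \<ge> 0\<close>.\<close>

definition negative_grading :: "(int \<Rightarrow> 'a set) \<Rightarrow> bool" where
  "negative_grading g \<longleftrightarrow>
     (\<forall>i. subspace (g i)) \<and> (\<forall>i\<ge>0. g i = {0}) \<and>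
     (\<forall>x. \<exists>!f. (\<forall>i. f i \<in> g i) \<and> finite {i. f i \<noteq> 0} \<and> x = (\<Sum>i\<in>{i. f i \<noteq> 0}. f i)) \<and>
     (\<forall>i j. \<forall>x\<in>g i. \<forall>y\<in>g j. bracket x y \<in> g (i + j))"


subsection \<open>The exterior algebra of the dual and its differential\<close>

definition dual :: "('a \<Rightarrow> complex) set" where
  "dual = {\<alpha>. Vector_Spaces.linear scale (*) \<alpha>}"

definition ext_power :: "nat \<Rightarrow> 'a form set" where
  "ext_power j = form.span {wedge_list \<alpha>s |\<alpha>s. length \<alpha>s = j \<and> set \<alpha>s \<subseteq> dual}"

text \<open>The dual of the component of degree \<open>i\<close>, as a subspace of the dual of the whole algebra.\<close>

definition graded_dual :: "(int \<Rightarrow> 'a set) \<Rightarrow> int \<Rightarrow> ('a \<Rightarrow> complex) set" where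
  "graded_dual g i = {\<alpha> \<in> dual. \<forall>l. l \<noteq> i \<longrightarrow> (\<forall>x\<in>g l. \<alpha> x = 0)}"

definition ext_power_graded :: "(int \<Rightarrow> 'a set) \<Rightarrow> nat \<Rightarrow> int \<Rightarrow> 'a form set" where
  "ext_power_graded g j k = form.span {wedge_list \<alpha>s |\<alpha>s is.
     length is = j \<and> sum_list is = k \<and> list_all2 (\<lambda>\<alpha> i. \<alpha> \<in> graded_dual g (- i)) \<alpha>s is}"

text \<open>The differential, with the sign for which \<open>d \<alpha> (x, y) = \<alpha> [x, y]\<close> on 1-forms. The bracket stands
  in the later slot \<open>l\<close>; moving it to the front gives the usual form
  \<open>\<Sum>i<l. (- 1) ^ (i + l + 1) \<omega> ([x\<^sub>i, x\<^sub>l], \<dots>)\<close> with \<open>x\<^sub>i\<close> and \<open>x\<^sub>l\<close> omitted. That this is the graded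
  derivation extending the dual of the bracket is shown in \<open>ce_d_one_form\<close>, \<open>ce_d_wedge\<close> and
  \<open>ce_d_unique\<close> below.\<close>

definition ce_d :: "'a form \<Rightarrow> 'a form" where
  "ce_d \<omega> xs = (\<Sum>l<length xs. \<Sum>i<l.
     (- 1) ^ i * \<omega> (take i xs @ drop (Suc i) (xs[l := bracket (xs ! i) (xs ! l)])))"

definition cocycles :: "nat \<Rightarrow> 'a form set" where
  "cocycles j = {\<omega> \<in> ext_power j. ce_d \<omega> = 0}"

definition coboundaries :: "nat \<Rightarrow> 'a form set" where
  "coboundaries j = (case j of 0 \<Rightarrow> {0} | Suc i \<Rightarrow> ce_d ` ext_power i)"

definition cohomology :: "nat \<Rightarrow> 'a form set set" where
  "cohomology j = form.quotient_space (cocycles j) (coboundaries j)"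

definition cocycles_graded :: "(int \<Rightarrow> 'a set) \<Rightarrow> nat \<Rightarrow> int \<Rightarrow> 'a form set" where
  "cocycles_graded g j k = {\<omega> \<in> ext_power_graded g j k. ce_d \<omega> = 0}"

definition coboundaries_graded :: "(int \<Rightarrow> 'a set) \<Rightarrow> nat \<Rightarrow> int \<Rightarrow> 'a form set" where
  "coboundaries_graded g j k = (case j of 0 \<Rightarrow> {0} | Suc i \<Rightarrow> ce_d ` ext_power_graded g i k)"

definition cohomology_graded :: "(int \<Rightarrow> 'a set) \<Rightarrow> nat \<Rightarrow> int \<Rightarrow> 'a form set set" where
  "cohomology_graded g j k = form.quotient_space (cocycles_graded g j k) (coboundaries_graded g j k)"

definition cohomology_graded_dim :: "(int \<Rightarrow> 'a set) \<Rightarrow> nat \<Rightarrow> int \<Rightarrow> nat" where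
  "cohomology_graded_dim g j k =
     form.quotient_dim (cocycles_graded g j k) (coboundaries_graded g j k)"

text \<open>The canonical map from the direct sum of the graded pieces with weights in \<open>W\<close> to the cohomology
  is bijective. Adding \<^term>\<open>coboundaries j\<close> to a sum of classes modulo graded coboundaries gives the
  class modulo all coboundaries.\<close>

definition cohomology_is_sum :: "(int \<Rightarrow> 'a set) \<Rightarrow> nat \<Rightarrow> int set \<Rightarrow> bool" where
  "cohomology_is_sum g j W \<longleftrightarrow>
     bij_betw (\<lambda>X. (\<Sum>k\<in>W. X k) + coboundaries j)
       (\<Pi>\<^sub>E k\<in>W. cohomology_graded g j k) (cohomology j)"

definition condition_W :: "(int \<Rightarrow> 'a set) \<Rightarrow> bool" where
  "condition_W g \<longleftrightarrow> cohomology_is_sum g 1 {1, 2} \<and> cohomology_is_sum g 2 {2, 3, 4}"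

definition condition_H :: "(int \<Rightarrow> 'a set) \<Rightarrow> bool" where
  "condition_H g \<longleftrightarrow>
     (\<forall>k. odd k \<longrightarrow> even (dim (g k)) \<and> (\<forall>j. even (cohomology_graded_dim g j k)))"

end


subsection \<open>The differential as a derivation\<close>

lemma wedge_Nil: "wedge \<omega> \<eta> [] = \<omega> [] * \<eta> []"
  by (simp add: wedge_def shuffle_sign_def)

lemma shuffle_sign_image_Suc:
  assumes T: "T \<subseteq> {..<n}"
  shows "shuffle_sign (Suc n) (Suc ` T) = (- 1) ^ card T * shuffle_sign n T"
    and "shuffle_sign (Suc n) (insert 0 (Suc ` T)) = shuffle_sign n T"
proof -
  define P where "P = {(a, b). a < b \<and> b < n \<and> a \<notin> T \<and> b \<in> T}"
  have finP: "finite P" by (rule finite_subset[of _ "{..<n} \<times> {..<n}"]) (auto simp: P_def)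
  have finT: "finite T" using T finite_subset by blast
  let ?s = "map_prod Suc Suc"
  have inj: "inj_on ?s P" by (auto simp: inj_on_def)
  have "{(a, b). a < b \<and> b < Suc n \<and> a \<notin> Suc ` T \<and> b \<in> Suc ` T} = ?s ` P \<union> (\<lambda>b. (0, Suc b)) ` T"
    (is "?L = ?R")
  proof
    show "?L \<subseteq> ?R"
    proof
      fix z assume "z \<in> ?L"
      then obtain a b where z: "z = (a, Suc b)" and *: "a < Suc b" "b < n" "a \<notin> Suc ` T" "b \<in> T"
        by auto
      show "z \<in> ?R"
      proof (cases a)
        case (Suc a')
        with * have "(a', b) \<in> P" by (auto simp: P_def)
        then show ?thesis unfolding z Suc by force
      qed (use z * in auto)
    qed
  qed (use T in \<open>auto simp: P_def\<close>)
  moreover have "?s ` P \<inter> (\<lambda>b. (0, Suc b)) ` T = {}" by auto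
  moreover have "card ((\<lambda>b. (0::nat, Suc b)) ` T) = card T"
    by (intro card_image) (auto simp: inj_on_def)
  ultimately show "shuffle_sign (Suc n) (Suc ` T) = (- 1) ^ card T * shuffle_sign n T"
    using finP finT inj unfolding shuffle_sign_def P_def[symmetric]
    by (simp add: card_Un_disjoint card_image power_add)
  have "{(a, b). a < b \<and> b < Suc n \<and> a \<notin> insert 0 (Suc ` T) \<and> b \<in> insert 0 (Suc ` T)} = ?s ` P"
    (is "?L = ?R")
  proof
    show "?L \<subseteq> ?R"
    proof
      fix z assume "z \<in> ?L"
      then obtain a b where z: "z = (a, Suc b)" and *: "a < Suc b" "b < n" "a \<noteq> 0"
          "a \<notin> Suc ` T" "b \<in> T"
        by auto
      from \<open>a \<noteq> 0\<close> obtain a' where a': "a = Suc a'" by (cases a) auto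
      with * have "(a', b) \<in> P" by (auto simp: P_def)
      then show "z \<in> ?R" unfolding z a' by force
    qed
  qed (auto simp: P_def)
  then show "shuffle_sign (Suc n) (insert 0 (Suc ` T)) = shuffle_sign n T"
    using inj unfolding shuffle_sign_def P_def[symmetric] by (simp add: card_image)
qed

lemma Pow_lessThan_Suc:
  "Pow {..<Suc n} = (\<lambda>T. insert 0 (Suc ` T)) ` Pow {..<n} \<union> image Suc ` Pow {..<n}"
proof -
  have "Pow (Suc ` {..<n}) = image Suc ` Pow {..<n}"
    using image_Pow_surj[of Suc "{..<n}" "Suc ` {..<n}"] by simp
  then show ?thesis
    by (simp add: lessThan_Suc_eq_insert_0 Pow_insert image_image Un_commute)
qed

text \<open>Contraction by the first argument is an antiderivation.\<close>

lemma wedge_Cons: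
  "wedge \<omega> \<eta> (x # xs) =
     wedge (\<lambda>ys. \<omega> (x # ys)) \<eta> xs + wedge (\<lambda>ys. (- 1) ^ length ys * \<omega> ys) (\<lambda>ys. \<eta> (x # ys)) xs"
proof -
  let ?n = "length xs"
  let ?f = "\<lambda>S. shuffle_sign (Suc ?n) S * \<omega> (nths (x # xs) S) * \<eta> (nths (x # xs) (- S))"
  have inj: "inj_on (image Suc) A" for A :: "nat set set"
    by (auto simp: inj_on_def inj_image_eq_iff)
  have inj0: "inj_on (\<lambda>T. insert 0 (Suc ` T)) A" for A :: "nat set set"
  proof (rule inj_onI)
    fix S T assume "insert 0 (Suc ` S) = insert 0 (Suc ` T)"
    moreover have "0 \<notin> Suc ` S" "0 \<notin> Suc ` T" by auto
    ultimately have "Suc ` S = Suc ` T" using insert_ident by metis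
    then show "S = T" by (simp add: inj_image_eq_iff)
  qed
  have len: "length (nths xs T) = card T" if "T \<subseteq> {..<?n}" for T
  proof -
    have "{i. i < ?n \<and> i \<in> T} = T" using that by auto
    then show ?thesis by (simp add: length_nths)
  qed
  have compl: "{j. Suc j \<in> - (Suc ` T)} = - T" "{j. Suc j \<in> - insert 0 (Suc ` T)} = - T"
    "{j. Suc j \<in> Suc ` T} = T" "{j. Suc j \<in> insert 0 (Suc ` T)} = T" for T
    by auto
  have f0: "?f (insert 0 (Suc ` T)) =
      shuffle_sign ?n T * \<omega> (x # nths xs T) * \<eta> (nths xs (- T))" if "T \<subseteq> {..<?n}" for T
    unfolding nths_Cons compl shuffle_sign_image_Suc[OF that] by simp
  have f1: "?f (Suc ` T) = shuffle_sign ?n T * ((- 1) ^ length (nths xs T) * \<omega> (nths xs T)) *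
      \<eta> (x # nths xs (- T))" if "T \<subseteq> {..<?n}" for T
    unfolding nths_Cons compl shuffle_sign_image_Suc[OF that] len[OF that] by auto
  have "wedge \<omega> \<eta> (x # xs) = (\<Sum>S\<in>Pow {..<Suc ?n}. ?f S)" by (simp add: wedge_def)
  also have "\<dots> = (\<Sum>S\<in>(\<lambda>T. insert 0 (Suc ` T)) ` Pow {..<?n}. ?f S)
      + (\<Sum>S\<in>image Suc ` Pow {..<?n}. ?f S)"
    unfolding Pow_lessThan_Suc by (rule sum.union_disjoint) auto
  also have "\<dots> = (\<Sum>T\<in>Pow {..<?n}. ?f (insert 0 (Suc ` T))) + (\<Sum>T\<in>Pow {..<?n}. ?f (Suc ` T))"
    by (simp only: sum.reindex[OF inj] sum.reindex[OF inj0] o_def)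
  also have "(\<Sum>T\<in>Pow {..<?n}. ?f (insert 0 (Suc ` T))) = wedge (\<lambda>ys. \<omega> (x # ys)) \<eta> xs"
    unfolding wedge_def by (intro sum.cong refl f0) auto
  also have "(\<Sum>T\<in>Pow {..<?n}. ?f (Suc ` T)) =
      wedge (\<lambda>ys. (- 1) ^ length ys * \<omega> ys) (\<lambda>ys. \<eta> (x # ys)) xs"
    unfolding wedge_def by (intro sum.cong refl f1) auto
  finally show ?thesis .
qed

lemma wedge_add_left: "wedge (\<lambda>ys. \<omega> ys + \<omega>' ys) \<eta> xs = wedge \<omega> \<eta> xs + wedge \<omega>' \<eta> xs"
  by (simp add: wedge_def ring_distribs sum.distrib)

lemma wedge_add_right: "wedge \<omega> (\<lambda>ys. \<eta> ys + \<eta>' ys) xs = wedge \<omega> \<eta> xs + wedge \<omega> \<eta>' xs"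
  by (simp add: wedge_def ring_distribs sum.distrib)

lemma wedge_diff_left: "wedge (\<lambda>ys. \<omega> ys - \<omega>' ys) \<eta> xs = wedge \<omega> \<eta> xs - wedge \<omega>' \<eta> xs"
  by (simp add: wedge_def ring_distribs sum_subtractf)

lemma wedge_diff_right: "wedge \<omega> (\<lambda>ys. \<eta> ys - \<eta>' ys) xs = wedge \<omega> \<eta> xs - wedge \<omega> \<eta>' xs"
  by (simp add: wedge_def ring_distribs sum_subtractf)

lemma wedge_scale_left: "wedge (\<lambda>ys. c * \<omega> ys) \<eta> xs = c * wedge \<omega> \<eta> xs"
  by (simp add: wedge_def sum_distrib_left mult_ac)

lemma wedge_minus_left: "wedge (\<lambda>ys. - \<omega> ys) \<eta> xs = - wedge \<omega> \<eta> xs"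
  by (simp add: wedge_def sum_negf)

lemma wedge_minus_right: "wedge \<omega> (\<lambda>ys. - \<eta> ys) xs = - wedge \<omega> \<eta> xs"
  by (simp add: wedge_def sum_negf)

context complex_lie_algebra
begin

text \<open>Minus the Lie derivative along \<open>x\<close>.\<close>

definition lie_der :: "'a \<Rightarrow> 'a form \<Rightarrow> 'a form" where
  "lie_der x \<omega> xs = (\<Sum>l<length xs. \<omega> (xs[l := bracket x (xs ! l)]))"

lemma lie_der_Nil [simp]: "lie_der x \<omega> [] = 0"
  by (simp add: lie_der_def)

lemma lie_der_Cons:
  "lie_der x \<omega> (y # ys) = \<omega> (bracket x y # ys) + lie_der x (\<lambda>zs. \<omega> (y # zs)) ys"
  by (simp add: lie_der_def sum.lessThan_Suc_shift del: sum.lessThan_Suc)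

lemma ce_d_Nil [simp]: "ce_d \<omega> [] = 0"
  by (simp add: ce_d_def)

text \<open>Cartan's formula.\<close>

lemma ce_d_Cons: "ce_d \<omega> (x # xs) = lie_der x \<omega> xs - ce_d (\<lambda>ys. \<omega> (x # ys)) xs"
  by (simp add: ce_d_def lie_der_def sum.lessThan_Suc_shift sum.distrib sum_negf sum_subtractf del: sum.lessThan_Suc)

lemma lie_der_sign:
  "lie_der x (\<lambda>ys. (- 1) ^ length ys * \<omega> ys) xs = (- 1) ^ length xs * lie_der x \<omega> xs"
  by (simp add: lie_der_def sum_distrib_left)

lemma ce_d_sign:
  "ce_d (\<lambda>ys. (- 1) ^ length ys * \<omega> ys) xs = - ((- 1) ^ length xs * ce_d \<omega> xs)"
proof (induction xs arbitrary: \<omega>)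
  case (Cons x xs)
  have "ce_d (\<lambda>ys. - ((- 1) ^ length ys * \<omega> (x # ys))) xs = - ce_d (\<lambda>ys. (- 1) ^ length ys * \<omega> (x # ys)) xs"
    by (simp add: ce_d_def sum_negf)
  then show ?case by (simp add: ce_d_Cons lie_der_sign Cons.IH right_diff_distrib)
qed simp

lemma lie_der_add: "lie_der x (\<lambda>ys. \<omega> ys + \<eta> ys) xs = lie_der x \<omega> xs + lie_der x \<eta> xs"
  by (simp add: lie_der_def sum.distrib)

lemma ce_d_add_apply: "ce_d (\<lambda>ys. \<omega> ys + \<eta> ys) xs = ce_d \<omega> xs + ce_d \<eta> xs"
  by (simp add: ce_d_def sum.distrib ring_distribs)

lemma ce_d_linear: "Vector_Spaces.linear form_scale form_scale ce_d"
  by unfold_locales (auto simp: fun_eq_iff ce_d_def form_scale_def ring_distribs sum.distrib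
      sum_distrib_left algebra_simps)

lemma lie_der_wedge:
  "lie_der x (wedge \<omega> \<eta>) xs = wedge (lie_der x \<omega>) \<eta> xs + wedge \<omega> (lie_der x \<eta>) xs"
proof (induction xs arbitrary: \<omega> \<eta>)
  case (Cons y ys)
  show ?case
    by (simp add: lie_der_Cons wedge_Cons lie_der_add Cons.IH wedge_add_left wedge_add_right
        lie_der_sign ring_distribs cong: if_cong)
qed (simp add: wedge_Nil)

lemma ce_d_wedge_sign:
  "ce_d (wedge \<omega> \<eta>) xs =
     wedge (ce_d \<omega>) \<eta> xs + wedge (\<lambda>ys. (- 1) ^ length ys * \<omega> ys) (ce_d \<eta>) xs"
proof (induction xs arbitrary: \<omega> \<eta>)
  case (Cons y ys)
  have "ce_d (\<lambda>zs. (- 1) ^ length zs * \<omega> zs) = (\<lambda>zs. - ((- 1) ^ length zs * ce_d \<omega> zs))"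
    by (rule ext) (rule ce_d_sign)
  then show ?case
    by (simp add: ce_d_Cons wedge_Cons ce_d_add_apply Cons.IH lie_der_wedge wedge_diff_left
        wedge_diff_right wedge_minus_left wedge_minus_right)
qed (simp add: wedge_Nil)

lemma ce_d_wedge:
  assumes "\<And>ys. length ys \<noteq> j \<Longrightarrow> \<omega> ys = 0"
  shows "ce_d (wedge \<omega> \<eta>) = wedge (ce_d \<omega>) \<eta> + form_scale ((- 1) ^ j) (wedge \<omega> (ce_d \<eta>))"
proof -
  have sign: "(\<lambda>ys. (- 1) ^ length ys * \<omega> ys) = (\<lambda>ys. (- 1) ^ j * \<omega> ys)"
    using assms by (metis mult_zero_right)
  show ?thesis
    by (rule ext) (simp only: ce_d_wedge_sign sign wedge_scale_left form_scale_def plus_fun_apply)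
qed

lemma ce_d_one_form:
  "ce_d (one_form \<alpha>) xs = (if length xs = 2 then \<alpha> (bracket (xs ! 0) (xs ! 1)) else 0)"
proof (cases "length xs = 2")
  case True
  then obtain x y where "xs = [x, y]"
    by (auto simp: length_Suc_conv numeral_2_eq_2)
  then show ?thesis
    by (simp add: ce_d_Cons lie_der_Cons one_form_def)
next
  case False
  have "one_form \<alpha> (take i xs @ drop (Suc i) (xs[l := v])) = 0" if "i < l" "l < length xs" for i l v
  proof -
    have "length xs - Suc 0 \<noteq> Suc 0" using that False by linarith
    then show ?thesis using that by (simp add: one_form_def)
  qed
  then show ?thesis using False by (simp add: ce_d_def)
qed

lemma ce_d_unique:
  assumes lin: "Vector_Spaces.linear form_scale form_scale D"
    and one: "D form_one = 0"
    and base: "\<And>\<alpha>. \<alpha> \<in> dual \<Longrightarrow>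
      D (one_form \<alpha>) = (\<lambda>xs. if length xs = 2 then \<alpha> (bracket (xs ! 0) (xs ! 1)) else 0)"
    and leibniz: "\<And>\<alpha> \<omega>. \<alpha> \<in> dual \<Longrightarrow>
      D (wedge (one_form \<alpha>) \<omega>) = wedge (D (one_form \<alpha>)) \<omega> - wedge (one_form \<alpha>) (D \<omega>)"
    and \<omega>: "\<omega> \<in> ext_power j"
  shows "D \<omega> = ce_d \<omega>"
proof -
  have eq: "D (wedge_list \<alpha>s) = ce_d (wedge_list \<alpha>s)" if "set \<alpha>s \<subseteq> dual" for \<alpha>s
    using that
  proof (induction \<alpha>s)
    case Nil
    have "ce_d (form_one :: 'a form) xs = 0" for xs
      unfolding ce_d_def form_one_def by (intro sum.neutral ballI) auto
    then show ?case by (simp add: wedge_list_def one fun_eq_iff)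
  next
    case (Cons \<alpha> \<alpha>s)
    have "D (one_form \<alpha>) = ce_d (one_form \<alpha>)"
      using Cons.prems by (simp add: base fun_eq_iff ce_d_one_form)
    then have "D (wedge_list (\<alpha> # \<alpha>s)) =
        wedge (ce_d (one_form \<alpha>)) (wedge_list \<alpha>s) - wedge (one_form \<alpha>) (ce_d (wedge_list \<alpha>s))"
      using Cons leibniz[of \<alpha> "wedge_list \<alpha>s"] by (simp add: wedge_list_def)
    also have "\<dots> = ce_d (wedge_list (\<alpha> # \<alpha>s))"
    proof -
      have "one_form \<alpha> ys = 0" if "length ys \<noteq> 1" for ys
        using that by (simp add: one_form_def)
      from ce_d_wedge[OF this] show ?thesis
        by (simp add: wedge_list_def fun_eq_iff form_scale_def)
    qed
    finally show ?case .
  qed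
  have pair: "vector_space_pair form_scale form_scale" by unfold_locales
  show ?thesis
    by (rule vector_space_pair.linear_eq_on[OF pair lin ce_d_linear \<omega>[unfolded ext_power_def]])
      (use eq in auto)
qed

end

end

theory Submission
  imports Defs
begin

text \<open>
  Write \<open>m\<close> for the dimension of the algebra. In a \<open>p\<close>-filiform algebra the consecutive quotients of the lower
  central series, after the first, are one-dimensional until the series ends. Abelian means \<open>m = p + 1\<close> and
  2-step nilpotent means \<open>m = p + 2\<close> (\<open>filiform_small_iff\<close>).

  Suppose that \<open>m \<ge> p + 3\<close> and that a grading satisfies (W) and (H). By (W) in degree one the algebra is
  generated by its components of degrees \<open>- 1\<close> and \<open>- 2\<close> (\<open>generated_in_degrees_1_2\<close>), so there are generators
  \<open>x\<close>, \<open>y\<close>, \<open>u\<close> of these degrees such that \<open>z = [x, y]\<close> and \<open>w = [u, z]\<close> represent the first two of the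
  one-dimensional quotients (\<open>graded_generators\<close>). If the weight of \<open>z\<close> or \<open>w\<close> is \<open>3\<close>, the component of
  degree \<open>- 3\<close> has dimension one, against (H); the Jacobi identity excludes all other cases except that \<open>x\<close>,
  \<open>y\<close>, \<open>u\<close> all have degree \<open>- 2\<close>. In that case the relation \<open>[y, [x, y]] = 0\<close>, which holds for a suitable choice
  of \<open>x\<close> and \<open>y\<close>, defines a nonzero class of weight \<open>6\<close> in the second cohomology, against (W)
  (\<open>weight_6_class_obstruction\<close>).

  Conversely, an abelian algebra is put in degree \<open>- 2\<close>. If the derived algebra is a central line spanned by
  \<open>z = [x, y]\<close>, the bracket is an alternating bilinear form with values in this line, and its rank decides
  (\<open>line_derived_grading\<close>). For rank at least four, \<open>z\<close> gets degree \<open>- 4\<close> and a complement gets degree \<open>- 2\<close>;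
  multiplication by the form is then injective on functionals of the complement, which removes all cohomology of weight
  \<open>6\<close>. For rank two, \<open>x\<close> and \<open>y\<close> get degree \<open>- 1\<close> and the centre gets degree \<open>- 2\<close>; the evenness required by
  (H) comes from two automorphisms whose actions on forms of odd weight anticommute
  (\<open>conditions_heisenberg_grading\<close>).

  Forms are compared by evaluating them on lists of homogeneous vectors (\<open>homogeneous_eq_0\<close>). This suffices
  because forms are multilinear, and it turns (W) into the vanishing of cocycles of the wrong weights
  (\<open>cohomology_is_sumI\<close>).
\<close>

section \<open>Wedge products and multilinear forms\<close>

lemma wedge_form_scale_left: "wedge (form_scale c \<omega>) \<eta> = form_scale c (wedge \<omega> \<eta>)"
  by (simp add: fun_eq_iff form_scale_def wedge_scale_left)

lemma wedge_scale_right: "wedge \<omega> (\<lambda>ys. c * \<eta> ys) xs = c * wedge \<omega> \<eta> xs"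
  by (simp add: wedge_def sum_distrib_left mult_ac)

lemma wedge_form_scale_right: "wedge \<omega> (form_scale c \<eta>) = form_scale c (wedge \<omega> \<eta>)"
  by (simp add: fun_eq_iff form_scale_def wedge_scale_right)

lemma wedge_plus_left: "wedge (\<omega> + \<omega>') \<eta> = wedge \<omega> \<eta> + wedge \<omega>' \<eta>"
  by (simp add: fun_eq_iff plus_fun_def wedge_add_left)

lemma wedge_plus_right: "wedge \<omega> (\<eta> + \<eta>') = wedge \<omega> \<eta> + wedge \<omega> \<eta>'"
  by (simp add: fun_eq_iff plus_fun_def wedge_add_right)

lemma wedge_zero_left [simp]: "wedge 0 \<eta> = 0"
  by (simp add: fun_eq_iff wedge_def)

lemma wedge_zero_right [simp]: "wedge \<omega> 0 = 0"
  by (simp add: fun_eq_iff wedge_def)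

lemma wedge_in_span:
  assumes "\<omega> \<in> form.span A" "\<eta> \<in> form.span B"
    and AB: "\<And>a b. a \<in> A \<Longrightarrow> b \<in> B \<Longrightarrow> wedge a b \<in> form.span C"
  shows "wedge \<omega> \<eta> \<in> form.span C"
  using assms(1)
proof (induction rule: form.span_induct_alt)
  case (step c a \<omega>)
  have "wedge a \<eta> \<in> form.span C"
    using assms(2)
  proof (induction rule: form.span_induct_alt)
    case (step c b \<eta>)
    then show ?case
      unfolding wedge_plus_right wedge_form_scale_right
      using AB[OF \<open>a \<in> A\<close>] by (intro form.span_add form.span_scale) auto
  next
    case base
    show ?case unfolding wedge_zero_right by (rule form.span_zero)
  qed
  with step show ?case
    unfolding wedge_plus_left wedge_form_scale_left by (intro form.span_add form.span_scale)
next
  case base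
  show ?case unfolding wedge_zero_left by (rule form.span_zero)
qed

lemma wedge_sign:
  "(- 1) ^ length xs * wedge \<omega> \<eta> xs =
     wedge (\<lambda>ys. (- 1) ^ length ys * \<omega> ys) (\<lambda>ys. (- 1) ^ length ys * \<eta> ys) xs"
proof (induction xs arbitrary: \<omega> \<eta>)
  case (Cons x xs)
  show ?case
    using Cons[of "\<lambda>ys. \<omega> (x # ys)" \<eta>] Cons[of "\<lambda>ys. (- 1) ^ length ys * \<omega> ys" "\<lambda>ys. \<eta> (x # ys)"]
    by (simp add: wedge_Cons distrib_left wedge_minus_left wedge_minus_right)
qed (simp add: wedge_Nil)

text \<open>Contraction by the first argument reduces every identity between wedge products to shorter
  argument lists; \<open>wedge_sign\<close> says that the parity sign which it produces is multiplicative.\<close>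

lemma wedge_assoc: "wedge (wedge \<omega> \<eta>) \<theta> = wedge \<omega> (wedge \<eta> \<theta>)"
proof
  show "wedge (wedge \<omega> \<eta>) \<theta> xs = wedge \<omega> (wedge \<eta> \<theta>) xs" for xs
  proof (induction xs arbitrary: \<omega> \<eta> \<theta>)
    case (Cons x xs)
    show ?case
      by (simp add: wedge_Cons wedge_add_left wedge_add_right Cons.IH wedge_sign)
  qed (simp add: wedge_Nil)
qed

lemma wedge_form_one_left [simp]: "wedge form_one \<omega> = \<omega>"
proof
  show "wedge form_one \<omega> xs = \<omega> xs" for xs
  proof (induction xs arbitrary: \<omega>)
    case (Cons x xs)
    have 1: "(\<lambda>ys. form_one (x # ys)) = 0"
      by (auto simp: form_one_def fun_eq_iff)
    have 2: "(\<lambda>ys. (- 1) ^ length ys * form_one ys) = form_one"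
      by (auto simp: form_one_def fun_eq_iff)
    show ?case unfolding wedge_Cons 1 2 by (simp add: Cons)
  qed (simp add: wedge_Nil form_one_def)
qed

lemma wedge_list_Nil [simp]: "wedge_list [] = form_one"
  by (simp add: wedge_list_def)

lemma wedge_list_Cons [simp]: "wedge_list (\<alpha> # \<alpha>s) = wedge (one_form \<alpha>) (wedge_list \<alpha>s)"
  by (simp add: wedge_list_def)

text \<open>The wedge product is multilinear in its factors, so only a spanning set of the dual is needed
  to generate an exterior power. A finite spanning set gives finite dimension; one made of homogeneous
  functionals gives the decomposition by weight.\<close>

lemma wedge_list_expand:
  assumes "\<And>\<alpha>. \<alpha> \<in> set \<alpha>s \<Longrightarrow> one_form \<alpha> \<in> form.span (one_form ` F)"
  shows "wedge_list \<alpha>s \<in> form.span {wedge_list \<beta>s |\<beta>s. length \<beta>s = length \<alpha>s \<and> set \<beta>s \<subseteq> F}"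
  using assms
proof (induction \<alpha>s)
  case (Cons \<alpha> \<alpha>s)
  let ?E = "\<lambda>n. {wedge_list \<beta>s |\<beta>s. length \<beta>s = n \<and> set \<beta>s \<subseteq> F}"
  have "wedge a b \<in> form.span (?E (Suc (length \<alpha>s)))"
    if "a \<in> one_form ` F" "b \<in> ?E (length \<alpha>s)" for a b
  proof -
    from that(1) obtain f where "a = one_form f" "f \<in> F"
      by auto
    moreover from that(2) obtain \<beta>s where "b = wedge_list \<beta>s" "length \<beta>s = length \<alpha>s" "set \<beta>s \<subseteq> F"
      by auto
    ultimately have "wedge a b = wedge_list (f # \<beta>s)" "length (f # \<beta>s) = Suc (length \<alpha>s)" "set (f # \<beta>s) \<subseteq> F"
      by auto
    then show ?thesis by (intro form.span_base) blast
  qed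
  moreover have "one_form \<alpha> \<in> form.span (one_form ` F)" "wedge_list \<alpha>s \<in> form.span (?E (length \<alpha>s))"
    using Cons by simp_all
  ultimately show ?case
    unfolding wedge_list_Cons length_Cons by (rule wedge_in_span[rotated 2])
qed (auto intro: form.span_base)

lemma wedge_one_form_apply:
  "wedge (one_form \<alpha>) \<omega> (x # xs) = \<alpha> x * \<omega> xs - wedge (one_form \<alpha>) (\<lambda>ys. \<omega> (x # ys)) xs"
proof -
  have 1: "(\<lambda>ys. one_form \<alpha> (x # ys)) = form_scale (\<alpha> x) form_one"
    by (auto simp: fun_eq_iff one_form_def form_scale_def form_one_def)
  have 2: "(\<lambda>ys. (- 1) ^ length ys * one_form \<alpha> ys) = (\<lambda>ys. - one_form \<alpha> ys)"
    by (auto simp: fun_eq_iff one_form_def)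
  show ?thesis
    by (simp add: wedge_Cons 1 2 wedge_form_scale_left wedge_minus_left)
      (simp add: form_scale_def)
qed

lemma wedge_one_form_Nil [simp]: "wedge (one_form \<alpha>) \<omega> [] = 0"
  by (simp add: wedge_Nil one_form_def)

lemma wedge_list_pair: "wedge_list [\<alpha>, \<beta>] [s, t] = \<alpha> s * \<beta> t - \<alpha> t * \<beta> s"
  by (simp add: wedge_one_form_apply form_one_def)

lemma wedge_list_support: "length xs \<noteq> length \<alpha>s \<Longrightarrow> wedge_list \<alpha>s xs = 0"
proof -
  have *: "wedge (one_form \<alpha>) \<omega> xs = 0"
    if "\<And>ys. Suc (length ys) = length xs \<Longrightarrow> \<omega> ys = 0" for \<alpha> \<omega> and xs :: "'a list"
    using that
  proof (induction xs arbitrary: \<omega>)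
    case (Cons x xs)
    show ?case
      unfolding wedge_one_form_apply using Cons(2)[of xs]
      by (subst Cons(1)[of "\<lambda>ys. \<omega> (x # ys)"]) (auto intro!: Cons.prems)
  qed simp
  show "length xs \<noteq> length \<alpha>s \<Longrightarrow> wedge_list \<alpha>s xs = 0"
  proof (induction \<alpha>s arbitrary: xs)
    case (Cons \<alpha> \<alpha>s)
    then show ?case by (auto intro!: *)
  qed (simp add: form_one_def)
qed

lemma wedge_map: "wedge (\<lambda>ys. \<omega> (map T ys)) (\<lambda>ys. \<eta> (map T ys)) xs = wedge \<omega> \<eta> (map T xs)"
  by (simp add: wedge_def nths_map)

lemma wedge_list_map: "wedge_list (map (\<lambda>\<alpha>. \<alpha> \<circ> T) \<alpha>s) xs = wedge_list \<alpha>s (map T xs)"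
proof (induction \<alpha>s arbitrary: xs)
  case (Cons \<alpha> \<alpha>s)
  have "one_form (\<alpha> \<circ> T) = (\<lambda>ys. one_form \<alpha> (map T ys))"
    by (auto simp: fun_eq_iff one_form_def length_Suc_conv)
  moreover have "wedge_list (map (\<lambda>\<alpha>. \<alpha> \<circ> T) \<alpha>s) = (\<lambda>ys. wedge_list \<alpha>s (map T ys))"
    using Cons by (intro ext)
  ultimately show ?case
    by (simp only: list.map wedge_list_Cons wedge_map)
qed (auto simp: form_one_def)

context complex_lie_algebra
begin

lemma in_dual_iff:
  "\<alpha> \<in> dual \<longleftrightarrow> (\<forall>x y. \<alpha> (x + y) = \<alpha> x + \<alpha> y) \<and> (\<forall>c x. \<alpha> (scale c x) = c * \<alpha> x)"
proof -
  have "vector_space ((*) :: complex \<Rightarrow> complex \<Rightarrow> complex)"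
    by unfold_locales (auto simp: algebra_simps)
  then show ?thesis
    by (simp add: dual_def Vector_Spaces.linear_iff vector_space_axioms)
qed

lemma dual_add: "\<alpha> \<in> dual \<Longrightarrow> \<alpha> (x + y) = \<alpha> x + \<alpha> y"
  and dual_scale: "\<alpha> \<in> dual \<Longrightarrow> \<alpha> (scale c x) = c * \<alpha> x"
  by (simp_all add: in_dual_iff)

lemma dual_0: "\<alpha> \<in> dual \<Longrightarrow> \<alpha> 0 = 0"
  using dual_scale[of \<alpha> 0 0] by simp

lemma dual_diff: "\<alpha> \<in> dual \<Longrightarrow> \<alpha> (x - y) = \<alpha> x - \<alpha> y"
  using dual_add[of \<alpha> "x - y" y] by simp

lemma dual_minus: "\<alpha> \<in> dual \<Longrightarrow> \<alpha> (- x) = - \<alpha> x"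
  using dual_scale[of \<alpha> "- 1" x] by simp

lemma dual_sum: "\<alpha> \<in> dual \<Longrightarrow> \<alpha> (\<Sum>i\<in>I. f i) = (\<Sum>i\<in>I. \<alpha> (f i))"
  by (induction I rule: infinite_finite_induct) (auto simp: dual_0 dual_add)

lemma subspace_dual_kernel: "\<alpha> \<in> dual \<Longrightarrow> subspace {x. \<alpha> x = 0}"
  by (auto simp: subspace_def dual_0 dual_add dual_scale)

lemma bracket_0 [simp]: "bracket 0 x = 0" "bracket x 0 = 0"
  using bracket_scale_left[of 0 0 x] bracket_scale_right[of x 0 0] by auto

lemma bracket_swap: "bracket x y = - bracket y x"
  using bracket_self[of "x + y"]
  by (simp add: bracket_add_left bracket_add_right bracket_self[of x] bracket_self[of y] eq_neg_iff_add_eq_0)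
    (metis add.commute add.right_neutral add_cancel_right_left bracket_self)

lemma bracket_minus: "bracket (- x) y = - bracket x y" "bracket x (- y) = - bracket x y"
  using bracket_scale_left[of "-1" x y] bracket_scale_right[of x "-1" y] by auto

lemma bracket_diff: "bracket (x - y) z = bracket x z - bracket y z"
    "bracket x (y - z) = bracket x y - bracket x z"
  using bracket_add_left[of x "- y" z] bracket_add_right[of x y "- z"] by (auto simp: bracket_minus)

lemma jacobi_derivation: "bracket a (bracket b c) = bracket (bracket a b) c + bracket b (bracket a c)"
  using jacobi[of a b c] bracket_swap[of "bracket a b" c] bracket_swap[of a c]
  by (simp add: bracket_minus) (metis add.commute add_diff_cancel_right' add_minus_cancel diff_0 diff_add_eq_diff_diff_swap uminus_add_conv_diff minus_add_cancel add.assoc)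

lemma bracket_in_span:
  assumes "x \<in> span A" "y \<in> span B" and AB: "\<And>a b. a \<in> A \<Longrightarrow> b \<in> B \<Longrightarrow> bracket a b \<in> span C"
  shows "bracket x y \<in> span C"
  using assms(1)
proof (induction rule: span_induct_alt)
  case (step c a x)
  have "bracket a y \<in> span C"
    using assms(2)
    by (induction rule: span_induct_alt)
      (auto simp: bracket_add_right bracket_scale_right span_zero intro!: span_add span_scale AB[OF step(1)])
  with step show ?case
    by (auto simp: bracket_add_left bracket_scale_left intro!: span_add span_scale)
qed (simp add: span_zero)

text \<open>Multilinearity is enough to recognise vanishing forms: a multilinear form vanishes if it does so on lists
  from a spanning set. The marked entry may be at any position, so that removing the first argument preserves
  the property.\<close>

definition multilinear_form :: "'a form \<Rightarrow> bool" where
  "multilinear_form \<omega> \<longleftrightarrow> (\<forall>as bs u v. \<omega> (as @ (u + v) # bs) = \<omega> (as @ u # bs) + \<omega> (as @ v # bs)) \<and>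
     (\<forall>as bs c v. \<omega> (as @ scale c v # bs) = c * \<omega> (as @ v # bs))"

lemma multilinear_add: "multilinear_form \<omega> \<Longrightarrow> \<omega> (as @ (u + v) # bs) = \<omega> (as @ u # bs) + \<omega> (as @ v # bs)"
  and multilinear_scale: "multilinear_form \<omega> \<Longrightarrow> \<omega> (as @ scale c v # bs) = c * \<omega> (as @ v # bs)"
  by (auto simp: multilinear_form_def)

lemma multilinear_add_hd: "multilinear_form \<omega> \<Longrightarrow> \<omega> ((u + v) # bs) = \<omega> (u # bs) + \<omega> (v # bs)"
  and multilinear_scale_hd: "multilinear_form \<omega> \<Longrightarrow> \<omega> (scale c v # bs) = c * \<omega> (v # bs)"
  using multilinear_add[of \<omega> "[]"] multilinear_scale[of \<omega> "[]"] by auto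

lemma multilinear_0: "multilinear_form \<omega> \<Longrightarrow> \<omega> (as @ 0 # bs) = 0"
  using multilinear_scale[of \<omega> as 0 0 bs] by simp

lemma multilinear_0_hd: "multilinear_form \<omega> \<Longrightarrow> \<omega> (0 # bs) = 0"
  using multilinear_0[of \<omega> "[]"] by simp

lemma multilinear_Cons: "multilinear_form \<omega> \<Longrightarrow> multilinear_form (\<lambda>ys. \<omega> (x # ys))"
  unfolding multilinear_form_def append_Cons[symmetric] by blast

lemma multilinear_sign: "multilinear_form \<omega> \<Longrightarrow> multilinear_form (\<lambda>ys. (- 1) ^ length ys * \<omega> ys)"
  by (simp add: multilinear_form_def algebra_simps)

lemma subspace_multilinear: "form.subspace (Collect multilinear_form)"
  by (auto simp: form.subspace_def multilinear_form_def form_scale_def algebra_simps)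

lemma multilinear_wedge:
  assumes "multilinear_form \<omega>" "multilinear_form \<eta>"
  shows "multilinear_form (wedge \<omega> \<eta>)"
proof -
  have "wedge \<omega> \<eta> (as @ (u + v) # bs) = wedge \<omega> \<eta> (as @ u # bs) + wedge \<omega> \<eta> (as @ v # bs)" for as bs u v
    using assms
  proof (induction as arbitrary: \<omega> \<eta>)
    case Nil
    then show ?case
      by (simp add: wedge_Cons multilinear_add_hd wedge_add_left wedge_add_right)
  next
    case (Cons a as)
    then show ?case
      by (simp add: wedge_Cons multilinear_Cons multilinear_sign)
  qed
  moreover have "wedge \<omega> \<eta> (as @ scale c v # bs) = c * wedge \<omega> \<eta> (as @ v # bs)" for as bs c v
    using assms
  proof (induction as arbitrary: \<omega> \<eta>)
    case Nil
    then show ?case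
      by (simp add: wedge_Cons multilinear_scale_hd wedge_scale_left wedge_scale_right distrib_left)
  next
    case (Cons a as)
    then show ?case
      by (simp add: wedge_Cons multilinear_Cons multilinear_sign distrib_left)
  qed
  ultimately show ?thesis by (auto simp: multilinear_form_def)
qed

lemma multilinear_one_form: "\<alpha> \<in> dual \<Longrightarrow> multilinear_form (one_form \<alpha>)"
  by (auto simp: multilinear_form_def one_form_def dual_add dual_scale)

lemma multilinear_wedge_list: "set \<alpha>s \<subseteq> dual \<Longrightarrow> multilinear_form (wedge_list \<alpha>s)"
proof (induction \<alpha>s)
  case Nil
  show ?case by (simp add: multilinear_form_def form_one_def)
qed (simp add: multilinear_wedge multilinear_one_form)

lemma multilinear_ext_power: "\<omega> \<in> ext_power j \<Longrightarrow> multilinear_form \<omega>"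
  using form.span_minimal[OF _ subspace_multilinear, of "{wedge_list \<alpha>s |\<alpha>s. length \<alpha>s = j \<and> set \<alpha>s \<subseteq> dual}"]
  unfolding ext_power_def using multilinear_wedge_list by fast

lemma multilinear_lie_der:
  assumes "multilinear_form \<omega>"
  shows "multilinear_form (lie_der x \<omega>)"
proof -
  have "lie_der x \<omega> (as @ (u + v) # bs) = lie_der x \<omega> (as @ u # bs) + lie_der x \<omega> (as @ v # bs)" for as bs u v
    using assms
  proof (induction as arbitrary: \<omega>)
    case Nil
    then show ?case
      by (simp add: lie_der_Cons multilinear_add_hd bracket_add_right lie_der_add)
  next
    case (Cons a as)
    then show ?case
      using multilinear_add[OF Cons(2), of "bracket x a # as"] by (simp add: lie_der_Cons multilinear_Cons)
  qed
  moreover have "lie_der x \<omega> (as @ scale c v # bs) = c * lie_der x \<omega> (as @ v # bs)" for as bs c v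
    using assms
  proof (induction as arbitrary: \<omega>)
    case Nil
    then show ?case
      by (simp add: lie_der_Cons multilinear_scale_hd bracket_scale_right)
        (simp add: lie_der_def sum_distrib_left distrib_left)
  next
    case (Cons a as)
    then show ?case
      using multilinear_scale[OF Cons(2), of "bracket x a # as"]
      by (simp add: lie_der_Cons multilinear_Cons distrib_left)
  qed
  ultimately show ?thesis by (auto simp: multilinear_form_def)
qed

lemma lie_der_add_vector:
  assumes "multilinear_form \<omega>"
  shows "lie_der (u + v) \<omega> xs = lie_der u \<omega> xs + lie_der v \<omega> xs"
  using assms
  by (induction xs arbitrary: \<omega>)
    (simp_all add: lie_der_Cons bracket_add_left multilinear_add_hd multilinear_Cons)

lemma lie_der_scale_vector:
  assumes "multilinear_form \<omega>"
  shows "lie_der (scale c v) \<omega> xs = c * lie_der v \<omega> xs"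
  using assms
  by (induction xs arbitrary: \<omega>)
    (simp_all add: lie_der_Cons bracket_scale_left multilinear_scale_hd multilinear_Cons distrib_left)

lemma ce_d_scale_apply: "ce_d (\<lambda>ys. c * \<omega> ys) xs = c * ce_d \<omega> xs"
  by (simp add: ce_d_def sum_distrib_left mult_ac)

lemma multilinear_ce_d:
  assumes "multilinear_form \<omega>"
  shows "multilinear_form (ce_d \<omega>)"
proof -
  have "ce_d \<omega> (as @ (u + v) # bs) = ce_d \<omega> (as @ u # bs) + ce_d \<omega> (as @ v # bs)" for as bs u v
    using assms
  proof (induction as arbitrary: \<omega>)
    case Nil
    then show ?case
      by (simp add: ce_d_Cons multilinear_add_hd lie_der_add_vector ce_d_add_apply)
  next
    case (Cons a as)
    then show ?case
      by (simp add: ce_d_Cons multilinear_Cons multilinear_add[OF multilinear_lie_der])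
  qed
  moreover have "ce_d \<omega> (as @ scale c v # bs) = c * ce_d \<omega> (as @ v # bs)" for as bs c v
    using assms
  proof (induction as arbitrary: \<omega>)
    case Nil
    then show ?case
      by (simp add: ce_d_Cons multilinear_scale_hd lie_der_scale_vector ce_d_scale_apply right_diff_distrib)
  next
    case (Cons a as)
    then show ?case
      by (simp add: ce_d_Cons multilinear_Cons multilinear_scale[OF multilinear_lie_der] right_diff_distrib)
  qed
  ultimately show ?thesis by (auto simp: multilinear_form_def)
qed

text \<open>The arguments are moved one at a time into the span of \<open>H\<close>: the list \<open>hs\<close> collects the
  arguments that already lie in \<open>H\<close>.\<close>

lemma multilinear_eq_0:
  assumes "multilinear_form \<omega>" "span H = UNIV" and 0: "\<And>xs. set xs \<subseteq> H \<Longrightarrow> \<omega> xs = 0"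
  shows "\<omega> = 0"
proof -
  have "\<omega> (hs @ xs) = 0" if "set hs \<subseteq> H" for hs xs
    using that
  proof (induction xs arbitrary: hs)
    case (Cons x xs)
    have "x \<in> span H" using assms(2) by simp
    then show ?case
    proof (induction rule: span_induct_alt)
      case base
      show ?case by (rule multilinear_0[OF assms(1)])
    next
      case (step c u v)
      have "\<omega> (hs @ u # xs) = 0" using Cons(1)[of "hs @ [u]"] Cons(2) step(1) by simp
      with step show ?case by (simp add: multilinear_add[OF assms(1)] multilinear_scale[OF assms(1)])
    qed
  qed (simp add: 0)
  from this[of "[]"] show ?thesis by (simp add: fun_eq_iff)
qed

end

section \<open>Weights of forms\<close>

lemma sum_form_apply: "(\<Sum>k\<in>K. f k) xs = (\<Sum>k\<in>K. f k xs)" for f :: "'k \<Rightarrow> 'a form"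
  by (induction K rule: infinite_finite_induct) auto

context complex_lie_algebra
begin

definition grading_component :: "(int \<Rightarrow> 'a set) \<Rightarrow> 'a \<Rightarrow> int \<Rightarrow> 'a" where
  "grading_component g x = (THE f. (\<forall>i. f i \<in> g i) \<and> finite {i. f i \<noteq> 0} \<and> x = (\<Sum>i\<in>{i. f i \<noteq> 0}. f i))"

text \<open>Evaluation characterises the weight: a form of weight \<open>k\<close> sees only lists of homogeneous vectors whose
  degrees add up to \<open>- k\<close>. Unlike membership in \<^const>\<open>ext_power_graded\<close>, this property is visibly
  inherited by \<^const>\<open>ce_d\<close>.\<close>

definition has_weight :: "(int \<Rightarrow> 'a set) \<Rightarrow> int \<Rightarrow> 'a form \<Rightarrow> bool" where
  "has_weight g k \<omega> \<longleftrightarrow>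
     (\<forall>xs ds. list_all2 (\<lambda>x d. x \<in> g d) xs ds \<longrightarrow> sum_list ds + k \<noteq> 0 \<longrightarrow> \<omega> xs = 0)"

lemma has_weightD:
  "has_weight g k \<omega> \<Longrightarrow> list_all2 (\<lambda>x d. x \<in> g d) xs ds \<Longrightarrow> sum_list ds + k \<noteq> 0 \<Longrightarrow> \<omega> xs = 0"
  by (auto simp: has_weight_def)

lemma has_weight_Cons: "has_weight g k \<omega> \<Longrightarrow> x \<in> g d \<Longrightarrow> has_weight g (k + d) (\<lambda>ys. \<omega> (x # ys))"
  unfolding has_weight_def
proof (intro allI impI)
  fix xs ds
  assume \<omega>: "\<forall>xs ds. list_all2 (\<lambda>x d. x \<in> g d) xs ds \<longrightarrow> sum_list ds + k \<noteq> 0 \<longrightarrow> \<omega> xs = 0"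
    and "x \<in> g d" "list_all2 (\<lambda>x d. x \<in> g d) xs ds" "sum_list ds + (k + d) \<noteq> 0"
  then show "\<omega> (x # xs) = 0" by (intro \<omega>[rule_format, of _ "d # ds"]) auto
qed

lemma has_weight_mult: "has_weight g k \<omega> \<Longrightarrow> has_weight g k (\<lambda>ys. c ys * \<omega> ys)"
  by (simp add: has_weight_def)

lemma subspace_has_weight: "form.subspace (Collect (has_weight g k))"
  by (auto simp: form.subspace_def has_weight_def form_scale_def)

lemma has_weight_wedge:
  assumes "has_weight g k \<omega>" "has_weight g l \<eta>"
  shows "has_weight g (k + l) (wedge \<omega> \<eta>)"
proof -
  have "wedge \<omega> \<eta> xs = 0" if "list_all2 (\<lambda>x d. x \<in> g d) xs ds" "sum_list ds + (k + l) \<noteq> 0" for xs ds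
    using that assms
  proof (induction xs arbitrary: ds k l \<omega> \<eta>)
    case Nil
    then show ?case
      using has_weightD[of g k \<omega> "[]" "[]"] has_weightD[of g l \<eta> "[]" "[]"]
      by (cases "k = 0") (auto simp: wedge_Nil)
  next
    case (Cons x xs)
    then obtain d ds' where ds: "ds = d # ds'" "x \<in> g d" "list_all2 (\<lambda>x d. x \<in> g d) xs ds'"
      by (auto simp: list_all2_Cons1)
    have "wedge (\<lambda>ys. \<omega> (x # ys)) \<eta> xs = 0"
      using Cons.prems ds by (intro Cons.IH[OF ds(3) _ has_weight_Cons]) auto
    moreover have "wedge (\<lambda>ys. (- 1) ^ length ys * \<omega> ys) (\<lambda>ys. \<eta> (x # ys)) xs = 0"
      using Cons.prems ds by (intro Cons.IH[OF ds(3) _ has_weight_mult has_weight_Cons]) auto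
    ultimately show ?case by (simp add: wedge_Cons)
  qed
  then show ?thesis by (auto simp: has_weight_def)
qed

lemma has_weight_wedge_list:
  assumes "list_all2 (\<lambda>\<alpha> i. \<alpha> \<in> graded_dual g (- i)) \<alpha>s is"
  shows "has_weight g (sum_list is) (wedge_list \<alpha>s)"
  using assms
proof (induction rule: list_all2_induct)
  case Nil
  show ?case by (auto simp: has_weight_def form_one_def)
next
  case (Cons \<alpha> \<alpha>s i "is")
  have "has_weight g i (one_form \<alpha>)"
    using Cons(1)
    by (auto simp: has_weight_def one_form_def graded_dual_def length_Suc_conv list_all2_Cons1
        eq_neg_iff_add_eq_0)
  then show ?case using Cons by (simp add: has_weight_wedge)
qed

lemma ext_power_graded_has_weight: "\<omega> \<in> ext_power_graded g j k \<Longrightarrow> has_weight g k \<omega>"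
proof -
  have "{wedge_list \<alpha>s |\<alpha>s is. length is = j \<and> sum_list is = k \<and>
      list_all2 (\<lambda>\<alpha> i. \<alpha> \<in> graded_dual g (- i)) \<alpha>s is} \<subseteq> Collect (has_weight g k)"
    using has_weight_wedge_list by auto
  from form.span_minimal[OF this subspace_has_weight]
  show "\<omega> \<in> ext_power_graded g j k \<Longrightarrow> has_weight g k \<omega>"
    by (auto simp: ext_power_graded_def)
qed

lemma graded_dual_in_dual: "\<alpha> \<in> graded_dual g i \<Longrightarrow> \<alpha> \<in> dual"
  by (simp add: graded_dual_def)

lemma ext_power_graded_subset: "ext_power_graded g j k \<subseteq> ext_power j"
  unfolding ext_power_graded_def ext_power_def
  by (intro form.span_mono) (auto 4 4 dest: list_all2_lengthD simp: list_all2_conv_all_nth in_set_conv_nth graded_dual_def)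

lemma subspace_ext_power: "form.subspace (ext_power j)"
  by (simp add: ext_power_def form.subspace_span)

lemma subspace_ext_power_graded: "form.subspace (ext_power_graded g j k)"
  by (simp add: ext_power_graded_def form.subspace_span)

lemma multilinear_ext_power_graded: "\<omega> \<in> ext_power_graded g j k \<Longrightarrow> multilinear_form \<omega>"
  using ext_power_graded_subset multilinear_ext_power by blast

lemma ext_power_support:
  assumes "\<omega> \<in> ext_power j" "length xs \<noteq> j"
  shows "\<omega> xs = 0"
proof -
  have "form.subspace {\<omega>. \<omega> xs = (0::complex)}"
    by (auto simp: form.subspace_def form_scale_def)
  moreover have "{wedge_list \<alpha>s |\<alpha>s. length \<alpha>s = j \<and> set \<alpha>s \<subseteq> dual} \<subseteq> {\<omega>. \<omega> xs = 0}"
    using assms(2) wedge_list_support[of xs] by auto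
  ultimately have "ext_power j \<subseteq> {\<omega>. \<omega> xs = 0}"
    unfolding ext_power_def by (intro form.span_minimal)
  with assms(1) show ?thesis by auto
qed

lemma ext_power_2_skew:
  assumes "\<omega> \<in> ext_power 2"
  shows "\<omega> [s, t] = - \<omega> [t, s]"
proof -
  have "form.subspace {\<omega>. \<omega> [s, t] = - (\<omega> [t, s] :: complex)}"
    by (auto simp: form.subspace_def form_scale_def)
  moreover have "{wedge_list \<alpha>s |\<alpha>s. length \<alpha>s = 2 \<and> set \<alpha>s \<subseteq> dual} \<subseteq> {\<omega>. \<omega> [s, t] = - \<omega> [t, s]}"
    using wedge_list_pair[of _ _ s t] wedge_list_pair[of _ _ t s]
    by (auto simp: length_Suc_conv numeral_2_eq_2 simp del: wedge_list_Cons wedge_list_Nil)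
  ultimately have "ext_power 2 \<subseteq> {\<omega>. \<omega> [s, t] = - \<omega> [t, s]}"
    unfolding ext_power_def by (intro form.span_minimal)
  with assms show ?thesis by auto
qed

lemma ce_d_support:
  assumes "\<And>ys. length ys \<noteq> j \<Longrightarrow> \<omega> ys = 0" "length xs \<noteq> Suc j"
  shows "ce_d \<omega> xs = 0"
  unfolding ce_d_def using assms(2) by (intro sum.neutral ballI) (simp add: assms(1))

lemma ce_d_pair: "ce_d \<omega> [a, b] = \<omega> [bracket a b]"
  by (simp add: ce_d_Cons lie_der_Cons)

lemma ce_d_triple: "ce_d \<omega> [a, b, c] = \<omega> [bracket a b, c] + \<omega> [b, bracket a c] - \<omega> [a, bracket b c]"
  by (simp add: ce_d_Cons lie_der_Cons)

lemma subspace_ce_d_image: "form.subspace S \<Longrightarrow> form.subspace (ce_d ` S)"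
  by (rule vector_space_pair.linear_subspace_image[OF _ ce_d_linear]) unfold_locales

lemma ce_d_plus: "ce_d (\<omega> + \<eta>) = ce_d \<omega> + ce_d \<eta>"
  by (simp add: fun_eq_iff plus_fun_def ce_d_add_apply)

lemma ce_d_form_scale: "ce_d (form_scale c \<omega>) = form_scale c (ce_d \<omega>)"
  by (simp add: fun_eq_iff form_scale_def ce_d_scale_apply)

lemma ce_d_zero [simp]: "ce_d 0 = 0"
  by (simp add: fun_eq_iff ce_d_def)

lemma ce_d_sum: "ce_d (\<Sum>k\<in>K. f k) = (\<Sum>k\<in>K. ce_d (f k))"
  by (induction K rule: infinite_finite_induct) (simp_all only: sum.infinite sum.empty sum.insert ce_d_zero ce_d_plus not_False_eq_True)

lemma subspace_coboundaries: "form.subspace (coboundaries j)"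
  by (cases j) (auto simp: coboundaries_def form.subspace_single_0 intro!: subspace_ce_d_image subspace_ext_power)

lemma subspace_coboundaries_graded: "form.subspace (coboundaries_graded g j k)"
  by (cases j) (auto simp: coboundaries_graded_def form.subspace_single_0
      intro!: subspace_ce_d_image subspace_ext_power_graded)

lemma coboundaries_graded_subset: "coboundaries_graded g j k \<subseteq> coboundaries j"
  using ext_power_graded_subset by (cases j) (force simp: coboundaries_def coboundaries_graded_def)+

lemma subspace_cocycles: "form.subspace (cocycles j)"
  using subspace_ext_power[of j]
  by (auto simp: cocycles_def form.subspace_def ce_d_plus ce_d_form_scale form.scale_zero_right simp del: plus_fun_apply)

lemma subspace_cocycles_graded: "form.subspace (cocycles_graded g j k)"
  using subspace_ext_power_graded[of g j k]
  by (auto simp: cocycles_graded_def form.subspace_def ce_d_plus ce_d_form_scale form.scale_zero_right simp del: plus_fun_apply)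

lemma cocycles_graded_subset: "cocycles_graded g j k \<subseteq> cocycles j"
  using ext_power_graded_subset by (auto simp: cocycles_def cocycles_graded_def)

text \<open>Exterior powers of a finite-dimensional space are spanned by the wedge products of coordinate functionals.\<close>

lemma ext_power_finite:
  assumes "finite D" "span D = UNIV"
  shows "\<exists>E. finite E \<and> ext_power j \<subseteq> form.span E"
proof -
  obtain B where B: "B \<subseteq> D" "independent B" "span B = UNIV"
  proof -
    obtain B where B: "B \<subseteq> D" "independent B" "D \<subseteq> span B"
      using maximal_independent_subset[of D] by blast
    have "span B = UNIV"
      using span_minimal[OF B(3) subspace_span] assms(2) by auto
    with B(1,2) show ?thesis by (rule that)
  qed
  have finB: "finite B" using B(1) assms(1) by (rule finite_subset)
  define F where "F = (\<lambda>b v. representation B v b) ` B"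
  have "one_form \<alpha> \<in> form.span (one_form ` F)" if \<alpha>: "\<alpha> \<in> dual" for \<alpha>
  proof -
    have eq: "\<alpha> v = (\<Sum>b\<in>B. \<alpha> b * representation B v b)" for v
    proof -
      have "v = (\<Sum>b\<in>B. scale (representation B v b) b)"
        using sum_representation_eq[OF B(2) _ finB order.refl, of v] B(3) by simp
      then have "\<alpha> v = \<alpha> (\<Sum>b\<in>B. scale (representation B v b) b)" by (rule arg_cong)
      also have "\<dots> = (\<Sum>b\<in>B. \<alpha> b * representation B v b)"
        by (simp add: dual_sum[OF \<alpha>] dual_scale[OF \<alpha>] mult.commute)
      finally show ?thesis .
    qed
    have "one_form \<alpha> = (\<Sum>b\<in>B. form_scale (\<alpha> b) (one_form (\<lambda>v. representation B v b)))"
    proof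
      show "one_form \<alpha> xs = (\<Sum>b\<in>B. form_scale (\<alpha> b) (one_form (\<lambda>v. representation B v b))) xs" for xs
        using eq[of "hd xs"] by (simp only: sum_form_apply one_form_def form_scale_def) simp
    qed
    then show ?thesis
      by (rule ssubst) (intro form.span_sum form.span_scale form.span_base, simp add: F_def)
  qed
  then have "ext_power j \<subseteq> form.span {wedge_list \<beta>s |\<beta>s. length \<beta>s = j \<and> set \<beta>s \<subseteq> F}"
    unfolding ext_power_def
    by (intro form.span_minimal[OF _ form.subspace_span]) (auto intro!: wedge_list_expand)
  moreover have "finite {wedge_list \<beta>s |\<beta>s. length \<beta>s = j \<and> set \<beta>s \<subseteq> F}"
  proof -
    have "finite F" by (simp add: F_def finB)
    from finite_lists_length_eq[OF this, of j] have "finite (wedge_list ` {\<beta>s. set \<beta>s \<subseteq> F \<and> length \<beta>s = j})"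
      by (rule finite_imageI)
    then show ?thesis by (rule rev_finite_subset) auto
  qed
  ultimately show ?thesis by blast
qed

section \<open>Decomposition of the cohomology by weight\<close>

context
  fixes g :: "int \<Rightarrow> 'a set"
  assumes g: "negative_grading g"
begin

lemma subspace_grading: "subspace (g i)"
  and grading_nonneg: "i \<ge> 0 \<Longrightarrow> g i = {0}"
  and bracket_grading: "x \<in> g i \<Longrightarrow> y \<in> g j \<Longrightarrow> bracket x y \<in> g (i + j)"
  using g[unfolded negative_grading_def, THEN conjunct1]
    g[unfolded negative_grading_def, THEN conjunct2, THEN conjunct1]
    g[unfolded negative_grading_def, THEN conjunct2, THEN conjunct2, THEN conjunct2]
  by simp_all

lemma grading_unique_decomposition:
  "\<exists>!f. (\<forall>i. f i \<in> g i) \<and> finite {i. f i \<noteq> 0} \<and> x = (\<Sum>i\<in>{i. f i \<noteq> 0}. f i)"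
  by (rule g[unfolded negative_grading_def, THEN conjunct2, THEN conjunct2, THEN conjunct1, THEN spec])

lemma grading_0: "0 \<in> g i"
  using subspace_grading subspace_0 by blast

lemma grading_component_props:
  "grading_component g x i \<in> g i" "finite {i. grading_component g x i \<noteq> 0}"
  "x = (\<Sum>i\<in>{i. grading_component g x i \<noteq> 0}. grading_component g x i)"
proof -
  from theI'[OF grading_unique_decomposition[of x]] show "grading_component g x i \<in> g i" "finite {i. grading_component g x i \<noteq> 0}"
    "x = (\<Sum>i\<in>{i. grading_component g x i \<noteq> 0}. grading_component g x i)"
    unfolding grading_component_def by blast+
qed

lemma grading_component_eqI:
  assumes "finite I" "\<And>i. f i \<in> g i" "\<And>i. i \<notin> I \<Longrightarrow> f i = 0" "x = (\<Sum>i\<in>I. f i)"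
  shows "grading_component g x = f"
proof -
  have "{i. f i \<noteq> 0} \<subseteq> I" using assms(3) by auto
  then have "finite {i. f i \<noteq> 0}" "x = (\<Sum>i\<in>{i. f i \<noteq> 0}. f i)"
    using assms(1,4) by (auto intro: finite_subset intro!: sum.mono_neutral_right)
  with assms(2) show ?thesis
    unfolding grading_component_def by (intro the1_equality[OF grading_unique_decomposition]) auto
qed

lemma grading_component_expand:
  assumes "finite I" "{i. grading_component g x i \<noteq> 0} \<subseteq> I"
  shows "x = (\<Sum>i\<in>I. grading_component g x i)"
proof -
  have "(\<Sum>i\<in>{i. grading_component g x i \<noteq> 0}. grading_component g x i) = (\<Sum>i\<in>I. grading_component g x i)"
    using assms by (intro sum.mono_neutral_left) auto
  with grading_component_props(3)[of x] show ?thesis by (rule trans)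
qed

lemma grading_component_homogeneous:
  "x \<in> g i \<Longrightarrow> grading_component g x j = (if j = i then x else 0)"
proof -
  assume "x \<in> g i"
  then have "grading_component g x = (\<lambda>j. if j = i then x else 0)"
    by (intro grading_component_eqI[of "{i}"]) (simp_all add: grading_0)
  then show ?thesis by simp
qed

lemma grading_component_add:
  "grading_component g (x + y) i = grading_component g x i + grading_component g y i"
proof -
  let ?I = "{i. grading_component g x i \<noteq> 0} \<union> {i. grading_component g y i \<noteq> 0}"
  have fin: "finite ?I" using grading_component_props(2) by auto
  have "x + y = (\<Sum>i\<in>?I. grading_component g x i + grading_component g y i)"
    unfolding sum.distrib
    by (rule arg_cong2[where f = "(+)"]) (rule grading_component_expand[OF fin], blast)+
  then show ?thesis
    by (subst grading_component_eqI[OF fin, of "\<lambda>i. grading_component g x i + grading_component g y i"])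
      (auto intro!: subspace_add[OF subspace_grading] grading_component_props(1))
qed

lemma grading_component_scale:
  "grading_component g (scale c x) i = scale c (grading_component g x i)"
proof -
  let ?I = "{i. grading_component g x i \<noteq> 0}"
  have "scale c x = scale c (\<Sum>i\<in>?I. grading_component g x i)"
    using grading_component_props(3)[of x] by (rule arg_cong)
  then have "scale c x = (\<Sum>i\<in>?I. scale c (grading_component g x i))"
    by (simp only: scale_sum_right)
  then show ?thesis
    by (subst grading_component_eqI[OF grading_component_props(2), of "\<lambda>i. scale c (grading_component g x i)" x])
      (auto intro!: subspace_scale[OF subspace_grading] grading_component_props(1))
qed

lemma span_grading: "span (\<Union>i. g i) = UNIV"
proof -
  have "x \<in> span (\<Union>i. g i)" for x
  proof -
    have "(\<Sum>i\<in>{i. grading_component g x i \<noteq> 0}. grading_component g x i) \<in> span (\<Union>i. g i)"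
      using grading_component_props(1)[of x] by (intro span_sum span_base) blast
    with grading_component_props(3)[of x] show ?thesis by (rule ssubst)
  qed
  then show ?thesis by auto
qed

lemma graded_dual_component:
  "\<alpha> \<in> dual \<Longrightarrow> (\<lambda>x. \<alpha> (grading_component g x i)) \<in> graded_dual g i"
  by (auto simp: graded_dual_def in_dual_iff grading_component_add grading_component_scale
      grading_component_homogeneous dual_0)

lemma dual_eqI_homogeneous:
  assumes "\<alpha> \<in> dual" "\<beta> \<in> dual" "\<And>i x. x \<in> g i \<Longrightarrow> \<alpha> x = \<beta> x"
  shows "\<alpha> = \<beta>"
proof
  fix x
  have "x \<in> span (\<Union>i. g i)" by (simp add: span_grading)
  then show "\<alpha> x = \<beta> x"
    by (induction rule: span_induct_alt)
      (use assms in \<open>auto simp: dual_0 dual_add dual_scale\<close>)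
qed

lemma has_weight_lie_der:
  assumes "has_weight g k \<omega>" "x \<in> g d"
  shows "has_weight g (k + d) (lie_der x \<omega>)"
proof -
  have "lie_der x \<omega> xs = 0" if "list_all2 (\<lambda>x d. x \<in> g d) xs ds" "sum_list ds + (k + d) \<noteq> 0" for xs ds
    using that assms
  proof (induction xs arbitrary: ds k \<omega>)
    case (Cons y ys)
    then obtain e ds' where ds: "ds = e # ds'" "y \<in> g e" "list_all2 (\<lambda>x d. x \<in> g d) ys ds'"
      by (auto simp: list_all2_Cons1)
    have "\<omega> (bracket x y # ys) = 0"
      using Cons.prems ds bracket_grading[of x d y e]
      by (intro has_weightD[of g k \<omega> _ "(d + e) # ds'"]) auto
    moreover have "lie_der x (\<lambda>zs. \<omega> (y # zs)) ys = 0"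
      using Cons.prems ds by (intro Cons.IH[OF ds(3) _ has_weight_Cons]) auto
    ultimately show ?case by (simp add: lie_der_Cons)
  qed simp
  then show ?thesis by (auto simp: has_weight_def)
qed

lemma has_weight_ce_d:
  assumes "has_weight g k \<omega>"
  shows "has_weight g k (ce_d \<omega>)"
proof -
  have "ce_d \<omega> xs = 0" if "list_all2 (\<lambda>x d. x \<in> g d) xs ds" "sum_list ds + k \<noteq> 0" for xs ds
    using that assms
  proof (induction xs arbitrary: ds k \<omega>)
    case (Cons y ys)
    then obtain e ds' where ds: "ds = e # ds'" "y \<in> g e" "list_all2 (\<lambda>x d. x \<in> g d) ys ds'"
      by (auto simp: list_all2_Cons1)
    have "lie_der y \<omega> ys = 0"
      using Cons.prems ds by (intro has_weightD[OF has_weight_lie_der ds(3)]) auto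
    moreover have "ce_d (\<lambda>zs. \<omega> (y # zs)) ys = 0"
      using Cons.prems ds by (intro Cons.IH[OF ds(3) _ has_weight_Cons]) auto
    ultimately show ?case by (simp add: ce_d_Cons)
  qed simp
  then show ?thesis by (auto simp: has_weight_def)
qed

lemma homogeneous_eq_0:
  assumes "multilinear_form \<omega>" and 0: "\<And>xs ds. list_all2 (\<lambda>x d. x \<in> g d) xs ds \<Longrightarrow> \<omega> xs = 0"
  shows "\<omega> = 0"
proof (rule multilinear_eq_0[OF assms(1) span_grading])
  fix xs assume "set xs \<subseteq> (\<Union>i. g i)"
  then have "\<exists>ds. list_all2 (\<lambda>x d. x \<in> g d) xs ds"
    by (induction xs) (auto simp: list_all2_Cons1)
  with 0 show "\<omega> xs = 0" by blast
qed

text \<open>Forms of different weights are linearly independent: on a list of homogeneous vectors at most one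
  summand is nonzero.\<close>

lemma weight_components_eq_0:
  assumes "finite K" and f: "\<And>k. k \<in> K \<Longrightarrow> multilinear_form (f k)" "\<And>k. k \<in> K \<Longrightarrow> has_weight g k (f k)"
    and sum0: "(\<Sum>k\<in>K. f k) = 0" and "k \<in> K"
  shows "f k = 0"
proof (rule homogeneous_eq_0[OF f(1)[OF \<open>k \<in> K\<close>]])
  fix xs ds assume xs: "list_all2 (\<lambda>x d. x \<in> g d) xs ds"
  show "f k xs = 0"
  proof (cases "sum_list ds + k = 0")
    case True
    then have "(\<Sum>l\<in>K. f l xs) = (\<Sum>l\<in>K. if l = k then f k xs else 0)"
      using f(2) xs by (intro sum.cong) (auto intro!: has_weightD)
    then have "f k xs = (\<Sum>l\<in>K. f l) xs"
      using \<open>finite K\<close> \<open>k \<in> K\<close> by (simp add: sum_form_apply)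
    then show ?thesis by (simp add: sum0)
  qed (use f(2)[OF \<open>k \<in> K\<close>] xs in \<open>auto intro: has_weightD\<close>)
qed

lemma coboundaries_graded_weight:
  assumes "\<omega> \<in> coboundaries_graded g j k"
  shows "multilinear_form \<omega>" "has_weight g k \<omega>"
proof -
  have "multilinear_form 0" "has_weight g k 0"
    by (auto simp: multilinear_form_def has_weight_def)
  with assms show "multilinear_form \<omega>" "has_weight g k \<omega>"
    by (auto simp: coboundaries_graded_def split: nat.splits
        intro!: multilinear_ce_d[OF multilinear_ext_power_graded] has_weight_ce_d[OF ext_power_graded_has_weight])
qed

lemma cocycles_graded_weight:
  assumes "\<omega> \<in> cocycles_graded g j k"
  shows "multilinear_form \<omega>" "has_weight g k \<omega>"
  using assms by (auto simp: cocycles_graded_def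
      intro!: multilinear_ext_power_graded ext_power_graded_has_weight)

context
  assumes fin: "finite {i. g i \<noteq> {0}}"
begin

text \<open>Composing a functional with the projections onto the homogeneous components writes it as a sum of
  homogeneous functionals, and this sum is finite because only finitely many components are nonzero.\<close>

lemma ext_power_expand: "ext_power j \<subseteq> form.span (\<Union>k. ext_power_graded g j k)"
proof -
  let ?I = "{i. g i \<noteq> {0}}" and ?F = "\<Union>i. graded_dual g i"
  have "one_form \<alpha> \<in> form.span (one_form ` ?F)" if \<alpha>: "\<alpha> \<in> dual" for \<alpha>
  proof -
    have eq: "\<alpha> x = (\<Sum>i\<in>?I. \<alpha> (grading_component g x i))" for x
    proof -
      have "{i. grading_component g x i \<noteq> 0} \<subseteq> ?I"
        using grading_component_props(1) by fastforce
      from grading_component_expand[OF fin this] have "\<alpha> x = \<alpha> (\<Sum>i\<in>?I. grading_component g x i)"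
        by (rule arg_cong)
      then show ?thesis unfolding dual_sum[OF \<alpha>] .
    qed
    have "one_form \<alpha> = (\<Sum>i\<in>?I. one_form (\<lambda>x. \<alpha> (grading_component g x i)))"
    proof
      show "one_form \<alpha> xs = (\<Sum>i\<in>?I. one_form (\<lambda>x. \<alpha> (grading_component g x i))) xs" for xs
        using eq[of "hd xs"] by (simp only: sum_form_apply one_form_def) simp
    qed
    then show ?thesis
      by (rule ssubst) (intro form.span_sum form.span_base, use graded_dual_component[OF \<alpha>] in auto)
  qed
  then have "ext_power j \<subseteq> form.span {wedge_list \<beta>s |\<beta>s. length \<beta>s = j \<and> set \<beta>s \<subseteq> ?F}"
    unfolding ext_power_def
    by (intro form.span_minimal[OF _ form.subspace_span]) (auto intro!: wedge_list_expand)
  also have "\<dots> \<subseteq> form.span (\<Union>k. ext_power_graded g j k)"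
  proof (intro form.span_mono subsetI)
    fix \<omega> assume "\<omega> \<in> {wedge_list \<beta>s |\<beta>s. length \<beta>s = j \<and> set \<beta>s \<subseteq> ?F}"
    then obtain \<beta>s where \<beta>s: "\<omega> = wedge_list \<beta>s" "length \<beta>s = j" "set \<beta>s \<subseteq> ?F" by blast
    have "\<exists>is. list_all2 (\<lambda>\<alpha> i. \<alpha> \<in> graded_dual g (- i)) \<beta>s is"
      using \<beta>s(3)
    proof (induction \<beta>s)
      case (Cons \<beta> \<beta>s)
      then obtain i "is" where "\<beta> \<in> graded_dual g (- (- i))" "list_all2 (\<lambda>\<alpha> i. \<alpha> \<in> graded_dual g (- i)) \<beta>s is"
        by auto
      then show ?case by (intro exI[of _ "(- i) # is"]) auto
    qed auto
    then obtain "is" where "list_all2 (\<lambda>\<alpha> i. \<alpha> \<in> graded_dual g (- i)) \<beta>s is" ..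
    then have "\<omega> \<in> ext_power_graded g j (sum_list is)"
      unfolding ext_power_graded_def using \<beta>s
      by (intro form.span_base CollectI exI[of _ \<beta>s] exI[of _ "is"]) (auto dest: list_all2_lengthD)
    then show "\<omega> \<in> (\<Union>k. ext_power_graded g j k)" by blast
  qed
  finally show ?thesis .
qed

lemma ext_power_decompose:
  assumes "\<omega> \<in> ext_power j"
  obtains K f where "finite K" "\<And>k. f k \<in> ext_power_graded g j k" "\<And>k. k \<notin> K \<Longrightarrow> f k = 0" "\<omega> = (\<Sum>k\<in>K. f k)"
proof -
  have "\<omega> \<in> form.span (\<Union>k. ext_power_graded g j k)"
    using assms ext_power_expand by blast
  then have "\<exists>K f. finite K \<and> (\<forall>k. f k \<in> ext_power_graded g j k) \<and> (\<forall>k. k \<notin> K \<longrightarrow> f k = 0) \<and> \<omega> = (\<Sum>k\<in>K. f k)"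
  proof (induction rule: form.span_induct_alt)
    case base
    show ?case
      by (intro exI[of _ "{}"] exI[of _ "\<lambda>_. 0"] conjI allI form.subspace_0[OF subspace_ext_power_graded]) auto
  next
    case (step c \<eta> \<omega>)
    then obtain K f l where K: "finite K" "\<And>k. f k \<in> ext_power_graded g j k" "\<And>k. k \<notin> K \<Longrightarrow> f k = 0"
      "\<omega> = (\<Sum>k\<in>K. f k)" and l: "\<eta> \<in> ext_power_graded g j l" by blast
    define f' where "f' = f(l := form_scale c \<eta> + f l)"
    have "\<omega> = (\<Sum>k\<in>insert l K. f k)"
      unfolding K(4) using K(1,3) by (intro sum.mono_neutral_left) auto
    also have "\<dots> = f l + (\<Sum>k\<in>K - {l}. f k)"
      using K(1) by (rule sum.insert_remove)
    also have "(\<Sum>k\<in>K - {l}. f k) = (\<Sum>k\<in>K - {l}. f' k)"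
      by (intro sum.cong) (auto simp: f'_def)
    finally have "form_scale c \<eta> + \<omega> = f' l + (\<Sum>k\<in>K - {l}. f' k)"
      by (simp only: f'_def fun_upd_same add.assoc)
    also have "\<dots> = (\<Sum>k\<in>insert l K. f' k)"
      using K(1) by (rule sum.insert_remove[symmetric])
    finally have "form_scale c \<eta> + \<omega> = (\<Sum>k\<in>insert l K. f' k)" .
    moreover have "f' k \<in> ext_power_graded g j k" for k
      using K(2) l unfolding f'_def
      by (auto intro!: form.subspace_add[OF subspace_ext_power_graded] form.subspace_scale[OF subspace_ext_power_graded])
    moreover have "f' k = 0" if "k \<notin> insert l K" for k
      using that K(3) by (simp add: f'_def)
    ultimately show ?case
      using K(1) by (intro exI[of _ "insert l K"] exI[of _ f']) blast
  qed
  with that show ?thesis by blast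
qed

lemma coboundaries_decompose:
  assumes "\<omega> \<in> coboundaries j"
  obtains K f where "finite K" "\<And>k. f k \<in> coboundaries_graded g j k" "\<And>k. k \<notin> K \<Longrightarrow> f k = 0" "\<omega> = (\<Sum>k\<in>K. f k)"
proof (cases j)
  case 0
  with assms show ?thesis
    by (intro that[of "{}" "\<lambda>_. 0"]) (auto simp: coboundaries_def coboundaries_graded_def)
next
  case (Suc i)
  with assms obtain \<alpha> where \<alpha>: "\<alpha> \<in> ext_power i" "\<omega> = ce_d \<alpha>"
    by (auto simp: coboundaries_def)
  from ext_power_decompose[OF \<alpha>(1)] obtain K f where "finite K" "\<And>k. f k \<in> ext_power_graded g i k"
    "\<And>k. k \<notin> K \<Longrightarrow> f k = 0" "\<alpha> = (\<Sum>k\<in>K. f k)" by metis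
  then show ?thesis
    using Suc \<alpha>(2) by (intro that[of K "\<lambda>k. ce_d (f k)"]) (auto simp: coboundaries_graded_def ce_d_sum)
qed

text \<open>The differential preserves weights, so the homogeneous components of a cocycle are cocycles.\<close>

lemma cocycles_decompose:
  assumes "\<omega> \<in> cocycles j"
  obtains K f where "finite K" "\<And>k. f k \<in> cocycles_graded g j k" "\<And>k. k \<notin> K \<Longrightarrow> f k = 0" "\<omega> = (\<Sum>k\<in>K. f k)"
proof -
  from ext_power_decompose[of \<omega> j] assms obtain K f where K: "finite K" "\<And>k. f k \<in> ext_power_graded g j k"
    "\<And>k. k \<notin> K \<Longrightarrow> f k = 0" "\<omega> = (\<Sum>k\<in>K. f k)" by (auto simp: cocycles_def)
  have sum0: "(\<Sum>k\<in>K. ce_d (f k)) = 0"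
    using assms K(4) by (simp add: cocycles_def ce_d_sum)
  have "ce_d (f k) = 0" if "k \<in> K" for k
    using K(2) by (intro weight_components_eq_0[OF K(1) _ _ sum0 that])
      (auto intro!: multilinear_ce_d[OF multilinear_ext_power_graded] has_weight_ce_d[OF ext_power_graded_has_weight])
  with K(3) have "ce_d (f k) = 0" for k by (metis ce_d_zero)
  with K show ?thesis by (intro that[of K f]) (auto simp: cocycles_graded_def)
qed

end

end

lemma coset_sum:
  fixes x :: "'k \<Rightarrow> 'a form"
  assumes "form.subspace B" "finite W" "\<And>k. k \<in> W \<Longrightarrow> form.subspace (C k)" "\<And>k. k \<in> W \<Longrightarrow> C k \<subseteq> B"
  shows "(\<Sum>k\<in>W. x k +o C k) + B = (\<Sum>k\<in>W. x k) +o B"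
  using assms(2-)
proof (induction W)
  case empty
  show ?case by (simp only: sum.empty add_0 set_zero_plus)
next
  case (insert l W)
  have "C l + B = B"
  proof
    show "C l + B \<subseteq> B"
      using insert.prems(2)[of l] form.subspace_add[OF assms(1)] by (force simp: set_plus_def)
    show "B \<subseteq> C l + B"
      using set_zero_plus2[OF form.subspace_0[OF insert.prems(1)]] by blast
  qed
  have "(\<Sum>k\<in>insert l W. x k +o C k) + B = (x l +o C l) + ((\<Sum>k\<in>W. x k +o C k) + B)"
    using insert.hyps by (simp add: add.assoc)
  also have "\<dots> = (x l +o C l) + ((\<Sum>k\<in>W. x k) +o B)"
    using insert by simp
  also have "\<dots> = (x l + (\<Sum>k\<in>W. x k)) +o (C l + B)"
    by (simp only: set_plus_rearrange)
  finally show ?case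
    using insert.hyps by (simp only: \<open>C l + B = B\<close> sum.insert not_False_eq_True)
qed

text \<open>The graded pieces always embed independently, because a coboundary decomposes into coboundaries of
  homogeneous forms. They exhaust the cohomology as soon as the weights outside \<open>W\<close> contribute only
  coboundaries.\<close>

lemma cohomology_is_sumI:
  assumes g: "negative_grading g" and fin: "finite {i. g i \<noteq> {0}}" and W: "finite W"
    and vanish: "\<And>k. k \<notin> W \<Longrightarrow> cocycles_graded g j k \<subseteq> coboundaries j"
  shows "cohomology_is_sum g j W"
proof -
  let ?B = "coboundaries j" and ?C = "\<lambda>k. coboundaries_graded g j k"
  let ?F = "\<lambda>X. (\<Sum>k\<in>W. X k) + ?B"
  note sub = subspace_coboundaries subspace_coboundaries_graded[of g j]
  have F: "?F X = (\<Sum>k\<in>W. x k) +o ?B" if "\<And>k. k \<in> W \<Longrightarrow> X k = x k +o ?C k" for X x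
  proof -
    have "?F X = (\<Sum>k\<in>W. x k +o ?C k) + ?B" using that by simp
    also have "\<dots> = (\<Sum>k\<in>W. x k) +o ?B"
      by (intro coset_sum W sub coboundaries_graded_subset)
    finally show ?thesis .
  qed
  have rep: "\<exists>x. (\<forall>k\<in>W. x k \<in> cocycles_graded g j k \<and> X k = x k +o ?C k)"
    if "X \<in> (\<Pi>\<^sub>E k\<in>W. cohomology_graded g j k)" for X
  proof -
    have "\<forall>k\<in>W. \<exists>y. y \<in> cocycles_graded g j k \<and> X k = y +o ?C k"
      using that by (auto simp: cohomology_graded_def form.quotient_space_def PiE_iff)
    then show ?thesis by metis
  qed
  have "inj_on ?F (\<Pi>\<^sub>E k\<in>W. cohomology_graded g j k)"
  proof (rule inj_onI)
    fix X Y assume X: "X \<in> (\<Pi>\<^sub>E k\<in>W. cohomology_graded g j k)"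
      and Y: "Y \<in> (\<Pi>\<^sub>E k\<in>W. cohomology_graded g j k)" and eq: "?F X = ?F Y"
    obtain x where x: "\<And>k. k \<in> W \<Longrightarrow> x k \<in> cocycles_graded g j k" "\<And>k. k \<in> W \<Longrightarrow> X k = x k +o ?C k"
      using rep[OF X] by blast
    obtain y where y: "\<And>k. k \<in> W \<Longrightarrow> y k \<in> cocycles_graded g j k" "\<And>k. k \<in> W \<Longrightarrow> Y k = y k +o ?C k"
      using rep[OF Y] by blast
    from eq have "(\<Sum>k\<in>W. x k) - (\<Sum>k\<in>W. y k) \<in> ?B"
      by (simp only: F[OF x(2)] F[OF y(2)] form.coset_eq_iff[OF sub(1)])
    from coboundaries_decompose[OF g fin this] obtain K f where K: "finite K"
      "\<And>k. f k \<in> ?C k" "\<And>k. k \<notin> K \<Longrightarrow> f k = 0" "(\<Sum>k\<in>W. x k) - (\<Sum>k\<in>W. y k) = (\<Sum>k\<in>K. f k)"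
      by metis
    \<comment> \<open>The components of weight \<open>k\<close> of the two sides of the relation are compared; the
      sums run over different index sets, so both are extended by zero.\<close>
    define h where "h k = (if k \<in> W then x k - y k else 0) - f k" for k
    have "(\<Sum>k\<in>W \<union> K. h k) = (\<Sum>k\<in>W \<union> K. if k \<in> W then x k - y k else 0) - (\<Sum>k\<in>W \<union> K. f k)"
      by (simp only: h_def sum_subtractf)
    also have "(\<Sum>k\<in>W \<union> K. if k \<in> W then x k - y k else 0) = (\<Sum>k\<in>W. x k - y k)"
      using W K(1) by (intro sum.mono_neutral_cong_right) auto
    also have "(\<Sum>k\<in>W \<union> K. f k) = (\<Sum>k\<in>K. f k)"
      using W K(1,3) by (intro sum.mono_neutral_right) auto
    finally have sum0: "(\<Sum>k\<in>W \<union> K. h k) = 0"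
      unfolding sum_subtractf K(4) by (simp only: diff_self)
    have "h k = 0" if "k \<in> W" for k
    proof (rule weight_components_eq_0[OF g _ _ _ sum0])
      note ms = form.subspace_diff[OF subspace_multilinear, simplified]
        form.subspace_diff[OF subspace_has_weight, simplified]
      have z: "multilinear_form 0" "has_weight g k 0" for k
        by (auto simp: multilinear_form_def has_weight_def)
      have "multilinear_form (if k \<in> W then x k - y k else 0)" "has_weight g k (if k \<in> W then x k - y k else 0)" for k
        using z ms cocycles_graded_weight[OF g x(1)] cocycles_graded_weight[OF g y(1)] by auto
      then show "multilinear_form (h k)" "has_weight g k (h k)" for k
        using ms coboundaries_graded_weight[OF g K(2)] unfolding h_def by blast+
    qed (use that W K(1) in auto)
    then have "x k - y k \<in> ?C k" if "k \<in> W" for k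
      using that K(2)[of k] by (simp add: h_def)
    then have "X k = Y k" if "k \<in> W" for k
      using that x(2) y(2) form.coset_eq_iff[OF sub(2)] by metis
    with X Y show "X = Y" by (meson PiE_ext)
  qed
  moreover have "?F ` (\<Pi>\<^sub>E k\<in>W. cohomology_graded g j k) = cohomology j"
  proof
    show "?F ` (\<Pi>\<^sub>E k\<in>W. cohomology_graded g j k) \<subseteq> cohomology j"
    proof
      fix Q assume "Q \<in> ?F ` (\<Pi>\<^sub>E k\<in>W. cohomology_graded g j k)"
      then obtain X where X: "X \<in> (\<Pi>\<^sub>E k\<in>W. cohomology_graded g j k)" "Q = ?F X" by blast
      obtain x where x: "\<And>k. k \<in> W \<Longrightarrow> x k \<in> cocycles_graded g j k" "\<And>k. k \<in> W \<Longrightarrow> X k = x k +o ?C k"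
        using rep[OF X(1)] by blast
      have "(\<Sum>k\<in>W. x k) \<in> cocycles j"
        using x(1) cocycles_graded_subset by (intro form.subspace_sum[OF subspace_cocycles]) blast
      moreover have "Q = (\<Sum>k\<in>W. x k) +o ?B"
        using X(2) by (simp only: F[OF x(2)])
      ultimately show "Q \<in> cohomology j"
        by (auto simp: cohomology_def form.quotient_space_def)
    qed
    show "cohomology j \<subseteq> ?F ` (\<Pi>\<^sub>E k\<in>W. cohomology_graded g j k)"
    proof
      fix Q assume "Q \<in> cohomology j"
      then obtain y where y: "y \<in> cocycles j" "Q = y +o ?B"
        by (auto simp: cohomology_def form.quotient_space_def)
      from cocycles_decompose[OF g fin y(1)] obtain K f where K: "finite K"
        "\<And>k. f k \<in> cocycles_graded g j k" "\<And>k. k \<notin> K \<Longrightarrow> f k = 0" "y = (\<Sum>k\<in>K. f k)"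
        by metis
      have "y = (\<Sum>k\<in>K \<union> W. f k)"
        unfolding K(4) using W K(1,3) by (intro sum.mono_neutral_left) auto
      also have "K \<union> W = (K - W) \<union> W" by blast
      also have "(\<Sum>k\<in>\<dots>. f k) = (\<Sum>k\<in>K - W. f k) + (\<Sum>k\<in>W. f k)"
        using W K(1) by (intro sum.union_disjoint) auto
      finally have "y - (\<Sum>k\<in>W. f k) = (\<Sum>k\<in>K - W. f k)" by simp
      also have "\<dots> \<in> ?B"
        using K(2) vanish by (intro form.subspace_sum[OF sub(1)]) auto
      finally have "Q = (\<Sum>k\<in>W. f k) +o ?B"
        unfolding y(2) by (simp only: form.coset_eq_iff[OF sub(1)])
      also have "\<dots> = ?F (\<lambda>k\<in>W. f k +o ?C k)"
        by (rule F[symmetric]) simp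
      finally show "Q \<in> ?F ` (\<Pi>\<^sub>E k\<in>W. cohomology_graded g j k)"
        by (rule image_eqI[where x = "\<lambda>k\<in>W. f k +o ?C k"]) (use K(2) in \<open>auto simp: cohomology_graded_def form.quotient_space_def\<close>)
    qed
  qed
  ultimately show ?thesis
    by (simp add: cohomology_is_sum_def bij_betw_def)
qed

lemma cohomology_is_sumD:
  assumes "cohomology_is_sum g j W" "finite W" "\<eta> \<in> cocycles j"
  obtains x b where "\<And>k. k \<in> W \<Longrightarrow> x k \<in> cocycles_graded g j k" "b \<in> coboundaries j" "\<eta> = (\<Sum>k\<in>W. x k) + b"
proof -
  let ?B = "coboundaries j" and ?C = "\<lambda>k. coboundaries_graded g j k"
  have "\<eta> +o ?B \<in> cohomology j"
    using assms(3) by (auto simp: cohomology_def form.quotient_space_def)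
  also have "cohomology j = (\<lambda>X. (\<Sum>k\<in>W. X k) + ?B) ` (\<Pi>\<^sub>E k\<in>W. cohomology_graded g j k)"
    using assms(1) by (simp add: cohomology_is_sum_def bij_betw_def)
  finally obtain X where X: "X \<in> (\<Pi>\<^sub>E k\<in>W. cohomology_graded g j k)" "\<eta> +o ?B = (\<Sum>k\<in>W. X k) + ?B"
    by (rule imageE)
  have "\<forall>k\<in>W. \<exists>y. y \<in> cocycles_graded g j k \<and> X k = y +o ?C k"
    using X(1) by (auto simp: cohomology_graded_def form.quotient_space_def PiE_iff)
  then obtain x where x: "\<And>k. k \<in> W \<Longrightarrow> x k \<in> cocycles_graded g j k \<and> X k = x k +o ?C k"
    by metis
  have "(\<Sum>k\<in>W. X k) + ?B = (\<Sum>k\<in>W. x k +o ?C k) + ?B" using x by simp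
  also have "\<dots> = (\<Sum>k\<in>W. x k) +o ?B"
    by (intro coset_sum assms(2) subspace_coboundaries subspace_coboundaries_graded coboundaries_graded_subset)
  finally have "\<eta> - (\<Sum>k\<in>W. x k) \<in> ?B"
    using X(2) form.coset_eq_iff[OF subspace_coboundaries] by metis
  then show ?thesis
    using x by (intro that[of x "\<eta> - (\<Sum>k\<in>W. x k)"]) auto
qed

end

section \<open>Generators and the lower central series\<close>

context complex_lie_algebra
begin

lemma subspace_lower_central: "subspace (lower_central i)"
  by (cases i) auto

lemma bracket_lower_central: "y \<in> lower_central i \<Longrightarrow> bracket x y \<in> lower_central (Suc i)"
  by (auto intro: span_base)

lemma bracket_lower_central': "y \<in> lower_central i \<Longrightarrow> bracket y x \<in> lower_central (Suc i)"
  by (subst bracket_swap) (intro subspace_neg[OF subspace_lower_central] bracket_lower_central)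

lemma lower_central_decreasing: "lower_central (Suc i) \<subseteq> lower_central i"
proof (induction i)
  case (Suc i)
  have "{bracket x y |x y. y \<in> lower_central (Suc i)} \<subseteq> {bracket x y |x y. y \<in> lower_central i}"
    using Suc by blast
  then show ?case
    unfolding lower_central.simps(2)[of "Suc i"] lower_central.simps(2)[of i] by (rule span_mono)
qed simp

text \<open>By the Jacobi identity, bracketing with \<open>[a, b]\<close> is a combination of two iterated brackets, each of
  which goes two steps down.\<close>

lemma bracket_derived:
  assumes "x \<in> lower_central 1" "y \<in> lower_central 1"
  shows "bracket x y \<in> lower_central 3"
proof -
  have three: "lower_central 3 = lower_central (Suc (Suc 1))" by (simp only: numeral_3_eq_3 One_nat_def)
  have "x \<in> span {bracket a b |a b. True}" using assms(1) by simp
  then show ?thesis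
  proof (induction rule: span_induct_alt)
    case base
    show ?case using subspace_0[OF subspace_lower_central, of 3] by simp
  next
    case (step c v u)
    then obtain a b where v: "v = bracket a b" by blast
    have "bracket v y = bracket a (bracket b y) - bracket b (bracket a y)"
      using jacobi_derivation[of a b y] by (simp add: v)
    also have "\<dots> \<in> lower_central 3"
      unfolding three by (intro subspace_diff[OF subspace_lower_central] bracket_lower_central assms(2))
    finally have "scale c (bracket v y) \<in> lower_central 3"
      by (rule subspace_scale[OF subspace_lower_central])
    from subspace_add[OF subspace_lower_central this step(2)] show ?case
      by (simp add: bracket_add_left bracket_scale_left)
  qed
qed

lemma finite_dimensional_basis:
  assumes "finite D" "span D = UNIV"
  obtains B where "finite_dimensional_vector_space scale B"
proof -
  obtain B where B: "B \<subseteq> D" "independent B" "D \<subseteq> span B"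
    using maximal_independent_subset[of D] by blast
  have "span B = UNIV"
    using span_minimal[OF B(3) subspace_span] assms(2) by auto
  with B assms(1) finite_subset have "finite_dimensional_vector_space scale B"
    by unfold_locales auto
  then show ?thesis by (rule that)
qed

lemma span_insert_codim_1:
  assumes fin: "finite D" "span D = UNIV"
    and "subspace S" "subspace T" "S \<subseteq> T" "dim T \<le> dim S + 1" "z \<in> T" "z \<notin> S"
  shows "T = span (insert z S)"
proof -
  obtain B where "finite_dimensional_vector_space scale B"
    using finite_dimensional_basis[OF fin] .
  then interpret fd: finite_dimensional_vector_space scale B .
  have "span (insert z S) \<subseteq> T"
    using assms by (intro span_minimal) auto
  moreover have "dim T \<le> dim (span (insert z S))"
    using assms by (simp add: fd.dim_insert span_eq_iff[THEN iffD2])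
  ultimately show ?thesis
    using fd.subspace_dim_equal[of "span (insert z S)" T] assms(4) by auto
qed

lemma separating_functional:
  assumes "subspace S" "v \<notin> S"
  obtains \<alpha> where "\<alpha> \<in> dual" "\<And>x. x \<in> S \<Longrightarrow> \<alpha> x = 0" "\<alpha> v = 1"
proof -
  obtain A where A: "A \<subseteq> S" "independent A" "S \<subseteq> span A"
    by (metis basis_exists)
  have spanA: "span A = S" using A(1,3) assms(1) by (metis span_minimal subset_antisym)
  have "independent (insert v A)" using A(2) assms(2) spanA by (simp add: independent_insertI)
  then obtain B where B: "insert v A \<subseteq> B" "independent B" "UNIV \<subseteq> span B"
    using maximal_independent_subset_extend[of "insert v A" UNIV] by auto
  then have spanB: "span B = UNIV" by auto
  define \<alpha> where "\<alpha> x = representation B x v" for x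
  have \<alpha>: "\<alpha> \<in> dual"
    by (simp add: in_dual_iff \<alpha>_def representation_add[OF B(2)] representation_scale[OF B(2)] spanB)
  have "A \<subseteq> {x. \<alpha> x = 0}"
  proof
    fix a assume "a \<in> A"
    moreover have "v \<notin> A" using assms(2) A(1) by blast
    ultimately have "a \<in> B" "v \<noteq> a" using B(1) by auto
    then show "a \<in> {x. \<alpha> x = 0}" by (simp add: \<alpha>_def representation_basis[OF B(2)])
  qed
  from span_minimal[OF this subspace_dual_kernel[OF \<alpha>]] have "\<alpha> x = 0" if "x \<in> S" for x
    using that spanA by auto
  moreover have "\<alpha> v = 1" using B(1) by (simp add: \<alpha>_def representation_basis[OF B(2)])
  ultimately show ?thesis using \<alpha> that by blast
qed

lemma wedge_list_single: "wedge_list [\<alpha>] = one_form \<alpha>"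
proof
  have 0: "(\<lambda>ys. form_one (x # ys)) = 0" for x by (auto simp: form_one_def fun_eq_iff)
  show "wedge_list [\<alpha>] xs = one_form \<alpha> xs" for xs
  proof (cases xs)
    case (Cons x ys)
    have "wedge_list [\<alpha>] xs = \<alpha> x * form_one ys"
      unfolding Cons wedge_list_Cons wedge_list_Nil wedge_one_form_apply 0 wedge_zero_right by simp
    then show ?thesis by (simp add: Cons one_form_def form_one_def)
  qed (simp add: one_form_def)
qed

lemma one_form_cocycle:
  assumes "\<alpha> \<in> dual" "\<And>x y. \<alpha> (bracket x y) = 0"
  shows "one_form \<alpha> \<in> cocycles 1"
proof -
  have "wedge_list [\<alpha>] \<in> ext_power 1"
    unfolding ext_power_def using assms(1) by (intro form.span_base CollectI exI[of _ "[\<alpha>]"]) auto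
  moreover have "ce_d (one_form \<alpha>) = 0"
    by (rule ext) (simp add: ce_d_one_form assms(2))
  ultimately show ?thesis by (simp only: wedge_list_single cocycles_def mem_Collect_eq)
qed

text \<open>The first cohomology is the annihilator of the derived algebra. A functional that kills the derived
  algebra and the components of degrees \<open>- 1\<close> and \<open>- 2\<close> is a class that (W) forces to be zero, so nothing
  outside these components is needed to generate the algebra.\<close>

lemma generated_in_degrees_1_2:
  assumes g: "negative_grading g" and W: "cohomology_is_sum g 1 {1, 2}"
  shows "span (g (- 1) \<union> g (- 2) \<union> lower_central 1) = UNIV"
proof (rule ccontr)
  let ?S = "span (g (- 1) \<union> g (- 2) \<union> lower_central 1)"
  assume "?S \<noteq> UNIV"
  then obtain v where "v \<notin> ?S" by blast
  from separating_functional[OF subspace_span this]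
  obtain \<alpha> where \<alpha>: "\<alpha> \<in> dual" "\<And>x. x \<in> ?S \<Longrightarrow> \<alpha> x = 0" "\<alpha> v = 1"
    by metis
  have "\<alpha> (bracket x y) = 0" for x y
    by (intro \<alpha>(2) span_base UnI2) (auto intro: span_base)
  then have "one_form \<alpha> \<in> cocycles 1" by (rule one_form_cocycle[OF \<alpha>(1)])
  then obtain \<omega> b where \<omega>: "\<And>k. k \<in> {1, 2} \<Longrightarrow> \<omega> k \<in> cocycles_graded g 1 k"
    and b: "b \<in> coboundaries 1" and sum: "one_form \<alpha> = (\<Sum>k\<in>{1, 2}. \<omega> k) + b"
    using cohomology_is_sumD[OF W] by (metis finite.emptyI finite.insertI)
  have b0: "b [x] = 0" for x
    using b by (auto simp: coboundaries_def ce_d_Cons)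
  have "\<alpha> x = 0" if x: "x \<in> g i" for x i
  proof (cases "i \<in> {- 1, - 2}")
    case True
    then show ?thesis using x by (intro \<alpha>(2) span_base) auto
  next
    case False
    have "\<omega> k [x] = 0" if "k \<in> {1, 2}" for k
      using cocycles_graded_weight(2)[OF g \<omega>[OF that]] x that False
      by (intro has_weightD[of g k "\<omega> k" _ "[i]"]) auto
    moreover have "\<alpha> x = one_form \<alpha> [x]" by (simp add: one_form_def)
    ultimately show ?thesis unfolding sum by (simp add: b0)
  qed
  then have "\<alpha> = (\<lambda>_. 0)"
    by (intro dual_eqI_homogeneous[OF g \<alpha>(1)]) (auto simp: in_dual_iff)
  with \<alpha>(3) show False by simp
qed

text \<open>The coordinate of \<open>v\<close> on the line spanned by \<open>z\<close>; arbitrary when \<open>v\<close> is not on this line or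
  \<open>z = 0\<close>.\<close>

definition line_coeff :: "'a \<Rightarrow> 'a \<Rightarrow> complex" where
  "line_coeff z v = (SOME c. v = scale c z)"

lemma line_coeff_scale: "v \<in> span {z} \<Longrightarrow> scale (line_coeff z v) z = v"
  unfolding line_coeff_def by (rule sym, rule someI_ex) (auto simp: span_singleton)

lemma line_coeff_eqI: "z \<noteq> 0 \<Longrightarrow> v = scale c z \<Longrightarrow> line_coeff z v = c"
  by (metis line_coeff_scale span_base span_scale scale_cancel_right singletonI)

lemma line_coeff_dual:
  assumes "z \<noteq> 0" and "\<And>s. f s \<in> span {z}"
    and "\<And>s t. f (s + t) = f s + f t" "\<And>c s. f (scale c s) = scale c (f s)"
  shows "(\<lambda>s. line_coeff z (f s)) \<in> dual"
  unfolding in_dual_iff assms(3,4)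
  by (intro conjI allI line_coeff_eqI[OF assms(1)])
    (simp_all add: scale_left_distrib line_coeff_scale assms(2) flip: scale_scale)

text \<open>This is where the second half of (W) fails. On the component of degree \<open>- 2\<close> let \<open>[s, t] = \<omega>(s, t) z\<close> and
  \<open>[s, z] = \<rho>(s) w\<close>. The Jacobi identity gives \<open>\<rho> \<and> \<omega> = 0\<close>, hence \<open>\<omega> = \<rho> \<and> \<mu>\<close> with
  \<open>\<mu> = \<omega>(x, -)\<close>. If \<open>\<zeta>\<close> is dual to \<open>z\<close>, then \<open>d \<zeta> = \<omega>\<close> and \<open>d \<mu> = 0\<close>, so \<open>\<mu> \<and> \<zeta>\<close> is a cocycle of
  weight \<open>6\<close>. It takes the value \<open>1\<close> on the commuting pair \<open>(y, z)\<close>, where coboundaries vanish and where forms of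
  weights \<open>2\<close>, \<open>3\<close>, \<open>4\<close> vanish because \<open>y\<close> and \<open>z\<close> have total degree \<open>- 6\<close>. It is the cohomology class
  of the cubic relation \<open>[y, [x, y]] = 0\<close>.\<close>

lemma weight_6_class_obstruction:
  assumes g: "negative_grading g" and W: "cohomology_is_sum g 2 {2, 3, 4}"
    and x: "x \<in> g (- 2)" and y: "y \<in> g (- 2)"
    and z: "z = bracket x y" and z0: "z \<noteq> 0" and w: "w = bracket x z" and w0: "w \<noteq> 0" and yz: "bracket y z = 0"
    and g3: "g (- 3) \<subseteq> {0}" and g4: "g (- 4) \<subseteq> span {z}" and g6: "g (- 6) \<subseteq> span {w}"
    and derived: "\<And>s t. grading_component g (bracket s t) (- 2) = 0"
  shows False
proof -
  let ?c = "grading_component g"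
  note br = bracket_grading[OF g] and comp = grading_component_props(1)[OF g]
    and hom = grading_component_homogeneous[OF g]
  note lin = grading_component_add[OF g] grading_component_scale[OF g] bracket_add_left bracket_add_right
    bracket_scale_left bracket_scale_right
  define \<mu> where "\<mu> s = line_coeff z (bracket x (?c s (- 2)))" for s
  define \<rho> where "\<rho> s = line_coeff w (bracket (?c s (- 2)) z)" for s
  define \<zeta> where "\<zeta> s = line_coeff z (?c s (- 4))" for s
  have zg: "z \<in> g (- 4)" using br[OF x y] by (simp add: z)
  have in4: "bracket x (?c s (- 2)) \<in> span {z}" for s
    using br[OF x comp[of s "- 2"]] g4 by auto
  have in6: "bracket (?c s (- 2)) z \<in> span {w}" for s
    using br[OF comp[of s "- 2"] zg] g6 by auto
  have in4': "?c s (- 4) \<in> span {z}" for s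
    using comp[of s "- 4"] g4 by auto
  have \<mu>: "\<mu> \<in> dual" unfolding \<mu>_def[abs_def]
    by (intro line_coeff_dual z0 in4) (simp_all add: lin)
  have \<rho>: "\<rho> \<in> dual" unfolding \<rho>_def[abs_def]
    by (intro line_coeff_dual w0 in6) (simp_all add: lin)
  have \<zeta>: "\<zeta> \<in> dual" unfolding \<zeta>_def[abs_def]
    by (intro line_coeff_dual z0 in4') (simp_all add: lin)
  have \<mu>_hom: "\<mu> s = 0" and \<rho>_hom: "\<rho> s = 0" if "s \<in> g i" "i \<noteq> - 2" for s i
    using that unfolding \<mu>_def \<rho>_def by (auto simp: hom intro!: line_coeff_eqI z0 w0)
  have \<zeta>_hom: "\<zeta> s = 0" if "s \<in> g i" "i \<noteq> - 4" for s i
    using that unfolding \<zeta>_def by (auto simp: hom intro!: line_coeff_eqI z0)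
  have \<mu>_eq: "bracket x s = scale (\<mu> s) z" if "s \<in> g (- 2)" for s
    using line_coeff_scale[OF in4[of s]] that by (simp add: \<mu>_def hom)
  have \<rho>_eq: "bracket s z = scale (\<rho> s) w" if "s \<in> g (- 2)" for s
    using line_coeff_scale[OF in6[of s]] that by (simp add: \<rho>_def hom)
  have \<mu>_bracket: "\<mu> (bracket s t) = 0" for s t
    unfolding \<mu>_def derived by (intro line_coeff_eqI z0) simp
  \<comment> \<open>This is \<open>d \<zeta> = \<rho> \<and> \<mu>\<close> on homogeneous vectors. Only two vectors of
    degree \<open>- 2\<close> can have a bracket of degree \<open>- 4\<close>, since the component of
    degree \<open>- 3\<close> is zero.\<close>
  have \<zeta>_bracket_hom: "\<zeta> (bracket s t) = \<rho> s * \<mu> t - \<rho> t * \<mu> s" if s: "s \<in> g i" and t: "t \<in> g j" for s t i j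
  proof (cases "i = - 2 \<and> j = - 2")
    case True
    with s t have s: "s \<in> g (- 2)" and t: "t \<in> g (- 2)" by auto
    have "bracket s t \<in> g (- 4)" using br[OF s t] by simp
    then have st: "bracket s t = scale (\<zeta> (bracket s t)) z"
      using line_coeff_scale[OF in4'[of "bracket s t"]] by (simp add: \<zeta>_def hom)
    have "scale (\<zeta> (bracket s t)) w = bracket x (bracket s t)"
      by (subst st) (simp add: bracket_scale_right w)
    also have "\<dots> = bracket (bracket x s) t + bracket s (bracket x t)"
      by (rule jacobi_derivation)
    also have "\<dots> = scale (\<rho> s * \<mu> t - \<rho> t * \<mu> s) w"
      using bracket_swap[of z t]
      by (simp add: \<mu>_eq s t bracket_scale_left bracket_scale_right \<rho>_eq scale_left_diff_distrib mult.commute)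
    finally show ?thesis using w0 by simp
  next
    case False
    have "\<rho> s * \<mu> t = 0" "\<rho> t * \<mu> s = 0"
      using False \<mu>_hom[OF s] \<mu>_hom[OF t] \<rho>_hom[OF s] \<rho>_hom[OF t] by auto
    moreover have "\<zeta> (bracket s t) = 0"
    proof (cases "i + j = - 4")
      case True
      have "s = 0 \<or> t = 0"
      proof -
        consider "i \<ge> 0" | "j \<ge> 0" | "i = - 1 \<and> j = - 3" | "i = - 3 \<and> j = - 1"
          using True False by linarith
        then show ?thesis
          using s t g3 grading_nonneg[OF g] by cases auto
      qed
      then show ?thesis by (auto simp: dual_0[OF \<zeta>])
    qed (use \<zeta>_hom[OF br[OF s t]] in auto)
    ultimately show ?thesis by (simp only: diff_zero)
  qed
  have \<zeta>_bracket: "\<zeta> (bracket s t) = \<rho> s * \<mu> t - \<rho> t * \<mu> s" for s t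
  proof -
    note d = \<mu>[unfolded in_dual_iff] \<rho>[unfolded in_dual_iff] \<zeta>[unfolded in_dual_iff]
    have hom: "\<zeta> (bracket s t) = \<rho> s * \<mu> t - \<rho> t * \<mu> s" if t: "t \<in> g j" for s t j
      by (rule fun_cong[of "\<lambda>s. \<zeta> (bracket s t)"], rule dual_eqI_homogeneous[OF g])
        (use \<zeta>_bracket_hom t in \<open>auto simp: in_dual_iff lin d algebra_simps\<close>)
    have "(\<lambda>t. \<zeta> (bracket s t)) = (\<lambda>t. \<rho> s * \<mu> t - \<rho> t * \<mu> s)"
      by (intro dual_eqI_homogeneous[OF g])
        (auto simp: in_dual_iff lin d algebra_simps hom)
    then show ?thesis by (rule fun_cong)
  qed
  define \<eta> where "\<eta> = wedge_list [\<mu>, \<zeta>]"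
  have \<eta>2: "\<eta> [s, t] = \<mu> s * \<zeta> t - \<mu> t * \<zeta> s" for s t
    unfolding \<eta>_def by (rule wedge_list_pair)
  have \<eta>_ext: "\<eta> \<in> ext_power 2"
    unfolding ext_power_def \<eta>_def using \<mu> \<zeta> by (intro form.span_base CollectI exI[of _ "[\<mu>, \<zeta>]"]) auto
  have "ce_d \<eta> xs = 0" for xs
  proof (cases "length xs = 3")
    case True
    then obtain a b c where "xs = [a, b, c]"
      by (auto simp: length_Suc_conv numeral_3_eq_3)
    then show ?thesis
      by (simp add: ce_d_triple \<eta>2 \<mu>_bracket \<zeta>_bracket algebra_simps)
  qed (use ext_power_support[OF \<eta>_ext] in \<open>auto intro!: ce_d_support[of 2]\<close>)
  then have "\<eta> \<in> cocycles 2" using \<eta>_ext by (auto simp: cocycles_def)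
  then obtain \<omega> b where \<omega>: "\<And>k. k \<in> {2, 3, 4} \<Longrightarrow> \<omega> k \<in> cocycles_graded g 2 k"
    and b: "b \<in> coboundaries 2" and sum: "\<eta> = (\<Sum>k\<in>{2, 3, 4}. \<omega> k) + b"
    using cohomology_is_sumD[OF W] by (metis finite.emptyI finite.insertI)
  have "\<omega> k [y, z] = 0" if "k \<in> {2, 3, 4}" for k
    using cocycles_graded_weight(2)[OF g \<omega>[OF that]] y zg that
    by (intro has_weightD[of g k "\<omega> k" _ "[- 2, - 4]"]) auto
  moreover have "b [y, z] = 0"
  proof -
    obtain \<alpha> where "\<alpha> \<in> ext_power 1" "b = ce_d \<alpha>"
      using b by (auto simp: coboundaries_def numeral_2_eq_2)
    then show ?thesis
      using multilinear_0_hd[OF multilinear_ext_power, of \<alpha> 1 "[]"] by (simp add: ce_d_pair yz)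
  qed
  ultimately have "\<eta> [y, z] = 0" unfolding sum by simp
  moreover have "\<mu> y = 1"
    unfolding \<mu>_def using y by (intro line_coeff_eqI z0) (simp add: hom z)
  moreover have "\<zeta> z = 1"
    unfolding \<zeta>_def using zg by (intro line_coeff_eqI z0) (simp add: hom)
  moreover have "\<mu> z = 0" using \<mu>_hom[OF zg] by simp
  ultimately show False by (simp add: \<eta>2)
qed

text \<open>The filtration by degree. Lower bounds for the weights in the lower central series are expressed by it,
  which avoids showing that the terms of the series are graded subspaces.\<close>

definition degrees_below :: "(int \<Rightarrow> 'a set) \<Rightarrow> int \<Rightarrow> 'a set" where
  "degrees_below g k = span (\<Union>i\<in>{..- k}. g i)"

context
  fixes g :: "int \<Rightarrow> 'a set"
  assumes g: "negative_grading g"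
begin

lemma subspace_degrees_below: "subspace (degrees_below g k)"
  by (simp add: degrees_below_def)

lemma degrees_below_base: "x \<in> g i \<Longrightarrow> i \<le> - k \<Longrightarrow> x \<in> degrees_below g k"
  unfolding degrees_below_def by (rule span_base) blast

lemma degrees_below_component:
  assumes "x \<in> degrees_below g k" "i > - k"
  shows "grading_component g x i = 0"
  using assms(1) unfolding degrees_below_def
proof (induction rule: span_induct_alt)
  case base
  show ?case using grading_component_homogeneous[OF g grading_0[OF g], of i i] by simp
next
  case (step c a u)
  then obtain j where "j \<le> - k" "a \<in> g j" by blast
  with assms(2) step(2) show ?case
    by (simp add: grading_component_add[OF g] grading_component_scale[OF g] grading_component_homogeneous[OF g])
qed

lemma degrees_below_1: "degrees_below g 1 = UNIV"
proof -
  have "(\<Union>i. g i) \<subseteq> degrees_below g 1"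
  proof
    fix x assume "x \<in> (\<Union>i. g i)"
    then obtain i where i: "x \<in> g i" by blast
    show "x \<in> degrees_below g 1"
    proof (cases "i \<ge> 0")
      case True
      then show ?thesis using i grading_nonneg[OF g True] subspace_0[OF subspace_degrees_below] by auto
    qed (use degrees_below_base[OF i] in auto)
  qed
  from span_minimal[OF this subspace_degrees_below] show ?thesis
    by (auto simp: span_grading[OF g])
qed

lemma bracket_degrees_below:
  assumes "y \<in> degrees_below g k"
  shows "bracket x y \<in> degrees_below g (k + 1)"
  unfolding degrees_below_def
proof (rule bracket_in_span)
  show "x \<in> span (\<Union>i\<in>{..- 1}. g i)" using degrees_below_1 by (simp add: degrees_below_def)
  show "y \<in> span (\<Union>i\<in>{..- k}. g i)" using assms by (simp add: degrees_below_def)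
  fix a b assume "a \<in> (\<Union>i\<in>{..- 1}. g i)" "b \<in> (\<Union>i\<in>{..- k}. g i)"
  then obtain i j where "i \<le> - 1" "j \<le> - k" "a \<in> g i" "b \<in> g j" by auto
  then have "bracket a b \<in> degrees_below g (k + 1)"
    using bracket_grading[OF g, of a i b j] by (intro degrees_below_base[of _ "i + j"]) auto
  then show "bracket a b \<in> span (\<Union>i\<in>{..- (k + 1)}. g i)" by (simp only: degrees_below_def)
qed

lemma lower_central_degrees_below_Suc:
  "lower_central i \<subseteq> degrees_below g k \<Longrightarrow> lower_central (Suc i) \<subseteq> degrees_below g (k + 1)"
  unfolding lower_central.simps
  by (intro span_minimal subspace_degrees_below) (auto intro: bracket_degrees_below)

text \<open>Modulo the next term, \<open>lower_central i\<close> is spanned by \<open>v\<close>, and passing to the next term raises the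
  weight. Hence a bound \<open>k < d\<close> for the weights improves to \<open>k + 1\<close>, and this can be iterated up to \<open>d\<close>.\<close>

lemma lower_central_degrees_below:
  assumes v: "v \<in> g (- d)" and L: "lower_central i = span (insert v (lower_central (Suc i)))" and "1 \<le> d"
  shows "lower_central i \<subseteq> degrees_below g d"
proof -
  have "k \<le> d \<longrightarrow> lower_central i \<subseteq> degrees_below g k" if "1 \<le> k" for k
    using that
  proof (induction k rule: int_ge_induct)
    case base
    show ?case by (simp add: degrees_below_1)
  next
    case (step k)
    show ?case
    proof
      assume "k + 1 \<le> d"
      then have "lower_central (Suc i) \<subseteq> degrees_below g (k + 1)"
        using step by (intro lower_central_degrees_below_Suc) auto
      moreover have "v \<in> degrees_below g (k + 1)"
        using v \<open>k + 1 \<le> d\<close> by (intro degrees_below_base) auto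
      ultimately show "lower_central i \<subseteq> degrees_below g (k + 1)"
        by (subst L) (intro span_minimal[OF _ subspace_degrees_below], blast)
    qed
  qed
  with assms(3) show ?thesis by blast
qed

text \<open>The algebra is spanned by the components of degrees \<open>- 1\<close> and \<open>- 2\<close>, by \<open>z\<close> and \<open>w\<close>, and by
  \<open>lower_central 3\<close>, whose weights exceed \<open>e\<close>. Projecting this spanning set to the component of degree \<open>- k\<close>
  leaves at most \<open>z\<close> and \<open>w\<close>.\<close>

lemma low_degree_components:
  assumes gen: "span (g (- 1) \<union> g (- 2) \<union> lower_central 1) = UNIV"
    and z: "z \<in> g (- d)" "lower_central 1 = span (insert z (lower_central 2))"
    and w: "w \<in> g (- e)" "lower_central 2 = span (insert w (lower_central 3))"
    and de: "2 \<le> d" "d < e" and k: "3 \<le> k" "k \<le> e"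
  shows "g (- k) \<subseteq> span ((if k = d then {z} else {}) \<union> (if k = e then {w} else {}))"
proof
  let ?T = "span ((if k = d then {z} else {}) \<union> (if k = e then {w} else {}))"
  let ?c = "\<lambda>x. grading_component g x (- k)"
  have sub: "subspace {x. ?c x \<in> ?T}"
    by (auto simp: subspace_def grading_component_add[OF g] grading_component_scale[OF g] span_zero
        grading_component_homogeneous[OF g grading_0[OF g], of "- k" "- k"] simp del: insert_iff split del: if_split
        intro!: span_add span_scale)
  have eqs: "lower_central 3 = lower_central (Suc 2)" "lower_central 2 = lower_central (Suc 1)"
    by (simp_all only: numeral_3_eq_3 numeral_2_eq_2 One_nat_def)
  have "lower_central 2 \<subseteq> degrees_below g e"
    using w de unfolding eqs(1) by (intro lower_central_degrees_below[of w]) auto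
  then have "lower_central 3 \<subseteq> degrees_below g (e + 1)"
    unfolding eqs(1) by (rule lower_central_degrees_below_Suc)
  then have "lower_central 3 \<subseteq> {x. ?c x \<in> ?T}"
    using degrees_below_component[of _ "e + 1" "- k"] k by (auto simp: span_zero)
  moreover have "?c w \<in> ?T" "?c z \<in> ?T"
    using z(1) w(1) by (auto simp: grading_component_homogeneous[OF g] span_zero intro: span_base)
  ultimately have "lower_central 1 \<subseteq> {x. ?c x \<in> ?T}"
    unfolding z(2) w(2) by (intro span_minimal[OF _ sub] insert_subsetI) auto
  moreover have "g (- 1) \<subseteq> {x. ?c x \<in> ?T}" "g (- 2) \<subseteq> {x. ?c x \<in> ?T}"
    using k by (auto simp: grading_component_homogeneous[OF g] span_zero)
  ultimately have "span (g (- 1) \<union> g (- 2) \<union> lower_central 1) \<subseteq> {x. ?c x \<in> ?T}"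
    by (intro span_minimal[OF _ sub]) auto
  then have all: "?c x \<in> ?T" for x unfolding gen by auto
  show "x \<in> ?T" if "x \<in> g (- k)" for x
    using all[of x] that by (simp add: grading_component_homogeneous[OF g])
qed

end

text \<open>Brackets of homogeneous generators span \<open>lower_central 1\<close> modulo \<open>lower_central 2\<close>, so one of them
  represents the one-dimensional quotient; the same argument, together with \<open>bracket_derived\<close>, gives a
  representative of the next quotient.\<close>

lemma graded_generators:
  assumes g: "negative_grading g" and gen: "span (g (- 1) \<union> g (- 2) \<union> lower_central 1) = UNIV"
    and fin: "finite D" "span D = UNIV"
    and dim1: "dim (lower_central 1) = dim (lower_central 2) + 1"
    and dim2: "dim (lower_central 2) = dim (lower_central 3) + 1"
  obtains a b c x y u where "a \<in> {1, 2}" "b \<in> {1, 2}" "c \<in> {1, 2}" "x \<in> g (- a)" "y \<in> g (- b)" "u \<in> g (- c)"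
    "bracket x y \<noteq> 0" "bracket u (bracket x y) \<noteq> 0"
    "lower_central 1 = span (insert (bracket x y) (lower_central 2))"
    "lower_central 2 = span (insert (bracket u (bracket x y)) (lower_central 3))"
proof -
  let ?D = "g (- 1) \<union> g (- 2)"
  have eqs: "lower_central 3 = lower_central (Suc 2)" "lower_central 2 = lower_central (Suc 1)"
    by (simp_all only: numeral_3_eq_3 numeral_2_eq_2 One_nat_def)
  have "lower_central 2 \<subseteq> lower_central 1" unfolding eqs(2) by (rule lower_central_decreasing)
  moreover have "lower_central 3 \<subseteq> lower_central 2" unfolding eqs(1) by (rule lower_central_decreasing)
  ultimately have dec: "lower_central 2 \<subseteq> lower_central 1" "lower_central 3 \<subseteq> lower_central 2" .
  note sub = subspace_lower_central
  have "\<exists>x\<in>?D. \<exists>y\<in>?D. bracket x y \<notin> lower_central 2"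
  proof (rule ccontr)
    assume *: "\<not> ?thesis"
    have "bracket s t \<in> span (lower_central 2)" for s t
    proof (rule bracket_in_span)
      show "s \<in> span (?D \<union> lower_central 1)" "t \<in> span (?D \<union> lower_central 1)" by (simp_all only: gen UNIV_I)
      fix a b assume "a \<in> ?D \<union> lower_central 1" "b \<in> ?D \<union> lower_central 1"
      then have "bracket a b \<in> lower_central 2"
        using * bracket_lower_central[of b 1 a] bracket_lower_central'[of a 1 b] unfolding eqs(2) by blast
      then show "bracket a b \<in> span (lower_central 2)" by (rule span_base)
    qed
    then have "{bracket s t |s t. t \<in> lower_central 0} \<subseteq> lower_central 2"
      using sub[of 2] by (auto simp: span_eq_iff[THEN iffD2] simp del: lower_central.simps)
    from span_minimal[OF this sub] have "lower_central 1 \<subseteq> lower_central 2"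
      unfolding One_nat_def lower_central.simps(2)[of 0] .
    with dec have "lower_central 1 = lower_central 2" by auto
    with dim1 show False by (simp only: add_cancel_left_right one_neq_zero add_cancel_right_right)
  qed
  then obtain x y where xy: "x \<in> ?D" "y \<in> ?D" "bracket x y \<notin> lower_central 2" by blast
  let ?z = "bracket x y"
  have z1: "?z \<in> lower_central 1" by (auto intro: span_base)
  have L1: "lower_central 1 = span (insert ?z (lower_central 2))"
    using dim1 dec z1 xy(3) by (intro span_insert_codim_1[OF fin] sub) auto
  have "\<exists>u\<in>?D. bracket u ?z \<notin> lower_central 3"
  proof (rule ccontr)
    assume *: "\<not> ?thesis"
    have "bracket s t \<in> span (lower_central 3)" if "t \<in> lower_central 1" for s t
    proof (rule bracket_in_span)
      show "s \<in> span (?D \<union> lower_central 1)" by (simp only: gen UNIV_I)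
      show "t \<in> span (insert ?z (lower_central 2))" using that L1 by blast
      fix a b assume a: "a \<in> ?D \<union> lower_central 1" and b: "b \<in> insert ?z (lower_central 2)"
      have "b \<in> lower_central 1" using b z1 dec by blast
      then have "bracket a b \<in> lower_central 3" if "a \<in> lower_central 1"
        using bracket_derived that by blast
      moreover have "bracket a b \<in> lower_central 3" if "b \<in> lower_central 2"
        using bracket_lower_central[OF that] unfolding eqs(1) .
      ultimately have "bracket a b \<in> lower_central 3" using a b * by blast
      then show "bracket a b \<in> span (lower_central 3)" by (rule span_base)
    qed
    then have "{bracket s t |s t. t \<in> lower_central 1} \<subseteq> lower_central 3"
      using sub[of 3] by (auto simp: span_eq_iff[THEN iffD2] simp del: lower_central.simps)
    from span_minimal[OF this sub] have "lower_central 2 \<subseteq> lower_central 3"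
      unfolding eqs(2) lower_central.simps(2) .
    with dec have "lower_central 2 = lower_central 3" by auto
    with dim2 show False by (simp only: add_cancel_left_right one_neq_zero add_cancel_right_right)
  qed
  then obtain u where u: "u \<in> ?D" "bracket u ?z \<notin> lower_central 3" by blast
  have "bracket u ?z \<in> lower_central 2" unfolding eqs(2) using z1 by (rule bracket_lower_central)
  then have L2: "lower_central 2 = span (insert (bracket u ?z) (lower_central 3))"
    using dim2 dec u(2) by (intro span_insert_codim_1[OF fin] sub) auto
  have "?z \<noteq> 0" "bracket u ?z \<noteq> 0"
    using xy(3) u(2) subspace_0[OF sub] by metis+
  moreover have deg: "\<exists>a \<in> {1, 2}. v \<in> g (- a)" if "v \<in> ?D" for v
    using that by auto
  obtain a b c where "a \<in> {1, 2}" "x \<in> g (- a)" "b \<in> {1, 2}" "y \<in> g (- b)" "c \<in> {1, 2}" "u \<in> g (- c)"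
    using deg[OF xy(1)] deg[OF xy(2)] deg[OF u(1)] by (elim bexE)
  ultimately show ?thesis using L1 L2 by (intro that[of a b c x y u])
qed

section \<open>Gradings force small dimension\<close>

text \<open>Let \<open>z = [x, y]\<close> and \<open>w = [u, z]\<close> be the representatives from \<open>graded_generators\<close>, of weights \<open>d\<close> and
  \<open>e\<close>, with \<open>x\<close>, \<open>y\<close>, \<open>u\<close> of weight \<open>1\<close> or \<open>2\<close>. If \<open>d = 3\<close> or \<open>e = 3\<close>, the component of degree \<open>- 3\<close> is a
  line, against (H). Otherwise it is zero, and \<open>x\<close>, \<open>y\<close> have the same weight. If the weight of \<open>u\<close> differs from
  it, then \<open>[u, x]\<close> and \<open>[u, y]\<close> have degree \<open>- 3\<close> and vanish, and the Jacobi identity gives \<open>w = 0\<close>. The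
  remaining case, all three of weight \<open>2\<close>, is excluded by \<open>weight_6_class_obstruction\<close>.\<close>

lemma filiform_grading_necessary:
  assumes g: "negative_grading g" and W: "condition_W g" and H: "condition_H g" and p: "filiform p"
  shows "dim (UNIV :: 'a set) < p + 3"
proof (rule ccontr)
  assume "\<not> ?thesis"
  then have p3: "p + 3 \<le> dim (UNIV :: 'a set)" by simp
  obtain D where fin: "finite D" "span D = UNIV"
    using p by (auto simp: filiform_def)
  have dims: "dim (lower_central i) = dim (UNIV :: 'a set) - i - p" if "1 \<le> i" "i \<le> 3" for i
    using p p3 that by (auto simp: filiform_def)
  have gen: "span (g (- 1) \<union> g (- 2) \<union> lower_central 1) = UNIV"
    using generated_in_degrees_1_2[OF g] W by (simp add: condition_W_def)
  have "dim (lower_central 1) = dim (lower_central 2) + 1" "dim (lower_central 2) = dim (lower_central 3) + 1"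
    using dims[of 1] dims[of 2] dims[of 3] p3 by auto
  from graded_generators[OF g gen fin this] obtain a b c x y u where abc: "a \<in> {1, 2}" "b \<in> {1, 2}" "c \<in> {1, 2}"
    and x: "x \<in> g (- a)" and y: "y \<in> g (- b)" and u: "u \<in> g (- c)"
    and z0: "bracket x y \<noteq> 0" and w0: "bracket u (bracket x y) \<noteq> 0"
    and L1: "lower_central 1 = span (insert (bracket x y) (lower_central 2))"
    and L2: "lower_central 2 = span (insert (bracket u (bracket x y)) (lower_central 3))" by metis
  define z w d e where "z = bracket x y" and "w = bracket u z" and "d = a + b" and "e = a + b + c"
  have zg: "z \<in> g (- d)" using bracket_grading[OF g x y] by (simp add: z_def d_def)
  have wg: "w \<in> g (- e)" using bracket_grading[OF g u zg] by (simp add: w_def d_def e_def)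
  have low: "g (- k) \<subseteq> span ((if k = d then {z} else {}) \<union> (if k = e then {w} else {}))" if "3 \<le> k" "k \<le> e" for k
    using abc zg wg L1 L2 that
    by (intro low_degree_components[OF g gen]) (auto simp: z_def w_def d_def e_def)
  have not_line: False if "g (- 3) \<subseteq> span {v}" "v \<in> g (- 3)" "v \<noteq> 0" for v
  proof -
    have "g (- 3) = span {v}"
      using that span_minimal[OF _ subspace_grading[OF g], of "{v}" "- 3"] by auto
    moreover have "dim (span {v}) = card {v}"
      using that(3) by (intro dim_span_eq_card_independent) simp
    ultimately have "dim (g (- 3)) = card {v}" by (simp only:)
    then have "dim (g (- 3)) = 1" by simp
    moreover have "even (dim (g (- 3)))" using H by (simp add: condition_H_def)
    ultimately show False by simp
  qed
  have d3: "d \<noteq> 3"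
    using not_line[of z] low[of 3] zg z0 abc by (auto simp: z_def d_def e_def)
  then have ab: "a = b" using abc by (auto simp: d_def)
  have e3: "e \<noteq> 3"
    using not_line[of w] low[of 3] wg w0 abc d3 by (auto simp: w_def z_def e_def)
  have g3: "g (- 3) \<subseteq> {0}"
    using low[of 3] d3 e3 abc by (auto simp: e_def)
  have jac: "w = bracket (bracket u x) y + bracket x (bracket u y)"
    unfolding w_def z_def by (rule jacobi_derivation)
  show False
  proof (cases "a + c = 3")
    case True
    with ab have "- c + - a = - 3" "- c + - b = - 3" by auto
    then have "bracket u x \<in> g (- 3)" "bracket u y \<in> g (- 3)"
      using bracket_grading[OF g u x] bracket_grading[OF g u y] by metis+
    then have "bracket u x = 0" "bracket u y = 0" using g3 by auto
    then have "w = 0" unfolding jac by simp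
    with w0 show False by (simp add: w_def z_def)
  next
    case False
    with e3 abc ab have a2: "a = 2" "b = 2" "c = 2" by (auto simp: e_def)
    note x = x[unfolded a2] and y = y[unfolded a2] and u = u[unfolded a2]
    have g4: "g (- 4) \<subseteq> span {z}" and g6: "g (- 6) \<subseteq> span {w}"
      using low[of 4] low[of 6] by (auto simp: d_def e_def a2)
    have z0: "z \<noteq> 0" and w0: "w \<noteq> 0" using z0 w0 by (auto simp: z_def w_def)
    have L: "lower_central 1 = span (insert z (lower_central (Suc 1)))"
      using L1 by (simp only: z_def numeral_2_eq_2 One_nat_def)
    have "z \<in> g (- 4)" using zg by (simp add: d_def a2)
    from lower_central_degrees_below[OF g this L] have "lower_central 1 \<subseteq> degrees_below g 4" by simp
    moreover have "bracket s t \<in> lower_central 1" for s t by (auto intro: span_base)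
    ultimately have derived: "grading_component g (bracket s t) (- 2) = 0" for s t
      using degrees_below_component[OF g, of _ 4 "- 2"] by auto
    have W2: "cohomology_is_sum g 2 {2, 3, 4}" using W by (simp add: condition_W_def)
    \<comment> \<open>Unless both \<open>x\<close> and \<open>y\<close> commute with \<open>z\<close>, some basis
      \<open>x'\<close>, \<open>y'\<close> of the plane that they span satisfies these conditions.\<close>
    have obstruction: False if "x' \<in> g (- 2)" "y' \<in> g (- 2)" "z = bracket x' y'" "bracket x' z \<noteq> 0" "bracket y' z = 0"
      for x' y'
    proof -
      have "bracket x' z \<in> g (- 6)" using bracket_grading[OF g that(1) zg] by (simp add: d_def a2)
      then obtain k where k: "bracket x' z = scale k w" using g6 by (auto simp: span_singleton)
      with that(4) have "k \<noteq> 0" by auto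
      then have "w = scale (inverse k) (bracket x' z)" by (simp add: k)
      then have "span {w} \<subseteq> span {bracket x' z}"
        by (intro span_minimal) (auto intro: span_scale span_base)
      with g6 have "g (- 6) \<subseteq> span {bracket x' z}" by auto
      then show False
        using weight_6_class_obstruction[OF g W2 that(1,2,3) z0 refl that(4,5) g3 g4 _ derived] by blast
    qed
    show False
    proof (cases "bracket x z = 0")
      case False
      have in6: "bracket v z \<in> span {w}" if "v \<in> g (- 2)" for v
        using bracket_grading[OF g that zg] g6 by (auto simp: d_def a2)
      obtain k l where k: "bracket x z = scale k w" and l: "bracket y z = scale l w"
        using in6[OF x] in6[OF y] by (auto simp: span_singleton)
      have "k \<noteq> 0" using False k by auto
      \<comment> \<open>Both \<open>[x, z]\<close> and \<open>[y, z]\<close> lie on the line of \<open>w\<close>;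
        subtracting a multiple of \<open>x\<close> from \<open>y\<close> cancels the latter and does
        not change \<open>z\<close>.\<close>
      define y' where "y' = y - scale (l / k) x"
      have "y' \<in> g (- 2)"
        unfolding y'_def by (intro subspace_diff[OF subspace_grading[OF g]] subspace_scale[OF subspace_grading[OF g]] x y)
      moreover have "z = bracket x y'"
        by (simp add: y'_def bracket_diff bracket_scale_right bracket_self z_def)
      moreover have "bracket y' z = 0"
        using \<open>k \<noteq> 0\<close> by (simp add: y'_def bracket_diff bracket_scale_left k l)
      ultimately show False using obstruction[OF x] False by blast
    next
      case True
      have "- x \<in> g (- 2)" by (intro subspace_neg[OF subspace_grading[OF g]] x)
      moreover have "z = bracket y (- x)"
        using bracket_swap[of x y] by (simp add: z_def bracket_minus)
      moreover have "bracket (- x) z = 0" using True by (simp add: bracket_minus)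
      ultimately have yz: "bracket y z = 0" using obstruction[OF y] by blast
      have "bracket u x \<in> span {z}" "bracket u y \<in> span {z}"
        using bracket_grading[OF g u x] bracket_grading[OF g u y] g4 by auto
      then obtain k l where "bracket u x = scale k z" "bracket u y = scale l z"
        by (auto simp: span_singleton)
      then have "w = 0"
        unfolding jac using True yz bracket_swap[of z y] by (simp add: bracket_scale_left bracket_scale_right)
      with w0 show False ..
    qed
  qed
qed

end

section \<open>The square of the differential and symmetries of forms\<close>

context vector_space
begin

text \<open>\<open>Q\<close> exchanges the eigenspaces of \<open>P\<close> for the eigenvalues \<open>1\<close> and \<open>- 1\<close>, which therefore have the same
  dimension.\<close>

lemma even_dim_anticommuting_involutions:
  assumes two: "(2 :: 'a) \<noteq> 0" and C: "subspace C" and fin: "finite D" "C \<subseteq> span D"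
    and P: "\<And>u v. P (u + v) = P u + P v" "\<And>c u. P (scale c u) = scale c (P u)"
    and Q: "\<And>u v. Q (u + v) = Q u + Q v" "\<And>c u. Q (scale c u) = scale c (Q u)"
    and PC: "\<And>v. v \<in> C \<Longrightarrow> P v \<in> C" and QC: "\<And>v. v \<in> C \<Longrightarrow> Q v \<in> C"
    and PP: "\<And>v. v \<in> C \<Longrightarrow> P (P v) = v" and QQ: "\<And>v. v \<in> C \<Longrightarrow> Q (Q v) = v"
    and PQ: "\<And>v. v \<in> C \<Longrightarrow> P (Q v) = - Q (P v)"
  shows "even (dim C)"
proof -
  have P0: "P 0 = 0" using P(2)[of 0 0] by simp
  have Q0: "Q 0 = 0" using Q(2)[of 0 0] by simp
  have Qneg: "Q (- v) = - Q v" for v using Q(2)[of "-1" v] by simp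
  have Pneg: "P (- v) = - P v" for v using P(2)[of "-1" v] by simp
  have Qsum: "Q (\<Sum>b\<in>B. f b) = (\<Sum>b\<in>B. Q (f b))" for B and f :: "'b \<Rightarrow> 'b"
    by (induction B rule: infinite_finite_induct) (simp_all add: Q0 Q)
  define A where "A = {v \<in> C. P v = v}"
  define A' where "A' = {v \<in> C. P v = - v}"
  have A: "subspace A" "subspace A'"
    using C by (auto simp: A_def A'_def subspace_def P0 P)
  have inter: "v = 0" if "v \<in> A" "v \<in> A'" for v
  proof -
    have "P v = v" "P v = - v" using that unfolding A_def A'_def by blast+
    then have "v + v = 0" by (metis eq_neg_iff_add_eq_0)
    then have "scale 2 v = 0" using scale_left_distrib[of 1 1 v] by simp
    with two show ?thesis by simp
  qed
  have QA: "Q v \<in> A'" if "v \<in> A" for v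
    using that by (simp add: A_def A'_def QC PQ)
  have QA': "Q v \<in> A" if "v \<in> A'" for v
    using that by (simp add: A_def A'_def QC PQ Qneg)
  obtain B where B: "B \<subseteq> A" "independent B" "A \<subseteq> span B" by (metis basis_exists)
  have AC: "A \<subseteq> C" by (auto simp: A_def)
  have finB: "finite B"
    using independent_span_bound[OF fin(1) B(2)] B(1) AC fin(2) by blast
  have BC: "B \<subseteq> C" using B(1) AC by (rule subset_trans)
  have inj: "inj_on Q B" by (rule inj_on_inverseI[of _ Q]) (rule QQ, rule subsetD[OF BC])
  have disj: "B \<inter> Q ` B = {}"
  proof -
    have False if v: "v \<in> B" "v \<in> Q ` B" for v
    proof -
      from v(2) obtain b where "b \<in> B" "v = Q b" ..
      then have "v = 0" using v(1) B(1) by (intro inter) (auto intro: QA)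
      with v(1) B(2) dependent_zero[of B] show False by simp
    qed
    then show ?thesis by (intro equals0I) (elim IntE)
  qed
  have "independent (B \<union> Q ` B)"
  proof (rule independent_if_scalars_zero)
    fix f v assume sum0: "(\<Sum>v\<in>B \<union> Q ` B. scale (f v) v) = 0" and v: "v \<in> B \<union> Q ` B"
    let ?a = "\<Sum>v\<in>B. scale (f v) v" and ?a' = "\<Sum>v\<in>B. scale (f (Q v)) v"
    have "(\<Sum>v\<in>B \<union> Q ` B. scale (f v) v) = ?a + (\<Sum>v\<in>Q ` B. scale (f v) v)"
      using finB disj by (intro sum.union_disjoint) auto
    also have "(\<Sum>v\<in>Q ` B. scale (f v) v) = Q ?a'"
      using inj by (simp add: sum.reindex Qsum Q)
    finally have "?a + Q ?a' = 0" using sum0 by simp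
    moreover have a: "?a \<in> A" and a': "?a' \<in> A"
      using B(1) by (auto intro!: subspace_sum[OF A(1)] subspace_scale[OF A(1)])
    ultimately have eq: "?a = - Q ?a'" by (simp add: eq_neg_iff_add_eq_0)
    have "- Q ?a' \<in> A'" using subspace_neg[OF A(2) QA[OF a']] .
    then have a0: "?a = 0" by (intro inter[OF a]) (simp only: eq)
    then have "Q ?a' = 0" using eq by (simp only: neg_equal_0_iff_equal neg_0_equal_iff_equal)
    moreover have "Q (Q ?a') = ?a'" by (rule QQ) (rule subsetD[OF AC a'])
    ultimately have a'0: "?a' = 0" by (simp only: Q0)
    have "\<forall>b\<in>B. f b = 0" "\<forall>b\<in>B. f (Q b) = 0"
      using independentD[OF B(2) finB order.refl a0] independentD[OF B(2) finB order.refl a'0] by blast+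
    with v show "f v = 0" by auto
  qed (use finB in simp)
  moreover have "C \<subseteq> span (B \<union> Q ` B)"
  proof
    fix v assume v: "v \<in> C"
    have half: "scale (1 / 2) (v + P v) + scale (1 / 2) (v - P v) = v"
    proof -
      have "scale (1 / 2) (v + P v) + scale (1 / 2) (v - P v) = scale (1 / 2 + 1 / 2) v"
        unfolding scale_left_distrib scale_right_distrib scale_right_diff_distrib by simp
      also have "(1 / 2 + 1 / 2 :: 'a) = 1" using two by (simp add: field_simps)
      finally show ?thesis by simp
    qed
    have "P (v + P v) = v + P v" "P (v - P v) = - (v - P v)"
      using P(1)[of v "- P v"] PP[OF v] by (simp_all add: P Pneg add.commute)
    then have "v + P v \<in> A" "v - P v \<in> A'"
      using v C PC[OF v] by (auto simp: A_def A'_def intro: subspace_add subspace_diff)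
    have "v + P v \<in> span (B \<union> Q ` B)"
      using \<open>v + P v \<in> A\<close> B(3) span_mono[of B "B \<union> Q ` B"] by auto
    moreover have "v - P v \<in> span (B \<union> Q ` B)"
    proof -
      have "Q (v - P v) \<in> span B" using \<open>v - P v \<in> A'\<close> QA' B(3) by blast
      moreover have "Q u \<in> span (Q ` B)" if "u \<in> span B" for u
        using that
        by (induction rule: span_induct_alt)
          (auto simp: Q0 Q span_zero intro: span_add span_scale span_base)
      ultimately have "Q (Q (v - P v)) \<in> span (Q ` B)" by blast
      moreover have "Q (Q (v - P v)) = v - P v"
        using \<open>v - P v \<in> A'\<close> QQ by (simp add: A'_def)
      ultimately show ?thesis using span_mono[of "Q ` B" "B \<union> Q ` B"] by auto
    qed
    ultimately have "scale (1 / 2) (v + P v) + scale (1 / 2) (v - P v) \<in> span (B \<union> Q ` B)"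
      by (intro span_add[OF span_scale span_scale])
    then show "v \<in> span (B \<union> Q ` B)" by (simp only: half)
  qed
  moreover have "B \<union> Q ` B \<subseteq> C" using BC QC by auto
  ultimately have "dim C = card (B \<union> Q ` B)" by (metis basis_card_eq_dim)
  also have "\<dots> = card B + card B"
    using finB disj inj by (simp add: card_Un_disjoint card_image)
  finally show ?thesis by simp
qed

end

definition pullback :: "('a \<Rightarrow> 'a) \<Rightarrow> 'a form \<Rightarrow> 'a form" where
  "pullback T \<omega> = (\<lambda>xs. \<omega> (map T xs))"

lemma pullback_add: "pullback T (\<omega> + \<eta>) = pullback T \<omega> + pullback T \<eta>"
  by (simp add: pullback_def fun_eq_iff)

lemma pullback_scale: "pullback T (form_scale c \<omega>) = form_scale c (pullback T \<omega>)"
  by (simp add: pullback_def fun_eq_iff form_scale_def)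

lemma pullback_zero: "pullback T 0 = 0"
  by (simp add: pullback_def fun_eq_iff)

lemma pullback_pullback: "pullback S (pullback T \<omega>) = pullback (T \<circ> S) \<omega>"
  by (simp add: pullback_def fun_eq_iff)

lemma pullback_ident: "(\<And>x. T x = x) \<Longrightarrow> pullback T \<omega> = \<omega>"
  by (simp add: pullback_def fun_eq_iff map_idI)

lemma wedge_list_append: "wedge (wedge_list \<alpha>s) (wedge_list \<beta>s) = wedge_list (\<alpha>s @ \<beta>s)"
  by (induction \<alpha>s) (simp_all add: wedge_assoc)

context complex_lie_algebra
begin

lemma ce_d_pullback:
  assumes "\<And>x y. T (bracket x y) = bracket (T x) (T y)"
  shows "ce_d (pullback T \<omega>) = pullback T (ce_d \<omega>)"
  by (rule ext) (simp add: pullback_def ce_d_def assms map_update flip: take_map drop_map)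

lemma pullback_ext_power_graded:
  assumes T: "\<And>x y. T (x + y) = T x + T y" "\<And>c x. T (scale c x) = scale c (T x)"
    and Tg: "\<And>i x. x \<in> g i \<Longrightarrow> T x \<in> g i"
    and \<omega>: "\<omega> \<in> ext_power_graded g j k"
  shows "pullback T \<omega> \<in> ext_power_graded g j k"
  using \<omega> unfolding ext_power_graded_def
proof (induction rule: form.span_induct_alt)
  case base
  show ?case unfolding pullback_zero by (rule form.span_zero)
next
  case (step c a \<omega>)
  from step(1) obtain \<alpha>s "is" where a: "a = wedge_list \<alpha>s" "length is = j" "sum_list is = k"
    "list_all2 (\<lambda>\<alpha> i. \<alpha> \<in> graded_dual g (- i)) \<alpha>s is" by blast
  have "pullback T a = wedge_list (map (\<lambda>\<alpha>. \<alpha> \<circ> T) \<alpha>s)"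
    unfolding a(1) pullback_def by (rule ext) (rule wedge_list_map[symmetric])
  moreover have "list_all2 (\<lambda>\<alpha> i. \<alpha> \<in> graded_dual g (- i)) (map (\<lambda>\<alpha>. \<alpha> \<circ> T) \<alpha>s) is"
    unfolding list_all2_map1
  proof (rule list_all2_mono[OF a(4)])
    fix \<alpha> i assume "\<alpha> \<in> graded_dual g (- i)"
    then show "\<alpha> \<circ> T \<in> graded_dual g (- i)"
      using Tg by (auto simp: graded_dual_def in_dual_iff T)
  qed
  ultimately have "pullback T a \<in> form.span {wedge_list \<alpha>s |\<alpha>s is.
     length is = j \<and> sum_list is = k \<and> list_all2 (\<lambda>\<alpha> i. \<alpha> \<in> graded_dual g (- i)) \<alpha>s is}"
    using a(2,3) by (intro form.span_base) blast
  with step(2) show ?case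
    unfolding pullback_add pullback_scale by (intro form.span_add form.span_scale)
qed

lemma wedge_ext_power_graded:
  assumes "\<omega> \<in> ext_power_graded g i k" "\<eta> \<in> ext_power_graded g j l"
  shows "wedge \<omega> \<eta> \<in> ext_power_graded g (i + j) (k + l)"
  using assms unfolding ext_power_graded_def
proof (rule wedge_in_span)
  fix a b
  assume "a \<in> {wedge_list \<alpha>s |\<alpha>s is. length is = i \<and> sum_list is = k \<and> list_all2 (\<lambda>\<alpha> i. \<alpha> \<in> graded_dual g (- i)) \<alpha>s is}"
    and "b \<in> {wedge_list \<alpha>s |\<alpha>s is. length is = j \<and> sum_list is = l \<and> list_all2 (\<lambda>\<alpha> i. \<alpha> \<in> graded_dual g (- i)) \<alpha>s is}"
  then obtain \<alpha>s "is" \<beta>s js where "a = wedge_list \<alpha>s" "length is = i" "sum_list is = k"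
    "list_all2 (\<lambda>\<alpha> i. \<alpha> \<in> graded_dual g (- i)) \<alpha>s is"
    "b = wedge_list \<beta>s" "length js = j" "sum_list js = l"
    "list_all2 (\<lambda>\<alpha> i. \<alpha> \<in> graded_dual g (- i)) \<beta>s js" by blast
  then show "wedge a b \<in> form.span {wedge_list \<alpha>s |\<alpha>s is. length is = i + j \<and> sum_list is = k + l \<and>
      list_all2 (\<lambda>\<alpha> i. \<alpha> \<in> graded_dual g (- i)) \<alpha>s is}"
    by (intro form.span_base CollectI exI[of _ "\<alpha>s @ \<beta>s"] exI[of _ "is @ js"])
      (simp add: wedge_list_append list_all2_appendI)
qed

lemma ce_d_wedge_one_form:
  "ce_d (wedge (one_form \<alpha>) \<omega>) = wedge (ce_d (one_form \<alpha>)) \<omega> - wedge (one_form \<alpha>) (ce_d \<omega>)"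
proof -
  have "one_form \<alpha> ys = 0" if "length ys \<noteq> 1" for ys
    using that by (simp add: one_form_def)
  from ce_d_wedge[OF this] show ?thesis
    by (simp add: fun_eq_iff form_scale_def)
qed

lemma ce_d_form_one: "ce_d (form_one :: 'a form) = 0"
proof
  show "ce_d (form_one :: 'a form) xs = 0 xs" for xs
    unfolding ce_d_def form_one_def zero_fun_apply by (intro sum.neutral ballI) auto
qed

text \<open>The differential is a derivation, so it maps exterior powers to exterior powers once this is known for
  1-forms.\<close>

lemma ce_d_ext_power_graded:
  assumes one: "\<And>\<alpha> i. \<alpha> \<in> graded_dual g (- i) \<Longrightarrow> ce_d (one_form \<alpha>) \<in> ext_power_graded g 2 i"
    and \<omega>: "\<omega> \<in> ext_power_graded g j k"
  shows "ce_d \<omega> \<in> ext_power_graded g (Suc j) k"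
proof -
  note sub = subspace_ext_power_graded
  have gen: "ce_d (wedge_list \<alpha>s) \<in> ext_power_graded g (Suc (length is)) (sum_list is)"
    if "list_all2 (\<lambda>\<alpha> i. \<alpha> \<in> graded_dual g (- i)) \<alpha>s is" for \<alpha>s "is"
    using that
  proof (induction rule: list_all2_induct)
    case Nil
    show ?case unfolding wedge_list_Nil ce_d_form_one by (rule form.subspace_0[OF sub])
  next
    case (Cons \<alpha> \<alpha>s i "is")
    have "one_form \<alpha> \<in> ext_power_graded g 1 i"
      unfolding ext_power_graded_def wedge_list_single[symmetric]
      using Cons(1) by (intro form.span_base CollectI exI[of _ "[\<alpha>]"] exI[of _ "[i]"]) simp
    moreover have "wedge_list \<alpha>s \<in> ext_power_graded g (length is) (sum_list is)"
      unfolding ext_power_graded_def using Cons(2)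
      by (intro form.span_base CollectI exI[of _ \<alpha>s] exI[of _ "is"]) simp
    ultimately show ?case
      using wedge_ext_power_graded[OF one[OF Cons(1)], of "wedge_list \<alpha>s" "length is" "sum_list is"]
        wedge_ext_power_graded[OF _ Cons(3), of "one_form \<alpha>" 1 i]
      unfolding wedge_list_Cons ce_d_wedge_one_form
      by (intro form.subspace_diff[OF sub]) simp_all
  qed
  from \<omega> show ?thesis
    unfolding ext_power_graded_def[of g j k]
  proof (induction rule: form.span_induct_alt)
    case base
    show ?case unfolding ce_d_zero by (rule form.subspace_0[OF sub])
  next
    case (step c a \<omega>)
    then have "ce_d a \<in> ext_power_graded g (Suc j) k" using gen by auto
    with step(2) show ?case
      unfolding ce_d_plus ce_d_form_scale by (intro form.subspace_add[OF sub] form.subspace_scale[OF sub])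
  qed
qed

text \<open>On 1-forms this is the Jacobi identity, and the Leibniz rule propagates it: the two mixed terms
  cancel.\<close>

lemma ce_d_ce_d:
  assumes "\<omega> \<in> ext_power j"
  shows "ce_d (ce_d \<omega>) = 0"
proof -
  have one: "ce_d (ce_d (one_form \<alpha>)) = 0" if \<alpha>: "\<alpha> \<in> dual" for \<alpha>
  proof
    fix xs :: "'a list"
    show "ce_d (ce_d (one_form \<alpha>)) xs = 0 xs"
    proof (cases "length xs = 3")
      case True
      then obtain a b c where "xs = [a, b, c]"
        by (auto simp: length_Suc_conv numeral_3_eq_3)
      then show ?thesis
        using jacobi_derivation[of a b c]
        by (simp add: ce_d_triple ce_d_one_form dual_add[OF \<alpha>])
    qed (use ce_d_support[of 2 "ce_d (one_form \<alpha>)" xs] in \<open>auto simp: ce_d_one_form\<close>)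
  qed
  have gen: "ce_d (ce_d (wedge_list \<alpha>s)) = 0" if "set \<alpha>s \<subseteq> dual" for \<alpha>s
    using that
  proof (induction \<alpha>s)
    case Nil
    show ?case by (simp only: wedge_list_Nil ce_d_form_one ce_d_zero)
  next
    case (Cons \<alpha> \<alpha>s)
    have 1: "ce_d (wedge (ce_d (one_form \<alpha>)) (wedge_list \<alpha>s)) = wedge (ce_d (one_form \<alpha>)) (ce_d (wedge_list \<alpha>s))"
    proof -
      have "ce_d (one_form \<alpha>) ys = 0" if "length ys \<noteq> 2" for ys using that by (simp add: ce_d_one_form)
      from ce_d_wedge[OF this] show ?thesis
        using one[of \<alpha>] Cons.prems by (simp add: fun_eq_iff form_scale_def wedge_def)
    qed
    have 2: "ce_d (wedge (one_form \<alpha>) (ce_d (wedge_list \<alpha>s))) = wedge (ce_d (one_form \<alpha>)) (ce_d (wedge_list \<alpha>s))"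
    proof -
      have "ce_d (ce_d (wedge_list \<alpha>s)) = 0" using Cons.prems by (intro Cons.IH) simp
      then show ?thesis by (simp only: ce_d_wedge_one_form wedge_zero_right diff_zero)
    qed
    have 3: "ce_d (\<omega> - \<eta>) = ce_d \<omega> - ce_d \<eta>" for \<omega> \<eta> :: "'a form"
      using ce_d_plus[of "\<omega> - \<eta>" \<eta>] by (simp only: diff_add_cancel eq_diff_eq)
    show ?case
      by (simp only: wedge_list_Cons ce_d_wedge_one_form[of \<alpha> "wedge_list \<alpha>s"] 1 2 3 diff_self)
  qed
  from assms show ?thesis
    unfolding ext_power_def
  proof (induction rule: form.span_induct_alt)
    case base
    show ?case by (simp only: ce_d_zero)
  next
    case (step c a \<omega>)
    then have "ce_d (ce_d a) = 0" using gen by auto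
    with step(2) show ?case
      by (simp only: ce_d_plus ce_d_form_scale form.scale_zero_right add_0)
  qed
qed

lemma multilinear_0_mem: "multilinear_form \<omega> \<Longrightarrow> 0 \<in> set xs \<Longrightarrow> \<omega> xs = 0"
  using multilinear_0 by (metis split_list)

lemma multilinear_pullback:
  assumes "\<And>x y. T (x + y) = T x + T y" "\<And>c x. T (scale c x) = scale c (T x)" "multilinear_form \<omega>"
  shows "multilinear_form (pullback T \<omega>)"
  using assms(3) unfolding multilinear_form_def pullback_def by (simp add: assms(1,2))

text \<open>The map \<open>R\<close> is the grading automorphism for the parameter \<open>- 1\<close>.\<close>

lemma pullback_parity:
  assumes g: "negative_grading g" and \<omega>: "multilinear_form \<omega>" "has_weight g k \<omega>" and k: "odd k"
    and R: "\<And>x y. R (x + y) = R x + R y" "\<And>c x. R (scale c x) = scale c (R x)"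
    and hom: "\<And>i x. x \<in> g i \<Longrightarrow> R x = (if even i then x else - x)"
  shows "pullback R \<omega> = - \<omega>"
proof -
  have sign: "\<omega> (map R xs) = (if even (sum_list ds) then \<omega> xs else - \<omega> xs)"
    if "list_all2 (\<lambda>x d. x \<in> g d) xs ds" "multilinear_form \<omega>" for xs ds and \<omega> :: "'a form"
    using that
  proof (induction xs ds arbitrary: \<omega> rule: list_all2_induct)
    case (Cons x xs d ds)
    have "\<omega> (- x # ys) = - \<omega> (x # ys)" for ys
      using multilinear_scale_hd[OF Cons(4), of "- 1" x ys] by simp
    then show ?case
      using Cons(3)[OF multilinear_Cons[OF Cons(4)], of x] hom[OF Cons(1)] by auto
  qed simp
  have "pullback R \<omega> + \<omega> = 0"
  proof (rule homogeneous_eq_0[OF g])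
    show "multilinear_form (pullback R \<omega> + \<omega>)"
      using form.subspace_add[OF subspace_multilinear] multilinear_pullback[OF R \<omega>(1)] \<omega>(1) by auto
    fix xs ds assume xs: "list_all2 (\<lambda>x d. x \<in> g d) xs ds"
    show "(pullback R \<omega> + \<omega>) xs = 0"
    proof (cases "sum_list ds + k = 0")
      case True
      then have "odd (sum_list ds)" using k by presburger
      then show ?thesis using sign[OF xs \<omega>(1)] by (simp add: pullback_def)
    next
      case False
      then show ?thesis using sign[OF xs \<omega>(1)] has_weightD[OF \<omega>(2) xs] by (simp add: pullback_def)
    qed
  qed
  then show ?thesis by (simp only: eq_neg_iff_add_eq_0)
qed

section \<open>Gradings of two-step nilpotent algebras\<close>

definition two_step_grading :: "int \<Rightarrow> 'a set \<Rightarrow> 'a set \<Rightarrow> int \<Rightarrow> 'a set" where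
  "two_step_grading a U W i = (if i = - a then U else if i = - 2 * a then W else {0})"

lemma finite_two_step_grading: "finite {i. two_step_grading a U W i \<noteq> {0}}"
  by (rule finite_subset[of _ "{- a, - 2 * a}"]) (auto simp: two_step_grading_def)

text \<open>Only two elements of \<open>U\<close> can have a nonzero bracket, and this bracket lies in \<open>W\<close>.\<close>

lemma negative_two_step_grading:
  assumes a: "a > 0" and U: "subspace U" and W: "subspace W" and UW: "U \<inter> W \<subseteq> {0}"
    and decomp: "\<And>x. \<exists>u\<in>U. x - u \<in> W"
    and br: "\<And>x y. bracket x y \<in> W" and central: "\<And>x w. w \<in> W \<Longrightarrow> bracket x w = 0"
  shows "negative_grading (two_step_grading a U W)"
proof -
  let ?g = "two_step_grading a U W"
  have gU: "?g (- a) = U" and gW: "?g (- 2 * a) = W" using a by (auto simp: two_step_grading_def)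
  have g0: "?g i = {0}" if "i \<noteq> - a" "i \<noteq> - 2 * a" for i using that by (simp add: two_step_grading_def)
  have sub: "subspace (?g i)" for i using U W by (auto simp: two_step_grading_def subspace_single_0)
  have sum: "finite {i. f i \<noteq> 0}" "(\<Sum>i\<in>{i. f i \<noteq> 0}. f i) = f (- a) + f (- 2 * a)"
    if "\<forall>i. f i \<in> ?g i" for f :: "int \<Rightarrow> 'a"
  proof -
    have supp: "{i. f i \<noteq> 0} \<subseteq> {- a, - 2 * a}" using that g0 by blast
    then show "finite {i. f i \<noteq> 0}" by (rule finite_subset) simp
    have "(\<Sum>i\<in>{i. f i \<noteq> 0}. f i) = (\<Sum>i\<in>{- a, - 2 * a}. f i)"
      using supp by (intro sum.mono_neutral_left) auto
    then show "(\<Sum>i\<in>{i. f i \<noteq> 0}. f i) = f (- a) + f (- 2 * a)" using a by simp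
  qed
  have ex1: "\<exists>!f. (\<forall>i. f i \<in> ?g i) \<and> finite {i. f i \<noteq> 0} \<and> x = (\<Sum>i\<in>{i. f i \<noteq> 0}. f i)" for x
  proof (rule ex_ex1I)
    obtain u where u: "u \<in> U" "x - u \<in> W" using decomp by blast
    define f where "f i = (if i = - a then u else if i = - 2 * a then x - u else 0)" for i
    have f: "\<forall>i. f i \<in> ?g i" using u a by (auto simp: f_def two_step_grading_def)
    moreover have "f (- a) + f (- 2 * a) = x" using a by (simp add: f_def)
    ultimately show "\<exists>f. (\<forall>i. f i \<in> ?g i) \<and> finite {i. f i \<noteq> 0} \<and> x = (\<Sum>i\<in>{i. f i \<noteq> 0}. f i)"
      using sum[OF f] by (intro exI[of _ f]) simp
  next
    fix f h
    assume "(\<forall>i. f i \<in> ?g i) \<and> finite {i. f i \<noteq> 0} \<and> x = (\<Sum>i\<in>{i. f i \<noteq> 0}. f i)"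
      and "(\<forall>i. h i \<in> ?g i) \<and> finite {i. h i \<noteq> 0} \<and> x = (\<Sum>i\<in>{i. h i \<noteq> 0}. h i)"
    then have f: "\<forall>i. f i \<in> ?g i" and h: "\<forall>i. h i \<in> ?g i"
      and eq: "f (- a) + f (- 2 * a) = h (- a) + h (- 2 * a)"
      using sum(2)[of f] sum(2)[of h] by auto
    have fh: "f (- a) \<in> U" "h (- a) \<in> U" "f (- 2 * a) \<in> W" "h (- 2 * a) \<in> W"
      using f h gU gW by metis+
    have diff: "f (- a) - h (- a) = h (- 2 * a) - f (- 2 * a)"
      using eq by (simp add: diff_eq_eq add.commute add_diff_eq) (simp add: algebra_simps)
    have "f (- a) - h (- a) \<in> U \<inter> W"
      using subspace_diff[OF U fh(1,2)] subspace_diff[OF W fh(4,3)] unfolding diff by blast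
    with UW have 0: "f (- a) - h (- a) = 0" by blast
    then have "h (- 2 * a) - f (- 2 * a) = 0" unfolding diff .
    with 0 have "f (- a) = h (- a)" "f (- 2 * a) = h (- 2 * a)" by auto
    moreover have "f i = h i" if "i \<noteq> - a" "i \<noteq> - 2 * a" for i
      using f h g0[OF that] by (metis singletonD)
    ultimately show "f = h" by (metis ext)
  qed
  have "bracket x y \<in> ?g (i + j)" if x: "x \<in> ?g i" and y: "y \<in> ?g j" for x y i j
  proof (cases "i = - a \<and> j = - a")
    case True
    then have "i + j = - 2 * a" by simp
    then show ?thesis using br gW by simp
  next
    case False
    have "x \<in> W \<or> y \<in> W"
      using x y False subspace_0[OF W] by (auto simp: two_step_grading_def split: if_splits)
    then have "bracket x y = 0"
      using central[of y x] central[of x y] bracket_swap[of x y] by auto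
    then show ?thesis using subspace_0[OF sub] by simp
  qed
  moreover have "?g i = {0}" if "i \<ge> 0" for i using g0[of i] that a by auto
  ultimately show ?thesis unfolding negative_grading_def using sub ex1 by blast
qed

lemma cohomology_graded_dim_0:
  assumes "\<And>i. ext_power_graded g i k \<subseteq> {0}"
  shows "cohomology_graded_dim g j k = 0"
proof -
  have z: "cocycles_graded g j k = {0}"
    using assms form.subspace_0[OF subspace_cocycles_graded, of g j k] by (auto simp: cocycles_graded_def)
  have b: "coboundaries_graded g j k \<subseteq> {0}"
  proof (cases j)
    case (Suc i)
    have "ce_d ` ext_power_graded g i k \<subseteq> ce_d ` {0}" using assms by (rule image_mono)
    then show ?thesis unfolding Suc coboundaries_graded_def by simp
  qed (simp add: coboundaries_graded_def)
  then have b: "coboundaries_graded g j k = {0}"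
    using form.subspace_0[OF subspace_coboundaries_graded, of g j k] by auto
  have "form.quotient_dim {0 :: 'a form} {0} = form.dim {0 :: 'a form} - form.dim {0 :: 'a form}"
  proof (rule form.quotient_dim_eq)
    show "finite ({} :: 'a form set)" "{0} \<subseteq> form.span ({} :: 'a form set)" by auto
  qed (auto simp: form.subspace_single_0)
  then show ?thesis unfolding cohomology_graded_dim_def z b by simp
qed

text \<open>All degrees are even, which makes (H) trivial. The first cohomology has weight \<open>2\<close> because \<open>W\<close>
  consists of combinations of brackets; the second has weight \<open>4\<close> as soon as closed 2-forms do not involve \<open>W\<close>.\<close>

lemma conditions_even_grading:
  assumes g: "negative_grading (two_step_grading 2 U W)"
    and derived: "W \<subseteq> lower_central 1"
    and closed: "\<And>\<omega> w v. \<omega> \<in> cocycles 2 \<Longrightarrow> w \<in> W \<Longrightarrow> \<omega> [w, v] = 0"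
  shows "condition_W (two_step_grading 2 U W)" "condition_H (two_step_grading 2 U W)"
proof -
  let ?g = "two_step_grading 2 U W"
  have degree: "x = 0 \<or> (i = - 2 \<and> x \<in> U) \<or> (i = - 4 \<and> x \<in> W)" if "x \<in> ?g i" for x i
    using that by (auto simp: two_step_grading_def split: if_splits)
  have "\<omega> = 0" if \<omega>: "\<omega> \<in> cocycles_graded ?g 1 k" and k: "k \<notin> {1, 2}" for \<omega> k
  proof (rule homogeneous_eq_0[OF g cocycles_graded_weight(1)[OF g \<omega>]])
    note ml = cocycles_graded_weight(1)[OF g \<omega>] and wt = cocycles_graded_weight(2)[OF g \<omega>]
    have ext: "\<omega> \<in> ext_power 1" "ce_d \<omega> = 0"
      using \<omega> ext_power_graded_subset[of ?g 1 k] by (auto simp: cocycles_graded_def)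
    fix xs ds assume xs: "list_all2 (\<lambda>x d. x \<in> ?g d) xs ds"
    show "\<omega> xs = 0"
    proof (cases "length xs = 1 \<and> sum_list ds + k = 0")
      case True
      then obtain x where x: "xs = [x]" by (auto simp: length_Suc_conv)
      then obtain d where d: "ds = [d]" "x \<in> ?g d" using xs by (auto simp: list_all2_Cons1)
      have "lower_central 1 \<subseteq> {x. \<omega> [x] = 0}"
        unfolding One_nat_def lower_central.simps
      proof (rule span_minimal)
        show "subspace {x. \<omega> [x] = 0}"
          by (auto simp: subspace_def multilinear_0_hd[OF ml] multilinear_add_hd[OF ml] multilinear_scale_hd[OF ml])
        show "{bracket x y |x y. y \<in> UNIV} \<subseteq> {x. \<omega> [x] = 0}"
          using ext(2) ce_d_pair[of \<omega>] by auto
      qed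
      then show ?thesis
        using degree[OF d(2)] True d(1) k derived multilinear_0_hd[OF ml, of "[]"] by (auto simp: x)
    qed (use ext_power_support[OF ext(1)] has_weightD[OF wt xs] in auto)
  qed
  then have W1: "cohomology_is_sum ?g 1 {1, 2}"
    using form.subspace_0[OF subspace_coboundaries]
    by (intro cohomology_is_sumI[OF g finite_two_step_grading]) auto
  have "\<omega> = 0" if \<omega>: "\<omega> \<in> cocycles_graded ?g 2 k" and k: "k \<notin> {2, 3, 4}" for \<omega> k
  proof (rule homogeneous_eq_0[OF g cocycles_graded_weight(1)[OF g \<omega>]])
    note ml = cocycles_graded_weight(1)[OF g \<omega>] and wt = cocycles_graded_weight(2)[OF g \<omega>]
    have cocycle: "\<omega> \<in> cocycles 2" using \<omega> cocycles_graded_subset by blast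
    then have ext: "\<omega> \<in> ext_power 2" by (simp add: cocycles_def)
    fix xs ds assume xs: "list_all2 (\<lambda>x d. x \<in> ?g d) xs ds"
    show "\<omega> xs = 0"
    proof (cases "length xs = 2 \<and> sum_list ds + k = 0")
      case True
      then obtain s t where st: "xs = [s, t]" by (auto simp: length_Suc_conv numeral_2_eq_2)
      then obtain d e where de: "ds = [d, e]" "s \<in> ?g d" "t \<in> ?g e" using xs by (auto simp: list_all2_Cons1)
      have "s = 0 \<or> t = 0 \<or> s \<in> W \<or> t \<in> W"
        using degree[OF de(2)] degree[OF de(3)] True de(1) k by auto
      then show ?thesis
        using closed[OF cocycle] ext_power_2_skew[OF ext, of s t] multilinear_0_mem[OF ml, of xs]
        by (auto simp: st)
    qed (use ext_power_support[OF ext] has_weightD[OF wt xs] in auto)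
  qed
  then have "cohomology_is_sum ?g 2 {2, 3, 4}"
    using form.subspace_0[OF subspace_coboundaries]
    by (intro cohomology_is_sumI[OF g finite_two_step_grading]) auto
  with W1 show "condition_W ?g" by (simp add: condition_W_def)
  have "\<omega> = 0" if k: "odd k" and \<omega>: "\<omega> \<in> ext_power_graded ?g j k" for \<omega> j k
  proof (rule homogeneous_eq_0[OF g multilinear_ext_power_graded[OF \<omega>]])
    fix xs ds assume xs: "list_all2 (\<lambda>x d. x \<in> ?g d) xs ds"
    then have "0 \<in> set xs \<or> even (sum_list ds)"
      by (induction rule: list_all2_induct) (use degree in fastforce)+
    moreover have "sum_list ds + k \<noteq> 0" if "even (sum_list ds)" using that k by presburger
    ultimately show "\<omega> xs = 0"
      using multilinear_0_mem[OF multilinear_ext_power_graded[OF \<omega>]]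
        has_weightD[OF ext_power_graded_has_weight[OF \<omega>] xs] by blast
  qed
  then have "cohomology_graded_dim ?g j k = 0" if "odd k" for j k
    using that by (intro cohomology_graded_dim_0) auto
  moreover have "?g k = {0}" if "odd k" for k using that by (auto simp: two_step_grading_def)
  moreover have "dim {0} = 0" by (rule dim_unique[of "{}"]) (auto simp: dependent_def)
  ultimately show "condition_H ?g" by (simp add: condition_H_def)
qed

text \<open>The product of the three-dimensional Heisenberg algebra, spanned by \<open>x\<close>, \<open>y\<close>, \<open>z\<close>, with an abelian algebra.
  Here \<open>x\<close> and \<open>y\<close> get degree \<open>- 1\<close>: the class of \<open>\<xi> \<and> \<zeta>\<close>, with \<open>\<zeta>\<close> dual to \<open>z\<close>, is nonzero and must have
  weight at most \<open>4\<close>. With degrees \<open>- 1\<close> and \<open>- 2\<close> only, \<open>j\<close>-forms have weights between \<open>j\<close> and \<open>2 j\<close>, which is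
  (W). For (H), two graded involutive automorphisms \<open>T\<close> and \<open>S\<close> of the Lie algebra act on cocycles and
  coboundaries; their actions on forms of odd weight anticommute, so both spaces have even dimension.\<close>

lemma conditions_heisenberg_grading:
  assumes fin: "finite D" "span D = UNIV"
    and \<xi>: "\<xi> \<in> dual" "\<xi> x = 1" "\<xi> y = 0" and \<upsilon>: "\<upsilon> \<in> dual" "\<upsilon> x = 0" "\<upsilon> y = 1"
    and br: "\<And>s t. bracket s t = scale (\<xi> s * \<upsilon> t - \<xi> t * \<upsilon> s) z" and z: "\<xi> z = 0" "\<upsilon> z = 0"
  defines "g \<equiv> two_step_grading 1 (span {x, y}) {w. \<xi> w = 0 \<and> \<upsilon> w = 0}"
  shows "negative_grading g" "condition_W g" "condition_H g"
proof -
  let ?U = "span {x, y}" and ?W = "{w. \<xi> w = 0 \<and> \<upsilon> w = 0}"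
  note d = dual_add[OF \<xi>(1)] dual_add[OF \<upsilon>(1)] dual_scale[OF \<xi>(1)] dual_scale[OF \<upsilon>(1)]
    dual_diff[OF \<xi>(1)] dual_diff[OF \<upsilon>(1)] dual_minus[OF \<xi>(1)] dual_minus[OF \<upsilon>(1)] dual_0[OF \<xi>(1)] dual_0[OF \<upsilon>(1)] \<xi>(2,3) \<upsilon>(2,3) z
  have U_expand: "scale (\<xi> u) x + scale (\<upsilon> u) y = u" if "u \<in> ?U" for u
    using that
  proof (induction rule: span_induct_alt)
    case (step c a v)
    have "scale (\<xi> a) x + scale (\<upsilon> a) y = a" using step(1) by (auto simp: d)
    then have "scale c (scale (\<xi> a) x + scale (\<upsilon> a) y) + (scale (\<xi> v) x + scale (\<upsilon> v) y) = scale c a + v"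
      using step(2) by (simp only:)
    then show ?case by (simp add: d scale_left_distrib scale_right_distrib algebra_simps)
  qed (simp add: d)
  show g: "negative_grading g"
    unfolding g_def
  proof (rule negative_two_step_grading)
    show "subspace ?W" by (auto simp: subspace_def d)
    show "?U \<inter> ?W \<subseteq> {0}"
    proof
      fix u assume "u \<in> ?U \<inter> ?W"
      then show "u \<in> {0}" using U_expand[of u] by simp
    qed
    show "\<exists>u\<in>?U. s - u \<in> ?W" for s
      by (rule bexI[of _ "scale (\<xi> s) x + scale (\<upsilon> s) y"])
        (auto simp: d intro: span_add span_scale span_base)
  qed (auto simp: br d)
  have gW: "g (- 2) = ?W" and gU: "g (- 1) = ?U" by (auto simp: g_def two_step_grading_def)
  have degree: "s = 0 \<or> i = - 1 \<or> i = - 2" if "s \<in> g i" for s i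
    using that by (auto simp: g_def two_step_grading_def split: if_splits)
  have finite: "finite {i. g i \<noteq> {0}}" unfolding g_def by (rule finite_two_step_grading)
  have vanish: "\<omega> = 0" if \<omega>: "\<omega> \<in> cocycles_graded g j k" and k: "k < int j \<or> k > 2 * int j" for \<omega> j k
  proof (rule homogeneous_eq_0[OF g cocycles_graded_weight(1)[OF g \<omega>]])
    note ml = cocycles_graded_weight(1)[OF g \<omega>] and wt = cocycles_graded_weight(2)[OF g \<omega>]
    have ext: "\<omega> \<in> ext_power j"
      using \<omega> ext_power_graded_subset[of g j k] by (auto simp: cocycles_graded_def)
    fix xs ds assume xs: "list_all2 (\<lambda>x d. x \<in> g d) xs ds"
    then have "0 \<in> set xs \<or> (- 2 * int (length xs) \<le> sum_list ds \<and> sum_list ds \<le> - int (length xs))"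
      by (induction rule: list_all2_induct) (use degree in fastforce)+
    then show "\<omega> xs = 0"
      using multilinear_0_mem[OF ml] ext_power_support[OF ext, of xs] has_weightD[OF wt xs] k
      by (cases "length xs = j") auto
  qed
  have sum: "cohomology_is_sum g j K" if K: "finite K" "{int j..2 * int j} \<subseteq> K" for j K
  proof (rule cohomology_is_sumI[OF g finite K(1)])
    fix k assume "k \<notin> K"
    then have "k \<notin> {int j..2 * int j}" using K(2) by (rule contra_subsetD[rotated])
    then have "k < int j \<or> k > 2 * int j" by auto
    then have "cocycles_graded g j k \<subseteq> {0}" using vanish by blast
    then show "cocycles_graded g j k \<subseteq> coboundaries j"
      using form.subspace_0[OF subspace_coboundaries, of j] by blast
  qed
  show "condition_W g"
    unfolding condition_W_def
  proof
    show "cohomology_is_sum g 1 {1, 2}" by (rule sum) auto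
    show "cohomology_is_sum g 2 {2, 3, 4}" by (rule sum) auto
  qed
  \<comment> \<open>\<open>T\<close> fixes \<open>y\<close> and negates \<open>x\<close>, \<open>S\<close> exchanges
    \<open>x\<close> and \<open>y\<close>. Both negate the complement, so that they negate \<open>z =
    [x, y]\<close>, as automorphisms must. Their commutator is \<open>R\<close>, which is \<open>-
    1\<close> in degree \<open>- 1\<close> and \<open>1\<close> in degree \<open>- 2\<close>.\<close>
  define T where "T s = scale (\<upsilon> s + \<upsilon> s) y - s" for s
  define S where "S s = scale (\<xi> s + \<upsilon> s) (x + y) - s" for s
  define R where "R s = s - scale (\<xi> s + \<xi> s) x - scale (\<upsilon> s + \<upsilon> s) y" for s
  have T: "T (s + t) = T s + T t" "T (scale c s) = scale c (T s)" for s t c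
    by (auto simp: T_def d scale_left_distrib scale_right_diff_distrib algebra_simps)
  have S: "S (s + t) = S s + S t" "S (scale c s) = scale c (S s)" for s t c
    by (auto simp: S_def d scale_left_distrib scale_right_distrib scale_right_diff_distrib algebra_simps)
  have R: "R (s + t) = R s + R t" "R (scale c s) = scale c (R s)" for s t c
    by (auto simp: R_def d scale_left_distrib scale_right_distrib scale_right_diff_distrib algebra_simps)
  have coords: "\<xi> (T s) = - \<xi> s" "\<upsilon> (T s) = \<upsilon> s" "\<xi> (S s) = \<upsilon> s" "\<upsilon> (S s) = \<xi> s" for s
    by (auto simp: T_def S_def d)
  have TT: "T (T s) = s" and SS: "S (S s) = s" for s
    unfolding T_def[of "T s"] S_def[of "S s"] coords unfolding T_def S_def by (simp_all add: add.commute)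
  have ST: "S (T s) = R (T (S s))" for s
    unfolding R_def S_def[of "T s"] coords unfolding T_def coords unfolding S_def
    unfolding scale_left_distrib scale_right_distrib scale_left_diff_distrib scale_minus_left
    by (simp add: algebra_simps)
  have T_bracket: "T (bracket s t) = bracket (T s) (T t)" and S_bracket: "S (bracket s t) = bracket (S s) (S t)" for s t
    unfolding br coords by (simp_all add: T_def S_def d scale_left_diff_distrib algebra_simps)
  have Tg: "T s \<in> g i" and Sg: "S s \<in> g i" and Rg: "R s = (if even i then s else - s)" if s: "s \<in> g i" for s i
  proof -
    consider "s = 0" | "i = - 1" "s \<in> ?U" | "i = - 2" "s \<in> ?W" using degree[OF s] s gU gW by auto
    then have "T s \<in> g i \<and> S s \<in> g i \<and> R s = (if even i then s else - s)"
    proof cases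
      case 1
      then show ?thesis using grading_0[OF g, of i] by (simp add: T_def S_def R_def d)
    next
      case 2
      have "T s \<in> ?U" "S s \<in> ?U"
        unfolding T_def S_def using 2 by (auto intro!: span_diff span_add span_scale intro: span_base)
      moreover have "R s = s - (scale (\<xi> s) x + scale (\<upsilon> s) y) - (scale (\<xi> s) x + scale (\<upsilon> s) y)"
        unfolding R_def scale_left_distrib by (simp add: algebra_simps)
      then have "R s = - s" by (simp add: U_expand[OF 2(2)])
      ultimately show ?thesis using 2 gU by simp
    next
      case 3
      then show ?thesis using gW by (simp add: T_def S_def R_def d)
    qed
    then show "T s \<in> g i" "S s \<in> g i" "R s = (if even i then s else - s)" by auto
  qed
  have one: "ce_d (one_form \<alpha>) \<in> ext_power_graded g 2 i" if \<alpha>: "\<alpha> \<in> graded_dual g (- i)" for \<alpha> i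
  proof -
    note \<alpha>d = graded_dual_in_dual[OF \<alpha>]
    have eq: "ce_d (one_form \<alpha>) = form_scale (\<alpha> z) (wedge_list [\<xi>, \<upsilon>])"
    proof
      fix xs :: "'a list"
      show "ce_d (one_form \<alpha>) xs = form_scale (\<alpha> z) (wedge_list [\<xi>, \<upsilon>]) xs"
      proof (cases "length xs = 2")
        case True
        then obtain s t where "xs = [s, t]" by (auto simp: length_Suc_conv numeral_2_eq_2)
        then show ?thesis
          using wedge_list_pair[of \<xi> \<upsilon> s t]
          by (simp add: ce_d_one_form form_scale_def br dual_scale[OF \<alpha>d] del: wedge_list_Cons)
      qed (use wedge_list_support[of xs "[\<xi>, \<upsilon>]"] in \<open>simp add: ce_d_one_form form_scale_def del: wedge_list_Cons\<close>)
    qed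
    show ?thesis
    proof (cases "i = 2")
      case True
      have "\<xi> \<in> graded_dual g (- 1)" "\<upsilon> \<in> graded_dual g (- 1)"
        using degree gW \<xi>(1) \<upsilon>(1) by (auto simp: graded_dual_def) (use degree d in fastforce)+
      then have "wedge_list [\<xi>, \<upsilon>] \<in> ext_power_graded g 2 2"
        unfolding ext_power_graded_def by (intro form.span_base CollectI exI[of _ "[\<xi>, \<upsilon>]"] exI[of _ "[1, 1]"]) simp
      then show ?thesis
        unfolding eq True by (rule form.subspace_scale[OF subspace_ext_power_graded])
    next
      case False
      have "z \<in> g (- 2)" using gW z by simp
      then have "\<alpha> z = 0" using \<alpha> False by (auto simp: graded_dual_def dest!: spec[of _ "- 2"])
      then show ?thesis
        unfolding eq using form.subspace_0[OF subspace_ext_power_graded] by (simp add: form.scale_zero_left)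
    qed
  qed
  have BZ: "coboundaries_graded g j k \<subseteq> cocycles_graded g j k" for j k
  proof (cases j)
    case 0
    then show ?thesis using form.subspace_0[OF subspace_cocycles_graded] by (auto simp: coboundaries_graded_def)
  next
    case (Suc i)
    then show ?thesis
      using ce_d_ext_power_graded[OF one] ce_d_ce_d[OF subsetD[OF ext_power_graded_subset]]
      by (auto simp: coboundaries_graded_def cocycles_graded_def)
  qed
  have even_dim: "even (form.dim C)" if C: "form.subspace C" "C \<subseteq> cocycles_graded g j k" and k: "odd k"
    and TC: "\<And>\<omega>. \<omega> \<in> C \<Longrightarrow> pullback T \<omega> \<in> C" and SC: "\<And>\<omega>. \<omega> \<in> C \<Longrightarrow> pullback S \<omega> \<in> C" for C j k
  proof -
    obtain E where E: "finite E" "ext_power j \<subseteq> form.span E"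
      using ext_power_finite[OF fin] by blast
    have anti: "pullback T (pullback S \<omega>) = - pullback S (pullback T \<omega>)" if "\<omega> \<in> C" for \<omega>
    proof -
      have \<omega>: "\<omega> \<in> cocycles_graded g j k" using that C(2) by blast
      have "pullback R \<omega> = - \<omega>"
        by (rule pullback_parity[OF g cocycles_graded_weight[OF g \<omega>] k R Rg])
      then have "pullback S (pullback T (pullback R \<omega>)) = - pullback S (pullback T \<omega>)"
        by (simp add: pullback_def fun_eq_iff)
      moreover have "pullback S (pullback T (pullback R \<omega>)) = pullback T (pullback S \<omega>)"
        by (simp add: pullback_def fun_eq_iff ST o_def)
      ultimately show ?thesis by simp
    qed
    show ?thesis
    proof (rule form.even_dim_anticommuting_involutions[OF _ C(1) E(1), of "pullback T" "pullback S"])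
      show "C \<subseteq> form.span E" using C(2) cocycles_graded_subset[of g j k] E(2) unfolding cocycles_def by blast
      show "pullback T (pullback T \<omega>) = \<omega>" "pullback S (pullback S \<omega>) = \<omega>" for \<omega>
        by (simp_all add: pullback_pullback pullback_ident TT SS)
    qed (simp_all add: pullback_add pullback_scale TC SC anti)
  qed
  have "even (cohomology_graded_dim g j k)" if k: "odd k" for j k
  proof -
    have Z: "pullback f \<omega> \<in> cocycles_graded g j k"
      if "\<omega> \<in> cocycles_graded g j k" "f = T \<or> f = S" for \<omega> f
      using that pullback_ext_power_graded[of T g \<omega> j k] pullback_ext_power_graded[of S g \<omega> j k] T S Tg Sg
      by (auto simp: cocycles_graded_def ce_d_pullback T_bracket S_bracket pullback_zero)
    have B: "pullback f \<omega> \<in> coboundaries_graded g j k"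
      if "\<omega> \<in> coboundaries_graded g j k" "f = T \<or> f = S" for \<omega> f
    proof (cases j)
      case 0
      then show ?thesis using that pullback_zero by (auto simp: coboundaries_graded_def)
    next
      case (Suc i)
      with that obtain \<alpha> where "\<alpha> \<in> ext_power_graded g i k" "\<omega> = ce_d \<alpha>" by (auto simp: coboundaries_graded_def)
      moreover from this have "pullback f \<alpha> \<in> ext_power_graded g i k"
        using that(2) pullback_ext_power_graded[of T g \<alpha> i k] pullback_ext_power_graded[of S g \<alpha> i k] T S Tg Sg by auto
      moreover have "pullback f \<omega> = ce_d (pullback f \<alpha>)"
        using that(2) \<open>\<omega> = ce_d \<alpha>\<close> by (auto simp: ce_d_pullback T_bracket S_bracket)
      ultimately show ?thesis using Suc by (auto simp: coboundaries_graded_def)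
    qed
    obtain E where E: "finite E" "ext_power j \<subseteq> form.span E"
      using ext_power_finite[OF fin] by blast
    have ZE: "cocycles_graded g j k \<subseteq> form.span E"
      using cocycles_graded_subset[of g j k] E(2) unfolding cocycles_def by blast
    have "cohomology_graded_dim g j k = form.dim (cocycles_graded g j k) - form.dim (coboundaries_graded g j k)"
      unfolding cohomology_graded_dim_def
      by (rule form.quotient_dim_eq[OF subspace_cocycles_graded subspace_coboundaries_graded BZ E(1) ZE])
    moreover have "even (form.dim (cocycles_graded g j k))"
      using Z by (intro even_dim[OF subspace_cocycles_graded order.refl k]) auto
    moreover have "even (form.dim (coboundaries_graded g j k))"
      using B by (intro even_dim[OF subspace_coboundaries_graded BZ k]) auto
    ultimately show ?thesis by simp
  qed
  moreover have "even (dim (g k))" if "odd k" for k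
  proof (cases "k = - 1")
    case True
    have "x \<noteq> y" using \<xi>(2,3) by auto
    moreover have "independent {x, y}"
    proof (rule independent_if_scalars_zero)
      fix f v assume "(\<Sum>v\<in>{x, y}. scale (f v) v) = 0" "v \<in> {x, y}"
      then have 0: "scale (f x) x + scale (f y) y = 0" using \<open>x \<noteq> y\<close> by simp
      have "f x = \<xi> (scale (f x) x + scale (f y) y)" "f y = \<upsilon> (scale (f x) x + scale (f y) y)" by (simp_all add: d)
      then have "f x = 0" "f y = 0" unfolding 0 by (simp_all add: d)
      with \<open>v \<in> {x, y}\<close> show "f v = 0" by auto
    qed simp
    ultimately have "dim ?U = 2" by (subst dim_span_eq_card_independent) auto
    then show ?thesis using True gU by simp
  next
    case False
    then have "g k = {0}" using that by (auto simp: g_def two_step_grading_def)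
    moreover have "dim {0} = 0" by (rule dim_unique[of "{}"]) (auto simp: dependent_def)
    ultimately show ?thesis by simp
  qed
  ultimately show "condition_H g" by (simp add: condition_H_def)
qed

lemma abelian_grading:
  assumes "abelian"
  shows "\<exists>g. negative_grading g \<and> condition_W g \<and> condition_H g"
proof -
  have br: "bracket x y = 0" for x y using assms by (simp add: abelian_def)
  have g: "negative_grading (two_step_grading 2 UNIV {0})"
    by (rule negative_two_step_grading) (auto simp: br subspace_single_0)
  have "\<omega> [0, v] = 0" if "\<omega> \<in> cocycles 2" for \<omega> v
    using that multilinear_0_hd[OF multilinear_ext_power] by (auto simp: cocycles_def)
  then have "condition_W (two_step_grading 2 UNIV {0})" "condition_H (two_step_grading 2 UNIV {0})"
    using subspace_0[OF subspace_lower_central] by (auto intro!: conditions_even_grading[OF g])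
  with g show ?thesis by blast
qed

text \<open>Let \<open>z = [x, y]\<close> and let \<open>\<xi>\<close>, \<open>\<upsilon>\<close> be the coordinates modulo the common centraliser of \<open>x\<close> and \<open>y\<close>. If this
  centraliser is abelian, it is central and the algebra is Heisenberg times abelian. Otherwise the bracket,
  viewed as an alternating bilinear form, has rank at least four. Then a closed 2-form vanishes on every pair containing \<open>z\<close>:
  evaluating its differential on a vector \<open>c\<close> and a pair \<open>a\<close>, \<open>b\<close> that commutes with \<open>c\<close> but not with each other leaves
  only the term with \<open>[a, b]\<close> and \<open>c\<close>, and rank four provides such a pair for each \<open>c\<close>. So \<open>z\<close> may get degree \<open>- 4\<close> and a complementary
  hyperplane degree \<open>- 2\<close>.\<close>

lemma line_derived_grading:
  assumes fin: "finite D" "span D = UNIV" and "bracket x y \<noteq> 0"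
    and derived: "lower_central 1 = span {bracket x y}" and nil: "lower_central 2 = {0}"
  shows "\<exists>g. negative_grading g \<and> condition_W g \<and> condition_H g"
proof -
  define z where "z = bracket x y"
  have z0: "z \<noteq> 0" using assms(3) by (simp add: z_def)
  have in_z: "bracket s t \<in> span {z}" for s t
  proof -
    have "bracket s t \<in> lower_central 1" by (auto intro: span_base)
    then show ?thesis unfolding derived z_def .
  qed
  have central: "bracket s w = 0" if "w \<in> span {z}" for s w
  proof -
    have "w \<in> lower_central 1" using that unfolding derived z_def .
    from bracket_lower_central[OF this] have "bracket s w \<in> lower_central 2" by (simp only: numeral_2_eq_2 One_nat_def)
    then show ?thesis by (simp add: nil)
  qed
  have zz: "z \<in> span {z}" by (simp add: span_base)
  define \<upsilon> where "\<upsilon> s = line_coeff z (bracket x s)" for s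
  define \<xi> where "\<xi> s = line_coeff z (bracket s y)" for s
  have \<upsilon>: "\<upsilon> \<in> dual" unfolding \<upsilon>_def[abs_def]
    by (intro line_coeff_dual z0 in_z) (simp_all add: bracket_add_right bracket_scale_right)
  have \<xi>: "\<xi> \<in> dual" unfolding \<xi>_def[abs_def]
    by (intro line_coeff_dual z0 in_z) (simp_all add: bracket_add_left bracket_scale_left)
  have xs: "bracket x s = scale (\<upsilon> s) z" and sy: "bracket s y = scale (\<xi> s) z" for s
    by (simp_all add: \<upsilon>_def \<xi>_def line_coeff_scale in_z)
  have vals: "\<upsilon> x = 0" "\<upsilon> y = 1" "\<xi> x = 1" "\<xi> y = 0"
    unfolding \<upsilon>_def \<xi>_def
    by (rule line_coeff_eqI[OF z0], simp add: bracket_self z_def)+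
  have zero: "bracket x w = 0" "bracket w y = 0" "bracket w x = 0" "bracket y w = 0" if "\<xi> w = 0" "\<upsilon> w = 0" for w
    using that xs[of w] sy[of w] bracket_swap[of w x] bracket_swap[of y w] by auto
  \<comment> \<open>The component of \<open>s\<close> in the common centraliser of \<open>x\<close> and
    \<open>y\<close>.\<close>
  define r where "r s = s - scale (\<xi> s) x - scale (\<upsilon> s) y" for s
  have r: "\<xi> (r s) = 0" "\<upsilon> (r s) = 0" for s
    by (simp_all add: r_def dual_diff[OF \<xi>] dual_diff[OF \<upsilon>] dual_scale[OF \<xi>] dual_scale[OF \<upsilon>] vals)
  have s_eq: "s = scale (\<xi> s) x + scale (\<upsilon> s) y + r s" for s by (simp add: r_def)
  have br: "bracket s t = scale (\<xi> s * \<upsilon> t - \<xi> t * \<upsilon> s) z + bracket (r s) (r t)" for s t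
  proof -
    have "bracket s t = bracket (scale (\<xi> s) x + scale (\<upsilon> s) y + r s) (scale (\<xi> t) x + scale (\<upsilon> t) y + r t)"
      by (rule arg_cong2[of _ _ _ _ bracket]) (rule s_eq)+
    also have "\<dots> = scale (\<xi> s * \<upsilon> t) (bracket x y) + scale (\<upsilon> s * \<xi> t) (bracket y x) + bracket (r s) (r t)"
      by (simp add: bracket_add_left bracket_add_right bracket_scale_left bracket_scale_right bracket_self zero r
          add.commute mult.commute)
    also have "\<dots> = scale (\<xi> s * \<upsilon> t - \<xi> t * \<upsilon> s) z + bracket (r s) (r t)"
      using bracket_swap[of y x] by (simp add: z_def scale_left_diff_distrib mult.commute)
    finally show ?thesis .
  qed
  show ?thesis
  proof (cases "\<forall>v w. \<xi> v = 0 \<longrightarrow> \<upsilon> v = 0 \<longrightarrow> \<xi> w = 0 \<longrightarrow> \<upsilon> w = 0 \<longrightarrow> bracket v w = 0")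
    case True
    then have br': "bracket s t = scale (\<xi> s * \<upsilon> t - \<xi> t * \<upsilon> s) z" for s t
      using br[of s t] r by simp
    have "\<xi> z = 0" "\<upsilon> z = 0"
      using central[OF zz, of x] central[OF zz, of y] bracket_swap[of z y] xs[of z] sy[of z] z0 by auto
    from conditions_heisenberg_grading[OF fin \<xi> vals(3,4) \<upsilon> vals(1,2) br' this]
    show ?thesis by blast
  next
    case False
    then obtain v w where v: "\<xi> v = 0" "\<upsilon> v = 0" and w: "\<xi> w = 0" "\<upsilon> w = 0" and vw: "bracket v w \<noteq> 0"
      by blast
    obtain \<alpha> where \<alpha>: "\<alpha> \<in> dual" "\<alpha> z = 1"
      using separating_functional[OF subspace_single_0, of z] z0 by blast
    let ?g = "two_step_grading 2 {s. \<alpha> s = 0} (span {z})"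
    have g: "negative_grading ?g"
    proof (rule negative_two_step_grading)
      show "{s. \<alpha> s = 0} \<inter> span {z} \<subseteq> {0}"
        using \<alpha> by (auto simp: span_singleton dual_scale)
      show "\<exists>u\<in>{s. \<alpha> s = 0}. s - u \<in> span {z}" for s
        using \<alpha> by (intro bexI[of _ "s - scale (\<alpha> s) z"]) (auto simp: dual_diff dual_scale intro: span_scale span_base)
    qed (use in_z central subspace_dual_kernel[OF \<alpha>(1)] in auto)
    have "\<omega> [s, t] = 0" if \<omega>: "\<omega> \<in> cocycles 2" and s: "s \<in> span {z}" for \<omega> s t
    proof -
      have ml: "multilinear_form \<omega>" using \<omega> multilinear_ext_power by (auto simp: cocycles_def)
      have closed: "\<omega> [bracket a b, c] + \<omega> [b, bracket a c] - \<omega> [a, bracket b c] = 0" for a b c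
        using \<omega> ce_d_triple[of \<omega> a b c] by (simp add: cocycles_def)
      have vanish: "\<omega> [z, c] = 0" if "bracket a c = 0" "bracket b c = 0" "bracket a b \<noteq> 0" for a b c
      proof -
        obtain k where k: "bracket a b = scale k z" using in_z[of a b] by (auto simp: span_singleton)
        have "\<omega> [bracket a b, c] = 0"
          using closed[of a b c] multilinear_0_mem[OF ml, of "[b, 0]"] multilinear_0_mem[OF ml, of "[a, 0]"]
          by (simp add: that)
        then show ?thesis using that(3) by (simp add: k multilinear_scale_hd[OF ml])
      qed
      have lin: "\<omega> [z, a + b] = \<omega> [z, a] + \<omega> [z, b]" "\<omega> [z, scale c a] = c * \<omega> [z, a]" for a b c
        using multilinear_add[OF ml, of "[z]" a b "[]"] multilinear_scale[OF ml, of "[z]" c a "[]"] by auto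
      have "\<omega> [z, x] = 0" "\<omega> [z, y] = 0"
        using vanish[of v x w] vanish[of v y w] vw zero[OF v] zero[OF w] by auto
      moreover have "\<omega> [z, r t] = 0"
        using vanish[of x "r t" y] zero[OF r] assms(3) by auto
      ultimately have "\<omega> [z, t] = 0"
        by (subst s_eq[of t]) (simp add: lin)
      with s show ?thesis by (auto simp: span_singleton multilinear_scale_hd[OF ml])
    qed
    moreover have "span {z} \<subseteq> lower_central 1" unfolding derived z_def by simp
    ultimately have "condition_W ?g" "condition_H ?g"
      using conditions_even_grading[OF g] by blast+
    with g show ?thesis by blast
  qed
qed

section \<open>Filiform algebras of small dimension\<close>

lemma subspace_dim_0:
  assumes "finite D" "span D = UNIV" "subspace S"
  shows "dim S = 0 \<longleftrightarrow> S = {0}"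
proof -
  obtain B where "finite_dimensional_vector_space scale B"
    using finite_dimensional_basis[OF assms(1,2)] .
  then interpret fd: finite_dimensional_vector_space scale B .
  show ?thesis using subspace_0[OF assms(3)] by auto
qed

lemma abelian_iff: "abelian \<longleftrightarrow> lower_central 1 = {0}"
proof
  assume "abelian"
  then show "lower_central 1 = {0}" by (simp add: abelian_def)
next
  assume L: "lower_central 1 = {0}"
  have "bracket x y \<in> lower_central 1" for x y by (auto intro: span_base)
  with L show "abelian" by (simp add: abelian_def)
qed

text \<open>The dimensions of the lower central series show that \<open>m = p + 1\<close> means abelian, \<open>m = p + 2\<close> means 2-step
  nilpotent, and for \<open>m \<ge> p + 3\<close> the third term of the series, \<open>lower_central 2\<close>, is still nonzero.\<close>

lemma filiform_small_iff:
  assumes p: "filiform p"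
  shows "dim (UNIV :: 'a set) < p + 3 \<longleftrightarrow> abelian \<or> step_nilpotent 2"
proof -
  obtain D where fin: "finite D" "span D = UNIV" using p by (auto simp: filiform_def)
  have m: "p < dim (UNIV :: 'a set)" using p by (auto simp: filiform_def)
  have dims: "dim (lower_central i) = dim (UNIV :: 'a set) - i - p" if "1 \<le> i" "i \<le> dim (UNIV :: 'a set) - p" for i
    using p that by (auto simp: filiform_def)
  note zero = subspace_dim_0[OF fin subspace_lower_central]
  have step: "step_nilpotent 2 \<longleftrightarrow> lower_central 2 = {0} \<and> lower_central 1 \<noteq> {0}"
    by (simp add: step_nilpotent_def)
  show ?thesis
  proof (cases "dim (UNIV :: 'a set) = p + 1")
    case True
    then show ?thesis using dims[of 1] zero[of 1] by (simp add: abelian_iff del: lower_central.simps)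
  next
    case False
    with m have m2: "p + 2 \<le> dim (UNIV :: 'a set)" by simp
    then have "lower_central 1 \<noteq> {0}" using dims[of 1] zero[of 1] by auto
    moreover have "lower_central 2 = {0} \<longleftrightarrow> dim (UNIV :: 'a set) < p + 3"
      using dims[of 2] zero[of 2] m2 by auto
    ultimately show ?thesis unfolding abelian_iff step by blast
  qed
qed

lemma filiform_grading_sufficient:
  assumes p: "filiform p" and m: "dim (UNIV :: 'a set) < p + 3"
  shows "\<exists>g. negative_grading g \<and> condition_W g \<and> condition_H g"
proof (cases abelian)
  case True
  then show ?thesis by (rule abelian_grading)
next
  case False
  obtain D where fin: "finite D" "span D = UNIV" using p by (auto simp: filiform_def)
  from False filiform_small_iff[OF p] m have nil: "lower_central 2 = {0}" by (simp add: step_nilpotent_def)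
  obtain x y where xy: "bracket x y \<noteq> 0" using False by (auto simp: abelian_def)
  have "dim (lower_central 1) \<le> dim {0} + 1"
    using p m by (auto simp: filiform_def)
  moreover have "bracket x y \<in> lower_central 1" by (auto intro: span_base)
  ultimately have "lower_central 1 = span (insert (bracket x y) {0})"
    using xy subspace_0[OF subspace_lower_central]
    by (intro span_insert_codim_1[OF fin] subspace_lower_central subspace_single_0)
      (simp_all del: lower_central.simps One_nat_def)
  then have "lower_central 1 = span {bracket x y}"
    by (simp only: insert_commute[of "bracket x y" 0] span_insert_0)
  from line_derived_grading[OF fin xy this nil] show ?thesis .
qed

end

theorem theorem4p0p4:
  fixes scale :: "complex \<Rightarrow> 'a::ab_group_add \<Rightarrow> 'a"
    and bracket :: "'a \<Rightarrow> 'a \<Rightarrow> 'a"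
    and p :: nat
  assumes "complex_lie_algebra scale bracket"
    and "p \<ge> 1"
    and "complex_lie_algebra.filiform scale bracket p"
  shows "((\<exists>g. complex_lie_algebra.negative_grading scale bracket g \<and>
               complex_lie_algebra.condition_W scale bracket g \<and>
               complex_lie_algebra.condition_H scale bracket g) \<longleftrightarrow>
           vector_space.dim scale (UNIV :: 'a set) < p + 3)
       \<and> ((\<exists>g. complex_lie_algebra.negative_grading scale bracket g \<and>
               complex_lie_algebra.condition_W scale bracket g \<and>
               complex_lie_algebra.condition_H scale bracket g) \<longleftrightarrow>
           complex_lie_algebra.abelian bracket \<or>
           complex_lie_algebra.step_nilpotent scale bracket 2)"
proof -
  interpret complex_lie_algebra scale bracket by fact
  have "(\<exists>g. negative_grading g \<and> condition_W g \<and> condition_H g) \<longleftrightarrow> dim (UNIV :: 'a set) < p + 3"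
    using filiform_grading_necessary filiform_grading_sufficient assms(3) by blast
  with filiform_small_iff[OF assms(3)] show ?thesis by blast
qed

end
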